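(* Let $T$ be an oriented 4-tangle with diagram $D_T$, and let $K$ be a classical long knot with diagram $D$. Let $Q$ be a finite quandle, $q\in Q$ and $x\in Q$. If $T$ embeds into $K$, then either the formal sum $$S^{x}_1(T)=\sum_{\zeta\in Col_Q^q(D_T)}(\phi_{\zeta}^1\cdot \phi_{\zeta}^2)(x)$$ or the formal sum $$S^{x}_2(T)=\sum_{\zeta\in Col_Q^q(D_T)}(\phi_{\zeta}^2\cdot \phi_{\zeta}^1)(x)$$ is included in the formal sum $$S^{x}_{\Phi}(K)=\sum_{\zeta\in Col(D,Q,q)}\phi_{\zeta}(x).$$ Consequently, if this condition is not satisfied for some choice of $Q$, $q$ and $x\in Q$, then $T$ does not embed into the long knot $K$.
   Context: **Quandles.** A quandle is a set $Q$ with two binary operations $\ast,\bar\ast$ such that for all $x,y,z\in Q$: $x\ast x=x$; $(x\ast y)\,\bar\ast\, y=x=(x\,\bar\ast\, y)\ast y$; $(x\ast y)\ast z=(x\ast z)\ast(y\ast z)$. The symbol $\ast^{\epsilon}$ denotes one of $\ast,\bar\ast$, and $\ast^{-\epsilon}$ denotes the opposite one. Products without parentheses are left-associated: $a\ast^{\epsilon_1}b\ast^{\epsilon_2}c=(a\ast^{\epsilon_1}b)\ast^{\epsilon_2}c$. For each $y\in Q$ the maps $x\mapsto x\ast y$ and $x\mapsto x\,\bar\ast\, y$ are automorphisms of $Q$. **Long knots.** A long knot diagram is a smooth immersion $f\colon\mathbb{R}\to\mathbb{R}^2$ with crossing information at each double point and $f(x)=(x,0)$ for $|x|$ large, oriented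 from left to right. A long knot is represented by such a diagram up to Reidemeister moves. **Colorings.** The normal of an arc of an oriented diagram is chosen so that (tangent, normal) matches the orientation of the plane. A quandle coloring of a diagram by $Q$ is a map $C$ from its set of arcs to $Q$ such that at each crossing with over-arc $r$, if $r_1$ is the under-arc such that the normal of $r$ points away from it and $r_2$ is the other under-arc, then $C(r_2)=C(r_1)\ast C(r)$. For a long knot diagram $D$, $Col(D,Q,q)$ is the set of all colorings of $D$ by $Q$ in which the initial arc has color $q$. **Colored quandle longitudes.** Let $D$ be a diagram of a long knot $K$ with $n$ crossings. Travelling along $D$ from left to right, label its arcs consecutively $x_1,\dots,x_{n+1}$. Let $x_{o(i)}$ be the over-arc encountered between $x_i$ and $x_{i+1}$, and let $\ast^{\epsilon_i}=\ast$ if the normal of that over-arc points away from $x_i$, and $\ast^{\epsilon_i}=\bar\ast$ otherwise. For a coloring $\zeta$ of $D$, the colored quandle longitude is the automorphism $\phi_\zeta\colon Q\to Q$, $$\phi_\zeta(x)=x\ast^{-\epsilon_1}\zeta(x_1)\ast^{\epsilon_1}\zeta(x_{o(1)})\ast^{-\epsilon_2}\zeta(x_2)\ast^{\epsilon_2}\zeta(x_{o(2)})\cdots\ast^{-\epsilon_n}\zeta(x_n)\ast^{\epsilon_n}\zeta(x_{o(n)}).$$ The formal sum $S^x_\Phi(K)$ does not depend on the choice of the diagram $D$ of $K$. **List notation.** An automorphism of $Q$ of the form $x\mapsto x\ast^{\delta_1}y_1\ast^{\delta_2}y_2\cdots\ast^{\delta_k}y_k$, with $y_1,\dots,y_k\in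 Q$ and each $\ast^{\delta_i}\in\{\ast,\bar\ast\}$, is also written as the list of the elements acting, in order, with an element $y$ written as $\overline{y}$ if it is preceded by $\bar\ast$ and as $y$ if it is preceded by $\ast$. A list acts on $x\in Q$ by applying its entries successively from left to right. The symbol $\cdot$ denotes concatenation of lists. **Tangles.** A 4-tangle consists of two disjoint arcs in the 3-ball; it is considered oriented, with two inputs and two outputs. Tangle diagrams represent the same tangle if they are related by Reidemeister moves fixing the boundary. The tangle $T$ embeds into the long knot $K$ if some diagram of $T$ is a part of some long knot diagram of $K$ (with matching orientations). A boundary-monochromatic coloring of a tangle diagram $D_T$ by $Q$ is a map from the arcs of $D_T$ to $Q$ satisfying the usual coloring condition at every crossing and such that all boundary points (i.e. the arcs containing them) receive the same color. $Col_Q^q(D_T)$ is the set of those whose boundary color is $q$. **Longitude parts.** The two components of $T$ are numbered $1,2$. For $\zeta\in Col_Q^q(D_T)$ and $j\in\{1,2\}$, travel along component $j$ of $D_T$ according to its orientation, passing consecutively along arcs $a_1,\dots,a_{m+1}$ of $D_T$; let $b_i$ be the over-arc (of either component) encountered between $a_i$ and $a_{i+1}$, and let $\ast^{\epsilon_i}=\ast$ if the normal of $b_i$ points away from $a_i$, $\ast^{\epsilon_i}=\bar\ast$ otherwise. Then $\phi^j_\zeta$ is the list corresponding to $x\mapsto x\ast^{-\epsilon_1}\zeta(a_1)\ast^{\epsilon_1}\zeta(b_1)\cdots\ast^{-\epsilon_m}\zeta(a_m)\ast^{\epsilon_m}\zeta(b_m)$. **Formal sums.** Formal sums are elements of the free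 $\mathbb{Z}$-module generated by the elements of $Q$. A formal sum $\sum_{y\in Q} m_y\, y$ is included in $\sum_{y\in Q} n_y\, y$ if $m_y\le n_y$ for every $y\in Q$. *)

theory Defs
  imports "HOL-Analysis.Analysis" "HOL-Library.Poly_Mapping"
begin

section \<open>Quandles\<close>

record 'a magma2 =
  carrier :: "'a set"
  star :: "'a \<Rightarrow> 'a \<Rightarrow> 'a"
  costar :: "'a \<Rightarrow> 'a \<Rightarrow> 'a"

locale quandle =
  fixes Q :: "'a magma2"
  assumes star_closed: "\<lbrakk>x \<in> carrier Q; y \<in> carrier Q\<rbrakk> \<Longrightarrow> star Q x y \<in> carrier Q"
    and costar_closed: "\<lbrakk>x \<in> carrier Q; y \<in> carrier Q\<rbrakk> \<Longrightarrow> costar Q x y \<in> carrier Q"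
    and idem: "x \<in> carrier Q \<Longrightarrow> star Q x x = x"
    and star_costar: "\<lbrakk>x \<in> carrier Q; y \<in> carrier Q\<rbrakk> \<Longrightarrow> costar Q (star Q x y) y = x"
    and costar_star: "\<lbrakk>x \<in> carrier Q; y \<in> carrier Q\<rbrakk> \<Longrightarrow> star Q (costar Q x y) y = x"
    and distrib: "\<lbrakk>x \<in> carrier Q; y \<in> carrier Q; z \<in> carrier Q\<rbrakk> \<Longrightarrow>
      star Q (star Q x y) z = star Q (star Q x z) (star Q y z)"

text \<open>
  A list of entries acts from left to right. The entry \<open>(True, y)\<close> stands for \<open>y\<close> (preceded by
  \<open>star\<close>), the entry \<open>(False, y)\<close> for the overlined \<open>y\<close> (preceded by \<open>costar\<close>).
\<close>

definition act :: "'a magma2 \<Rightarrow> (bool \<times> 'a) list \<Rightarrow> 'a \<Rightarrow> 'a" where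
  "act Q ys x = foldl (\<lambda>u (e, y). if e then star Q u y else costar Q u y) x ys"

section \<open>Formal sums\<close>

text \<open>The free abelian group on \<open>'a\<close> is the type \<open>'a \<Rightarrow>\<^sub>0 int\<close> of finitely supported functions.\<close>

definition included :: "('a \<Rightarrow>\<^sub>0 int) \<Rightarrow> ('a \<Rightarrow>\<^sub>0 int) \<Rightarrow> bool" where
  "included m n \<longleftrightarrow> (\<forall>y. Poly_Mapping.lookup m y \<le> Poly_Mapping.lookup n y)"

section \<open>Smooth maps\<close>

text \<open>The plane is \<open>complex\<close> with its standard orientation, given by the basis \<open>1, \<i>\<close>.\<close>

definition smooth_curve :: "(real \<Rightarrow> 'b::real_normed_vector) \<Rightarrow> bool" where
  "smooth_curve f \<longleftrightarrow> (\<exists>F :: nat \<Rightarrow> real \<Rightarrow> 'b. F 0 = f \<and>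
     (\<forall>n t. (F n has_vector_derivative F (Suc n) t) (at t)))"

text \<open>Below, \<open>F m n\<close> is the partial derivative of order \<open>m\<close> in \<open>Re\<close> and of order \<open>n\<close> in \<open>Im\<close>.\<close>

definition smooth_plane :: "(complex \<Rightarrow> complex) \<Rightarrow> bool" where
  "smooth_plane h \<longleftrightarrow> (\<exists>F :: nat \<Rightarrow> nat \<Rightarrow> complex \<Rightarrow> complex. F 0 0 = h \<and>
     (\<forall>m n z. (F m n has_derivative
        (\<lambda>v. Re v *\<^sub>R F (Suc m) n z + Im v *\<^sub>R F m (Suc n) z)) (at z)))"

text \<open>\<open>Im (cnj u * v)\<close> is the determinant of the matrix with columns \<open>u\<close> and \<open>v\<close>.\<close>

definition jacobian :: "(complex \<Rightarrow> complex) \<Rightarrow> complex \<Rightarrow> real" where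
  "jacobian h z = Im (cnj (frechet_derivative h (at z) 1) * frechet_derivative h (at z) \<i>)"

definition oriented_diffeo :: "(complex \<Rightarrow> complex) \<Rightarrow> bool" where
  "oriented_diffeo h \<longleftrightarrow> bij h \<and> smooth_plane h \<and> smooth_plane (inv h) \<and> (\<forall>z. jacobian h z > 0)"

section \<open>Diagrams\<close>

text \<open>
  A diagram is a parametrised oriented curve, possibly with several components, together with its
  crossing information. The values of \<open>curve\<close> outside \<open>params\<close> are irrelevant. Long knots are
  parametrised by the whole line, tangles by two disjoint intervals, one for each component.
  The crossing information is the set \<open>unders\<close> of the parameters at which the curve
  passes under.
\<close>

record diagram =
  params :: "real set"
  curve :: "real \<Rightarrow> complex"
  unders :: "real set"

definition tangent :: "diagram \<Rightarrow> real \<Rightarrow> complex" where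
  "tangent D t = vector_derivative (curve D) (at t)"

definition normal :: "diagram \<Rightarrow> real \<Rightarrow> complex" where
  "normal D t = \<i> * tangent D t"

definition double_points :: "diagram \<Rightarrow> (real \<times> real) set" where
  "double_points D = {(s, t). s \<in> params D \<and> t \<in> params D \<and> s \<noteq> t \<and> curve D s = curve D t}"

text \<open>
  \<open>single_valued\<close> excludes triple points; the condition on \<open>normal\<close> says that the two branches
  at a double point are transverse.
\<close>

definition regular_diagram :: "diagram \<Rightarrow> bool" where
  "regular_diagram D \<longleftrightarrow>
     smooth_curve (curve D) \<and>
     (\<forall>t\<in>params D. tangent D t \<noteq> 0) \<and>
     finite (double_points D) \<and>
     single_valued (double_points D) \<and>
     (\<forall>(s, t)\<in>double_points D. inner (normal D s) (tangent D t) \<noteq> 0) \<and>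
     (\<forall>(s, t)\<in>double_points D. s \<in> unders D \<longleftrightarrow> t \<notin> unders D) \<and>
     unders D \<subseteq> Domain (double_points D)"

definition long_knot_diagram :: "diagram \<Rightarrow> bool" where
  "long_knot_diagram D \<longleftrightarrow> regular_diagram D \<and> params D = UNIV \<and>
     (\<exists>M. \<forall>t. \<bar>t\<bar> \<ge> M \<longrightarrow> curve D t = Complex t 0)"

definition strand1 :: "real set" where "strand1 = {0..1}"
definition strand2 :: "real set" where "strand2 = {2..3}"
definition endpoints :: "real set" where "endpoints = {0, 1, 2, 3}"

definition tangle_diagram :: "diagram \<Rightarrow> bool" where
  "tangle_diagram D \<longleftrightarrow> regular_diagram D \<and> params D = strand1 \<union> strand2 \<and>
     (\<forall>t\<in>params D - endpoints. curve D t \<in> ball 0 1) \<and>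
     (\<forall>t\<in>endpoints. curve D t \<in> sphere 0 1 \<and> inner (curve D t) (tangent D t) \<noteq> 0) \<and>
     inj_on (curve D) endpoints"

section \<open>Reidemeister moves\<close>

text \<open>\<open>D'\<close> is the image under \<open>h\<close> of the part of \<open>D\<close> parametrised by \<open>\<rho> ` params D'\<close>.\<close>

definition carried_to :: "(complex \<Rightarrow> complex) \<Rightarrow> (real \<Rightarrow> real) \<Rightarrow> diagram \<Rightarrow> diagram \<Rightarrow> bool" where
  "carried_to h \<rho> D D' \<longleftrightarrow> smooth_curve \<rho> \<and> (\<forall>t\<in>params D'. deriv \<rho> t > 0) \<and>
     inj_on \<rho> (params D') \<and> \<rho> ` params D' \<subseteq> params D \<and>
     (\<forall>t\<in>params D'. curve D' t = h (curve D (\<rho> t)) \<and> (t \<in> unders D' \<longleftrightarrow> \<rho> t \<in> unders D))"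

text \<open>Ambient isotopy of the plane fixing \<open>S\<close> pointwise, up to reparametrisation.\<close>

definition planar_isotopic :: "complex set \<Rightarrow> diagram \<Rightarrow> diagram \<Rightarrow> bool" where
  "planar_isotopic S D D' \<longleftrightarrow> (\<exists>H \<rho>.
     continuous_on ({0..1::real} \<times> UNIV) (\<lambda>(t, z). H t z) \<and>
     (\<forall>z. H 0 z = z) \<and>
     (\<forall>t\<in>{0..1}. oriented_diffeo (H t) \<and> (\<forall>z\<in>S. H t z = z)) \<and>
     strict_mono_on (params D') \<rho> \<and> \<rho> ` params D' = params D \<and>
     carried_to (H 1) \<rho> D D')"

definition closed_disc :: "complex set \<Rightarrow> bool" where
  "closed_disc B \<longleftrightarrow> (\<exists>h. oriented_diffeo h \<and> h ` cball 0 1 = B)"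

definition inside :: "diagram \<Rightarrow> complex set \<Rightarrow> real set" where
  "inside D B = {t \<in> params D. curve D t \<in> B}"

definition agree_outside :: "complex set \<Rightarrow> diagram \<Rightarrow> diagram \<Rightarrow> bool" where
  "agree_outside B D D' \<longleftrightarrow> params D' = params D \<and> inside D' B = inside D B \<and>
     (\<forall>t\<in>params D - inside D B. curve D' t = curve D t \<and> (t \<in> unders D' \<longleftrightarrow> t \<in> unders D))"

text \<open>The crossings in \<open>B\<close>, each given by its pair of over and under parameters.\<close>

definition crossings_in :: "diagram \<Rightarrow> complex set \<Rightarrow> (real \<times> real) set" where
  "crossings_in D B = {(s, t) \<in> double_points D. t \<in> unders D \<and> curve D t \<in> B}"

definition over :: "diagram \<Rightarrow> real \<Rightarrow> real" where
  "over D t = (THE s. (s, t) \<in> double_points D)"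

text \<open>
  At the under-crossing \<open>t\<close> the under strand passes to the side of the over strand into which the
  normal of the over strand points, i.e. this normal points away from the arc that ends at \<open>t\<close>.
\<close>

definition along_normal :: "diagram \<Rightarrow> real \<Rightarrow> bool" where
  "along_normal D t \<longleftrightarrow> inner (normal D (over D t)) (tangent D t) > 0"

text \<open>
  Each move takes place in a closed disc \<open>B\<close> contained in the region \<open>R\<close>. In a disc containing
  one strand with a single self-crossing, the loop at this crossing is necessarily a kink; when
  one strand passes over another one twice and the ends of the strands are unlinked on the boundary
  of the disc (as \<open>D\<close> shows), the strands necessarily bound an empty bigon, and the two
  crossings have opposite signs.
\<close>

definition reidemeister1 :: "complex set \<Rightarrow> diagram \<Rightarrow> diagram \<Rightarrow> bool" where
  "reidemeister1 R D D' \<longleftrightarrow> (\<exists>B a b s t.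
     closed_disc B \<and> B \<subseteq> R \<and> agree_outside B D D' \<and> inside D B = {a..b} \<and>
     crossings_in D B = {} \<and> crossings_in D' B = {(s, t)})"

definition reidemeister2 :: "complex set \<Rightarrow> diagram \<Rightarrow> diagram \<Rightarrow> bool" where
  "reidemeister2 R D D' \<longleftrightarrow> (\<exists>B a b c d s1 t1 s2 t2.
     closed_disc B \<and> B \<subseteq> R \<and> agree_outside B D D' \<and>
     inside D B = {a..b} \<union> {c..d} \<and> {a..b} \<inter> {c..d} = {} \<and>
     crossings_in D B = {} \<and> crossings_in D' B = {(s1, t1), (s2, t2)} \<and>
     s1 \<noteq> s2 \<and> {s1, s2} \<subseteq> {a..b} \<and> {t1, t2} \<subseteq> {c..d} \<and>
     along_normal D' t1 \<noteq> along_normal D' t2)"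

text \<open>
  The strands \<open>X\<close>, \<open>Y\<close>, \<open>Z\<close> are the top, middle and bottom one. In \<open>D\<close> they are three chords,
  up to a diffeomorphism; in \<open>D'\<close> they meet pairwise in crossings of the same signs, but along each
  strand in the opposite order.
\<close>

definition reidemeister3 :: "complex set \<Rightarrow> diagram \<Rightarrow> diagram \<Rightarrow> bool" where
  "reidemeister3 R D D' \<longleftrightarrow> (\<exists>h B X Y Z x1 x2 y1 y2 z1 z2 x1' x2' y1' y2' z1' z2'.
     oriented_diffeo h \<and> h ` B = cball 0 1 \<and> B \<subseteq> R \<and> agree_outside B D D' \<and>
     (\<forall>V\<in>{X, Y, Z}. (\<exists>a b. V = {a..b}) \<and> collinear (h ` curve D ` V)) \<and>
     inside D B = X \<union> Y \<union> Z \<and> X \<inter> Y = {} \<and> X \<inter> Z = {} \<and> Y \<inter> Z = {} \<and>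
     {x1, x2, x1', x2'} \<subseteq> X \<and> {y1, y2, y1', y2'} \<subseteq> Y \<and> {z1, z2, z1', z2'} \<subseteq> Z \<and>
     crossings_in D B = {(x1, y1), (x2, z1), (y2, z2)} \<and>
     crossings_in D' B = {(x1', y1'), (x2', z1'), (y2', z2')} \<and>
     along_normal D' y1' = along_normal D y1 \<and>
     along_normal D' z1' = along_normal D z1 \<and>
     along_normal D' z2' = along_normal D z2 \<and>
     (x1 < x2 \<longleftrightarrow> x2' < x1') \<and> (y1 < y2 \<longleftrightarrow> y2' < y1') \<and> (z1 < z2 \<longleftrightarrow> z2' < z1'))"

definition reidemeister :: "complex set \<Rightarrow> diagram \<Rightarrow> diagram \<Rightarrow> bool" where
  "reidemeister R D D' \<longleftrightarrow> reidemeister1 R D D' \<or> reidemeister2 R D D' \<or> reidemeister3 R D D'"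

definition long_knot_move :: "diagram \<Rightarrow> diagram \<Rightarrow> bool" where
  "long_knot_move D D' \<longleftrightarrow> long_knot_diagram D \<and> long_knot_diagram D' \<and>
     ((\<exists>r. planar_isotopic (- ball 0 r) D D') \<or> reidemeister UNIV D D')"

definition tangle_move :: "diagram \<Rightarrow> diagram \<Rightarrow> bool" where
  "tangle_move D D' \<longleftrightarrow> tangle_diagram D \<and> tangle_diagram D' \<and>
     (planar_isotopic (sphere 0 1) D D' \<or> reidemeister (ball 0 1) D D')"

definition long_knots :: "diagram set set" where
  "long_knots = {D. long_knot_diagram D} // {(D, D'). equivclp long_knot_move D D'}"

definition tangles :: "diagram set set" where
  "tangles = {D. tangle_diagram D} // {(D, D'). equivclp tangle_move D D'}"

definition part_of :: "diagram \<Rightarrow> diagram \<Rightarrow> bool" where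
  "part_of D' D \<longleftrightarrow> (\<exists>g \<rho>. oriented_diffeo g \<and> carried_to g \<rho> D D' \<and>
     \<rho> ` params D' = {t \<in> params D. g (curve D t) \<in> cball 0 1})"

definition embeds :: "diagram set \<Rightarrow> diagram set \<Rightarrow> bool" where
  "embeds T K \<longleftrightarrow> (\<exists>D'\<in>T. \<exists>D\<in>K. part_of D' D)"

section \<open>Arcs and colorings\<close>

text \<open>Arcs are represented by their sets of parameters.\<close>

definition arcs :: "diagram \<Rightarrow> real set set" where
  "arcs D = components (params D - unders D)"

definition arc_at :: "diagram \<Rightarrow> real \<Rightarrow> real set" where
  "arc_at D t = (THE A. A \<in> arcs D \<and> t \<in> A)"

definition arc_before :: "diagram \<Rightarrow> real \<Rightarrow> real set" where
  "arc_before D t = (THE A. A \<in> arcs D \<and> (\<exists>e>0. {t - e<..<t} \<subseteq> A))"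

definition arc_after :: "diagram \<Rightarrow> real \<Rightarrow> real set" where
  "arc_after D t = (THE A. A \<in> arcs D \<and> (\<exists>e>0. {t<..<t + e} \<subseteq> A))"

definition over_arc :: "diagram \<Rightarrow> real \<Rightarrow> real set" where
  "over_arc D t = arc_at D (over D t)"

definition initial_arc :: "diagram \<Rightarrow> real set" where
  "initial_arc D = (THE A. A \<in> arcs D \<and> (\<exists>M. {..M} \<subseteq> A))"

definition colorings :: "diagram \<Rightarrow> 'a magma2 \<Rightarrow> (real set \<Rightarrow> 'a) set" where
  "colorings D Q = {C \<in> arcs D \<rightarrow>\<^sub>E carrier Q. \<forall>t\<in>unders D.
     if along_normal D t
     then C (arc_after D t) = star Q (C (arc_before D t)) (C (over_arc D t))
     else C (arc_before D t) = star Q (C (arc_after D t)) (C (over_arc D t))}"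

definition long_colorings :: "diagram \<Rightarrow> 'a magma2 \<Rightarrow> 'a \<Rightarrow> (real set \<Rightarrow> 'a) set" where
  "long_colorings D Q q = {C \<in> colorings D Q. C (initial_arc D) = q}"

definition tangle_colorings :: "diagram \<Rightarrow> 'a magma2 \<Rightarrow> 'a \<Rightarrow> (real set \<Rightarrow> 'a) set" where
  "tangle_colorings D Q q = {C \<in> colorings D Q. \<forall>t\<in>endpoints. C (arc_at D t) = q}"

section \<open>Longitudes\<close>

text \<open>
  The list collected while travelling along the part of \<open>D\<close> with parameters in \<open>P\<close>: the
  under-crossings on this part, in increasing order, are the transitions between consecutive arcs.
\<close>

definition longitude :: "diagram \<Rightarrow> (real set \<Rightarrow> 'a) \<Rightarrow> real set \<Rightarrow> (bool \<times> 'a) list" where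
  "longitude D \<zeta> P = concat (map
     (\<lambda>t. [(\<not> along_normal D t, \<zeta> (arc_before D t)), (along_normal D t, \<zeta> (over_arc D t))])
     (sorted_list_of_set (unders D \<inter> P)))"

definition S_Phi :: "'a magma2 \<Rightarrow> 'a \<Rightarrow> 'a \<Rightarrow> diagram \<Rightarrow> 'a \<Rightarrow>\<^sub>0 int" where
  "S_Phi Q q x D = (\<Sum>\<zeta>\<in>long_colorings D Q q.
     Poly_Mapping.single (act Q (longitude D \<zeta> UNIV) x) 1)"

definition S_1 :: "'a magma2 \<Rightarrow> 'a \<Rightarrow> 'a \<Rightarrow> diagram \<Rightarrow> 'a \<Rightarrow>\<^sub>0 int" where
  "S_1 Q q x D = (\<Sum>\<zeta>\<in>tangle_colorings D Q q.
     Poly_Mapping.single (act Q (longitude D \<zeta> strand1 @ longitude D \<zeta> strand2) x) 1)"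

definition S_2 :: "'a magma2 \<Rightarrow> 'a \<Rightarrow> 'a \<Rightarrow> diagram \<Rightarrow> 'a \<Rightarrow>\<^sub>0 int" where
  "S_2 Q q x D = (\<Sum>\<zeta>\<in>tangle_colorings D Q q.
     Poly_Mapping.single (act Q (longitude D \<zeta> strand2 @ longitude D \<zeta> strand1) x) 1)"

end

theory Submission
  imports Defs
begin

text \<open>
  The corrections in a longitude can be gathered. Suppose that a strand starts with the color \<open>z\<close>.
  Its color before an under-crossing is the image of \<open>z\<close> under the over-arcs passed so far, and these
  act by automorphisms. Hence the longitude acts like one correction by \<open>z\<close> for each under-crossing,
  followed by the word of all over-arcs (\<open>param_longitude_segment\<close>). The same word carries the
  initial color of the strand to the final one. So longitudes and colors are controlled together,
  by the actions of these words and the signs of the crossings.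

  Arcs are subsets of the parameter range and change with the diagram. Colorings are therefore
  replaced by functions of the parameter whose value changes along every segment by the word of the
  over-arcs passed there (\<open>color_at_bij\<close>). This condition is local, and colorings of different
  diagrams can be compared pointwise.

  A Reidemeister move replaces the inside of a disc. It induces a bijection between the colorings,
  given by agreement outside the disc, if two things hold: the colors entering the disc extend
  uniquely to its inside (\<open>fillable\<close>), and the strands leave with the same colors and have contributed
  equally to the longitude (\<open>same_effect\<close>). The conclusion is \<open>local_change_invariance\<close>. Colors extend
  because a kink is constant by idempotence, while in the other moves the strands lie in layers and
  can be colored from top to bottom. The effects agree by cancellation of opposite crossings in
  the second move and by self-distributivity in the third one. The latter needs a relation between
  the signs of the three crossings and their orders along the strands, which holds because on one
  side of the move the strands are the sides of a triangle (\<open>chord_signs\<close>). Planar isotopies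
  preserve all the data.

  If a tangle is a part of a long knot, then each of its colorings with boundary color \<open>q\<close> extends
  by the constant \<open>q\<close> to a coloring of the long knot (\<open>extend_by_coloring\<close>). At a crossing outside
  the tangle, the longitude acquires \<open>q\<close> and its inverse. What remains is the product of the
  longitudes of the two components, in the order in which the long knot passes through them
  (\<open>extend_by_longitude\<close>). Different colorings have different extensions, which gives the
  inclusion of formal sums.
\<close>

section \<open>Words acting on a quandle\<close>

definition qop :: "'a magma2 \<Rightarrow> bool \<Rightarrow> 'a \<Rightarrow> 'a \<Rightarrow> 'a" where
  "qop Q e x y = (if e then star Q x y else costar Q x y)"

lemma act_Nil [simp]: "act Q [] x = x"
  by (simp add: act_def)

lemma act_Cons [simp]: "act Q (p # w) x = act Q w (qop Q (fst p) x (snd p))"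
  by (cases p) (simp add: act_def qop_def)

lemma act_append [simp]: "act Q (v @ w) x = act Q w (act Q v x)"
  by (induction v arbitrary: x) auto

context quandle
begin

lemma qop_closed [simp]:
  "x \<in> carrier Q \<Longrightarrow> y \<in> carrier Q \<Longrightarrow> qop Q e x y \<in> carrier Q"
  by (simp add: qop_def star_closed costar_closed)

lemma qop_cancel [simp]:
  "x \<in> carrier Q \<Longrightarrow> y \<in> carrier Q \<Longrightarrow> qop Q (\<not> e) (qop Q e x y) y = x"
  "x \<in> carrier Q \<Longrightarrow> y \<in> carrier Q \<Longrightarrow> qop Q e (qop Q (\<not> e) x y) y = x"
  by (auto simp: qop_def star_costar costar_star)

lemma qop_idem [simp]: "x \<in> carrier Q \<Longrightarrow> qop Q e x x = x"
  using idem[of x] star_costar[of x x] by (simp add: qop_def)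

lemma qop_cancel_iff:
  assumes "x \<in> carrier Q" "y \<in> carrier Q" "z \<in> carrier Q"
  shows "qop Q e x z = y \<longleftrightarrow> x = qop Q (\<not> e) y z"
  using assms qop_cancel[of x z e] qop_cancel[of y z e] by metis

lemma qop_distrib:
  assumes "x \<in> carrier Q" "y \<in> carrier Q" "z \<in> carrier Q"
  shows "qop Q e (qop Q d x y) z = qop Q d (qop Q e x z) (qop Q e y z)"
proof -
  have ss: "qop Q True (qop Q True x y) z = qop Q True (qop Q True x z) (qop Q True y z)"
    if "x \<in> carrier Q" "y \<in> carrier Q" "z \<in> carrier Q" for x y z
    using distrib that by (simp add: qop_def)
  have sc: "qop Q True (qop Q d x y) z = qop Q d (qop Q True x z) (qop Q True y z)"
    if q: "x \<in> carrier Q" "y \<in> carrier Q" "z \<in> carrier Q" for x y z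
  proof (cases d)
    case True
    then show ?thesis using ss[OF q] by simp
  next
    case False
    let ?w = "qop Q False x y"
    have "qop Q True (qop Q True ?w y) z = qop Q True (qop Q True ?w z) (qop Q True y z)"
      using q by (intro ss) auto
    moreover have "qop Q True ?w y = x"
      using qop_cancel(2)[of x y True] q by simp
    ultimately have "qop Q True (qop Q True ?w z) (qop Q True y z) = qop Q True x z"
      by simp
    then show ?thesis
      using qop_cancel_iff[of "qop Q True ?w z" "qop Q True x z" "qop Q True y z" True] q False
      by simp
  qed
  show ?thesis
  proof (cases e)
    case True
    then show ?thesis using sc[OF assms] by simp
  next
    case False
    let ?x = "qop Q False x z" and ?y = "qop Q False y z"
    have "qop Q True (qop Q d ?x ?y) z = qop Q d (qop Q True ?x z) (qop Q True ?y z)"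
      using assms by (intro sc) auto
    also have "\<dots> = qop Q d x y"
      using qop_cancel(2)[of x z True] qop_cancel(2)[of y z True] assms by simp
    finally show ?thesis
      using qop_cancel_iff[of "qop Q d ?x ?y" "qop Q d x y" z True] assms False by simp
  qed
qed

lemma act_closed [simp]:
  "x \<in> carrier Q \<Longrightarrow> snd ` set w \<subseteq> carrier Q \<Longrightarrow> act Q w x \<in> carrier Q"
  by (induction w arbitrary: x) auto

lemma act_qop:
  assumes "u \<in> carrier Q" "z \<in> carrier Q" "snd ` set w \<subseteq> carrier Q"
  shows "act Q w (qop Q e u z) = qop Q e (act Q w u) (act Q w z)"
  using assms
proof (induction w arbitrary: u z)
  case (Cons p w)
  then show ?case using qop_distrib[of u z "snd p" "fst p" e] by simp
qed simp

text \<open>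
  Travelling from an arc of color \<open>z\<close>, the incoming color at the under-crossing \<open>t\<close> is the image of
  \<open>z\<close> under the over-arcs passed before. As these act by automorphisms, they can be moved past the
  correction by the incoming colors, which turns all corrections into corrections by \<open>z\<close>.
\<close>

lemma act_corrected_word:
  assumes "z \<in> carrier Q" "u \<in> carrier Q" "k ` set ts \<subseteq> carrier Q"
    and "\<And>p t r. ts = p @ t # r \<Longrightarrow> c t = act Q (map (\<lambda>t. (e t, k t)) p) z"
  shows "act Q (concat (map (\<lambda>t. [(\<not> e t, c t), (e t, k t)]) ts)) u
       = act Q (map (\<lambda>t. (e t, k t)) ts) (act Q (map (\<lambda>t. (\<not> e t, z)) ts) u)"
  using assms(3,4)
proof (induction ts rule: rev_induct)
  case (snoc t ts)
  let ?W = "map (\<lambda>t. (e t, k t)) ts" and ?N = "act Q (map (\<lambda>t. (\<not> e t, z)) ts) u"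
  have N: "?N \<in> carrier Q" and W: "snd ` set ?W \<subseteq> carrier Q"
    using assms snoc.prems(1) by (auto intro!: act_closed)
  have IH: "act Q (concat (map (\<lambda>t. [(\<not> e t, c t), (e t, k t)]) ts)) u = act Q ?W ?N"
    using snoc.prems by (intro snoc.IH) auto
  have "c t = act Q ?W z" using snoc.prems(2)[of ts t "[]"] by simp
  then show ?case using IH act_qop[OF N assms(1) W] by simp
qed simp

end

section \<open>Increasing enumerations\<close>

lemma sorted_list_of_set_Un_less:
  fixes A B :: "'b::linorder set"
  assumes "finite A" "finite B" "\<And>a b. a \<in> A \<Longrightarrow> b \<in> B \<Longrightarrow> a < b"
  shows "sorted_list_of_set (A \<union> B) = sorted_list_of_set A @ sorted_list_of_set B"
proof (rule sorted_distinct_set_unique)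
  show "sorted (sorted_list_of_set A @ sorted_list_of_set B)"
    using assms by (auto simp: sorted_append intro: less_imp_le)
  show "distinct (sorted_list_of_set A @ sorted_list_of_set B)"
    using assms by (auto dest: assms(3))
qed (use assms in auto)

lemma sorted_list_of_set_image:
  fixes f :: "'b::linorder \<Rightarrow> 'c::linorder"
  assumes "finite A" "strict_mono_on A f"
  shows "sorted_list_of_set (f ` A) = map f (sorted_list_of_set A)"
proof (rule sorted_distinct_set_unique)
  have "sorted_wrt (<) (map f (sorted_list_of_set A))"
    unfolding sorted_wrt_map
    by (rule sorted_wrt_mono_rel[OF _ strict_sorted_list_of_set])
      (use assms in \<open>simp add: strict_mono_onD\<close>)
  then show "sorted (map f (sorted_list_of_set A))"
    by (simp add: strict_sorted_iff)
  show "distinct (map f (sorted_list_of_set A))"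
    using assms by (auto simp: distinct_map strict_mono_on_imp_inj_on)
qed (use assms in auto)

lemma sorted_list_of_set_pair:
  "a < b \<Longrightarrow> sorted_list_of_set {a, b} = [a, b :: 'b::linorder]"
  using sorted_list_of_set_Un_less[of "{a}" "{b}"] by (simp add: insert_commute)

lemma sorted_list_of_set_prefix:
  fixes A :: "'b::linorder set"
  assumes "finite A" "sorted_list_of_set A = p @ t # r"
  shows "p = sorted_list_of_set (A \<inter> {..<t})" and "t \<in> A"
proof -
  have s: "sorted_wrt (<) (p @ t # r)" using assms(2) by (metis strict_sorted_list_of_set)
  have A: "A = set (p @ t # r)" using assms by (metis set_sorted_list_of_set)
  show "t \<in> A" using A by simp
  have "set p = A \<inter> {..<t}" using s unfolding A by (auto simp: sorted_wrt_append)
  moreover have "sorted p" "distinct p"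
    using s by (auto simp: sorted_wrt_append strict_sorted_iff)
  ultimately show "p = sorted_list_of_set (A \<inter> {..<t})"
    using sorted_list_of_set.idem_if_sorted_distinct by metis
qed

section \<open>Words read off along a strand\<close>

definition word :: "(real \<Rightarrow> (bool \<times> 'a) list) \<Rightarrow> real set \<Rightarrow> (bool \<times> 'a) list" where
  "word f A = concat (map f (sorted_list_of_set A))"

lemma word_empty [simp]: "word f {} = []"
  by (simp add: word_def)

lemma word_singleton [simp]: "word f {t} = f t"
  by (simp add: word_def)

lemma word_pair: "s < t \<Longrightarrow> word f {s, t} = f s @ f t"
  by (simp add: word_def sorted_list_of_set_pair)

lemma word_Un:
  "finite A \<Longrightarrow> finite B \<Longrightarrow> (\<And>a b. a \<in> A \<Longrightarrow> b \<in> B \<Longrightarrow> a < b) \<Longrightarrow>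
    word f (A \<union> B) = word f A @ word f B"
  by (simp add: word_def sorted_list_of_set_Un_less)

lemma word_image:
  "finite A \<Longrightarrow> strict_mono_on A \<rho> \<Longrightarrow> word f (\<rho> ` A) = word (f \<circ> \<rho>) A"
  by (simp add: word_def sorted_list_of_set_image)

lemma word_cong:
  assumes "A = B" "\<And>t. t \<in> B \<Longrightarrow> f t = g t"
  shows "word f A = word g B"
proof (cases "finite B")
  case True
  then have "map f (sorted_list_of_set B) = map g (sorted_list_of_set B)"
    using assms(2) by auto
  then show ?thesis using assms(1) by (simp only: word_def)
qed (use assms(1) in \<open>simp add: word_def\<close>)

lemma set_word_subset: "set (word f A) \<subseteq> (\<Union>t\<in>A. set (f t))"
  by (cases "finite A") (auto simp: word_def)

lemma word_colors:
  assumes "\<And>t. t \<in> A \<Longrightarrow> snd ` set (f t) \<subseteq> C"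
  shows "snd ` set (word f A) \<subseteq> C"
  using set_word_subset[of f A] assms by fastforce

context quandle
begin

lemma act_word_id:
  assumes "u \<in> carrier Q" "\<And>t. t \<in> A \<Longrightarrow> act Q (f t) u = u"
  shows "act Q (word f A) u = u"
proof (cases "finite A")
  case True
  have "act Q (concat (map f ts)) u = u" if "set ts \<subseteq> A" for ts
    using that by (induction ts) (auto simp: assms(2))
  then show ?thesis using True by (simp add: word_def)
qed (simp add: word_def)

lemma act_word_replace:
  assumes fin: "finite A" "finite A'" and J: "is_interval J" and out: "A - J = A' - J"
    and f: "\<And>t. t \<in> A - J \<Longrightarrow> f t = f' t"
    and C: "\<And>t. t \<in> A \<Longrightarrow> snd ` set (f t) \<subseteq> carrier Q"
    and eq: "\<And>u. u \<in> carrier Q \<Longrightarrow> act Q (word f (A \<inter> J)) u = act Q (word f' (A' \<inter> J)) u"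
    and u: "u \<in> carrier Q"
  shows "act Q (word f A) u = act Q (word f' A') u"
proof (cases "J = {}")
  case True
  then have "word f A = word f' A'" using out f by (intro word_cong) auto
  then show ?thesis by simp
next
  case False
  then obtain j where j: "j \<in> J" by auto
  have between: "t \<in> J" if "a \<in> J" "b \<in> J" "a \<le> t" "t \<le> b" for a b t
    using J that by (meson is_interval_1)
  define L R where "L = {t \<in> A - J. t < j}" and "R = {t \<in> A - J. t > j}"
  have Lless: "t < s" if "t \<in> L" "s \<in> J" for t s
  proof (rule ccontr)
    assume "\<not> t < s"
    then have "t \<in> J" using that between[OF that(2) j, of t] by (simp add: L_def)
    then show False using that(1) by (simp add: L_def)
  qed
  have Rless: "s < t" if "t \<in> R" "s \<in> J" for t s
  proof (rule ccontr)
    assume "\<not> s < t"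
    then have "t \<in> J" using that between[OF j that(2), of t] by (simp add: R_def)
    then show False using that(1) by (simp add: R_def)
  qed
  have split: "word g B = word g L @ word g (B \<inter> J) @ word g R"
    if "finite B" "B - J = A - J" for g :: "real \<Rightarrow> (bool \<times> 'a) list" and B
  proof -
    have "A - J = L \<union> R" using j by (fastforce simp: L_def R_def not_less order_le_less)
    then have B: "B = L \<union> (B \<inter> J \<union> R)" using that(2) by blast
    have fL: "finite L" "finite R" using fin by (auto simp: L_def R_def)
    have "word g B = word g L @ word g (B \<inter> J \<union> R)"
    proof (subst B, rule word_Un)
      show "a < b" if "a \<in> L" "b \<in> B \<inter> J \<union> R" for a b
        using that Lless[of a b] by (auto simp: L_def R_def)
    qed (use fL that(1) in auto)
    also have "word g (B \<inter> J \<union> R) = word g (B \<inter> J) @ word g R"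
      by (rule word_Un) (use fL that(1) Rless in blast)+
    finally show ?thesis .
  qed
  have "word f L = word f' L" "word f R = word f' R"
    using f by (auto intro!: word_cong simp: L_def R_def)
  moreover have "act Q (word f L) u \<in> carrier Q"
    using u C by (intro act_closed word_colors) (auto simp: L_def)
  ultimately show ?thesis
    using split[OF fin(1)] split[OF fin(2)] out eq by simp
qed

lemma act_word_replace_all:
  assumes "finite \<J>" "finite A" "finite A'" "\<And>J. J \<in> \<J> \<Longrightarrow> is_interval J"
    and "\<And>J K. J \<in> \<J> \<Longrightarrow> K \<in> \<J> \<Longrightarrow> J \<noteq> K \<Longrightarrow> J \<inter> K = {}"
    and "A - \<Union>\<J> = A' - \<Union>\<J>" "\<And>t. t \<in> A - \<Union>\<J> \<Longrightarrow> f t = f' t"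
    and "\<And>t. t \<in> A \<Longrightarrow> snd ` set (f t) \<subseteq> carrier Q"
    and C': "\<And>t. t \<in> A' \<Longrightarrow> snd ` set (f' t) \<subseteq> carrier Q"
    and "\<And>J u. J \<in> \<J> \<Longrightarrow> u \<in> carrier Q \<Longrightarrow>
      act Q (word f (A \<inter> J)) u = act Q (word f' (A' \<inter> J)) u"
    and u: "u \<in> carrier Q"
  shows "act Q (word f A) u = act Q (word f' A') u"
  using assms(1-8,10)
proof (induction \<J> arbitrary: A f rule: finite_induct)
  case empty
  then have "word f A = word f' A'" by (intro word_cong) auto
  then show ?case by simp
next
  case (insert J \<J>)
  define A2 f2 where "A2 = (A - J) \<union> (A' \<inter> J)" and "f2 t = (if t \<in> J then f' t else f t)" for t
  have disj: "J \<inter> K = {}" if "K \<in> \<J>" for K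
    using insert.prems(4)[of J K] insert.hyps(2) that by auto
  have "act Q (word f A) u = act Q (word f2 A2) u"
  proof (rule act_word_replace[where J = J])
    show "act Q (word f (A \<inter> J)) u = act Q (word f2 (A2 \<inter> J)) u" if "u \<in> carrier Q" for u
    proof -
      have "word f2 (A2 \<inter> J) = word f' (A' \<inter> J)"
        by (rule word_cong) (auto simp: A2_def f2_def)
      then show ?thesis using insert.prems(8)[of J u] that by simp
    qed
  qed (use insert.prems u in \<open>auto simp: A2_def f2_def\<close>)
  also have "\<dots> = act Q (word f' A') u"
  proof (rule insert.IH)
    show "act Q (word f2 (A2 \<inter> K)) u = act Q (word f' (A' \<inter> K)) u"
      if "K \<in> \<J>" "u \<in> carrier Q" for K u
    proof -
      have "word f2 (A2 \<inter> K) = word f (A \<inter> K)"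
        by (rule word_cong) (use disj[OF that(1)] in \<open>auto simp: A2_def f2_def\<close>)
      then show ?thesis using insert.prems(8)[of K u] that by simp
    qed
    show "A2 - \<Union>\<J> = A' - \<Union>\<J>" using insert.prems(5) by (auto simp: A2_def)
    show "f2 t = f' t" if "t \<in> A2 - \<Union>\<J>" for t
      using insert.prems(6)[of t] that by (auto simp: A2_def f2_def)
    show "snd ` set (f2 t) \<subseteq> carrier Q" if "t \<in> A2" for t
      using insert.prems(7)[of t] C'[of t] that by (auto simp: A2_def f2_def)
  qed (use insert.prems in \<open>auto simp: A2_def\<close>)
  finally show ?case .
qed

end

section \<open>Colorings as functions of the parameter\<close>

text \<open>
  At a crossing with interior parameters both strands continue on both sides, and their tangents
  depend only on the curve over the parameter range.
\<close>

definition proper_diagram :: "diagram \<Rightarrow> bool" where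
  "proper_diagram D \<longleftrightarrow> regular_diagram D \<and> Domain (double_points D) \<subseteq> interior (params D)"

lemma double_points_sym: "(s, t) \<in> double_points D \<Longrightarrow> (t, s) \<in> double_points D"
  by (auto simp: double_points_def)

lemma over_eqI:
  assumes "regular_diagram D" "(s, t) \<in> double_points D"
  shows "over D t = s"
  unfolding over_def
proof (rule the_equality)
  show "s' = s" if "(s', t) \<in> double_points D" for s'
    using assms that double_points_sym[of _ t D] unfolding regular_diagram_def single_valued_def
    by blast
qed (rule assms)

lemma over_double_point:
  assumes "regular_diagram D" "t \<in> unders D"
  shows "(over D t, t) \<in> double_points D"
proof -
  obtain s where "(t, s) \<in> double_points D"
    using assms by (auto simp: regular_diagram_def)
  then show ?thesis using over_eqI[OF assms(1)] double_points_sym by metis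
qed

lemma over_props:
  assumes "regular_diagram D" "t \<in> unders D"
  shows "over D t \<in> params D" "over D t \<notin> unders D" "t \<in> params D" "over D t \<noteq> t"
    "curve D (over D t) = curve D t"
proof -
  note d = over_double_point[OF assms]
  then show "over D t \<in> params D" "t \<in> params D" "over D t \<noteq> t" "curve D (over D t) = curve D t"
    by (auto simp: double_points_def)
  show "over D t \<notin> unders D" using d assms by (auto simp: regular_diagram_def)
qed

lemma finite_unders: "regular_diagram D \<Longrightarrow> finite (unders D)"
  unfolding regular_diagram_def using finite_subset finite_Domain by blast

lemma proper_regular: "proper_diagram D \<Longrightarrow> regular_diagram D"
  by (simp add: proper_diagram_def)

lemma proper_interior:
  assumes "proper_diagram D" "t \<in> unders D"
  shows "t \<in> interior (params D)" "over D t \<in> interior (params D)"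
proof -
  have "(over D t, t) \<in> double_points D"
    using over_double_point assms by (simp add: proper_diagram_def)
  with double_points_sym[OF this] have "t \<in> Domain (double_points D)" "over D t \<in> Domain (double_points D)"
    by blast+
  then show "t \<in> interior (params D)" "over D t \<in> interior (params D)"
    using assms(1) unfolding proper_diagram_def by blast+
qed

lemma long_knot_proper: "long_knot_diagram D \<Longrightarrow> proper_diagram D"
  by (simp add: long_knot_diagram_def proper_diagram_def)

lemma interior_strands: "{0<..<1} \<union> {2<..<3} \<subseteq> interior (strand1 \<union> strand2)"
  by (rule interior_maximal) (auto simp: strand1_def strand2_def)

lemma strands_minus_endpoints: "strand1 \<union> strand2 - endpoints = {0<..<1} \<union> {2<..<3}"
  by (auto simp: strand1_def strand2_def endpoints_def)

lemma tangle_endpoint_simple: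
  assumes "tangle_diagram D" and st: "(s, t) \<in> double_points D"
  shows "s \<notin> endpoints"
proof
  note d = assms(1)[unfolded tangle_diagram_def]
  assume s: "s \<in> endpoints"
  have t: "s \<noteq> t" "curve D s = curve D t" "t \<in> params D"
    using st by (auto simp: double_points_def)
  show False
  proof (cases "t \<in> endpoints")
    case True
    then show False using s t d inj_onD by metis
  next
    case False
    then have "curve D t \<in> ball 0 1" using t d by auto
    moreover have "curve D s \<in> sphere 0 1" using s d by auto
    ultimately show False using t(2) by auto
  qed
qed

lemma tangle_endpoint_not_under: "tangle_diagram D \<Longrightarrow> t \<in> unders D \<Longrightarrow> t \<notin> endpoints"
  using tangle_endpoint_simple double_points_sym over_double_point
  unfolding tangle_diagram_def by metis

lemma tangle_proper:
  assumes "tangle_diagram D"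
  shows "proper_diagram D"
proof -
  have "Domain (double_points D) \<subseteq> params D - endpoints"
    using tangle_endpoint_simple[OF assms] by (auto simp: double_points_def)
  then show ?thesis
    using assms interior_strands strands_minus_endpoints
    unfolding proper_diagram_def tangle_diagram_def by auto
qed

text \<open>
  A coloring is recorded as a function \<open>c\<close> of the parameter; at an under-crossing it takes the
  color of the incoming arc. Then it is determined by the rule that \<open>c\<close> changes along a segment by
  the action of the over-arcs passed on it.
\<close>

abbreviation passing :: "diagram \<Rightarrow> (real \<Rightarrow> 'a) \<Rightarrow> real \<Rightarrow> (bool \<times> 'a) list" where
  "passing D c t \<equiv> [(along_normal D t, c (over D t))]"

abbreviation corrected_passing :: "diagram \<Rightarrow> (real \<Rightarrow> 'a) \<Rightarrow> real \<Rightarrow> (bool \<times> 'a) list" where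
  "corrected_passing D c t \<equiv> [(\<not> along_normal D t, c t), (along_normal D t, c (over D t))]"

definition passes :: "diagram \<Rightarrow> (real \<Rightarrow> 'a) \<Rightarrow> real set \<Rightarrow> (bool \<times> 'a) list" where
  "passes D c A = word (passing D c) (unders D \<inter> A)"

definition param_longitude :: "diagram \<Rightarrow> (real \<Rightarrow> 'a) \<Rightarrow> real set \<Rightarrow> (bool \<times> 'a) list" where
  "param_longitude D c A = word (corrected_passing D c) (unders D \<inter> A)"

definition corrections :: "diagram \<Rightarrow> 'a \<Rightarrow> real set \<Rightarrow> (bool \<times> 'a) list" where
  "corrections D z A = word (\<lambda>t. [(\<not> along_normal D t, z)]) (unders D \<inter> A)"

definition flows :: "'a magma2 \<Rightarrow> diagram \<Rightarrow> (real \<Rightarrow> 'a) \<Rightarrow> real set \<Rightarrow> bool" where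
  "flows Q D c J \<longleftrightarrow> (\<forall>s t. s \<le> t \<longrightarrow> {s..t} \<subseteq> J \<longrightarrow> c t = act Q (passes D c {s..<t}) (c s))"

definition param_colorings :: "diagram \<Rightarrow> 'a magma2 \<Rightarrow> (real \<Rightarrow> 'a) set" where
  "param_colorings D Q = {c \<in> params D \<rightarrow>\<^sub>E carrier Q. flows Q D c (params D)}"

lemma passes_eq:
  assumes "unders D \<inter> A = unders D' \<inter> A'"
    and "\<And>t. t \<in> unders D' \<Longrightarrow> t \<in> A' \<Longrightarrow>
      along_normal D t = along_normal D' t \<and> c (over D t) = c' (over D' t)"
  shows "passes D c A = passes D' c' A'"
  unfolding passes_def using assms by (intro word_cong) auto

lemma passes_empty: "unders D \<inter> A = {} \<Longrightarrow> passes D c A = []"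
  by (simp add: passes_def)

lemma passes_empty_set [simp]: "passes D c {} = []"
  by (simp add: passes_empty)

lemma passes_split:
  assumes "regular_diagram D" "a \<le> b" "b \<le> d"
  shows "passes D c {a..<d} = passes D c {a..<b} @ passes D c {b..<d}"
proof -
  have "unders D \<inter> {a..<d} = (unders D \<inter> {a..<b}) \<union> (unders D \<inter> {b..<d})"
    using assms by auto
  then show ?thesis
    using finite_unders[OF assms(1)] unfolding passes_def by (auto intro!: word_Un)
qed

lemma passes_colors:
  assumes "regular_diagram D" "c \<in> params D \<rightarrow> carrier Q"
  shows "snd ` set (passes D c A) \<subseteq> carrier Q"
  unfolding passes_def using assms over_props(1) by (intro word_colors) fastforce

lemma param_longitude_colors:
  assumes "regular_diagram D" "c \<in> params D \<rightarrow> carrier Q"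
  shows "snd ` set (param_longitude D c A) \<subseteq> carrier Q"
  unfolding param_longitude_def using assms over_props(1,3) by (intro word_colors) fastforce

lemma flowsD: "flows Q D c J \<Longrightarrow> s \<le> t \<Longrightarrow> {s..t} \<subseteq> J \<Longrightarrow> c t = act Q (passes D c {s..<t}) (c s)"
  by (auto simp: flows_def)

lemma flows_subset: "flows Q D c J \<Longrightarrow> I \<subseteq> J \<Longrightarrow> flows Q D c I"
  by (auto simp: flows_def)

lemma flows_const:
  assumes "flows Q D c J" "s \<le> t" "{s..t} \<subseteq> J" "unders D \<inter> {s..<t} = {}"
  shows "c t = c s"
  using flowsD[OF assms(1-3)] by (simp add: passes_empty[OF assms(4)])

lemma param_coloringsD:
  assumes "c \<in> param_colorings D Q"
  shows "c \<in> params D \<rightarrow> carrier Q" "flows Q D c (params D)" "c \<in> extensional (params D)"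
  using assms by (auto simp: param_colorings_def PiE_def)

text \<open>
  The base point \<open>a\<close> may lie inside the segment, provided that no crossing precedes it: for \<open>t \<le> a\<close>
  the word is empty, and \<open>c\<close> is constant up to \<open>a\<close>.
\<close>

lemma flows_from_base:
  assumes "regular_diagram D" "unders D \<inter> {l..<a} = {}"
    and "\<And>t. t \<in> {l..h} \<Longrightarrow> c t = act Q (passes D c {a..<t}) z"
  shows "flows Q D c {l..h}"
  unfolding flows_def
proof (intro allI impI)
  fix s t :: real assume st: "s \<le> t" "{s..t} \<subseteq> {l..h}"
  then have s: "s \<in> {l..h}" and t: "t \<in> {l..h}" by auto
  show "c t = act Q (passes D c {s..<t}) (c s)"
  proof (cases "a \<le> s")
    case True
    then show ?thesis
      using assms(3)[OF s] assms(3)[OF t] passes_split[OF assms(1) True st(1), of c] by simp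
  next
    case False
    have "unders D \<inter> {s..<t} = unders D \<inter> {a..<t}"
      using assms(2) False s by force
    then have "passes D c {s..<t} = passes D c {a..<t}"
      by (intro passes_eq) auto
    then show ?thesis
      using assms(3)[OF s] assms(3)[OF t] False by simp
  qed
qed

text \<open>The rule is local because the words of adjacent segments are concatenated.\<close>

lemma flows_local:
  assumes "regular_diagram D"
    and "\<And>x. x \<in> J \<Longrightarrow> \<exists>d>0. \<forall>s t. s \<le> x \<and> x \<le> t \<and> t - s < d \<and> {s..t} \<subseteq> J \<longrightarrow>
      c t = act Q (passes D c {s..<t}) (c s)"
  shows "flows Q D c J"
  unfolding flows_def
proof (intro allI impI)
  fix s t :: real assume "s \<le> t" "{s..t} \<subseteq> J"
  then show "c t = act Q (passes D c {s..<t}) (c s)"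
  proof (induction s t rule: Bolzano)
    case (trans a b d)
    have "{a..b} \<subseteq> J" "{b..d} \<subseteq> J" using trans(3-5) by auto
    then show ?case
      using trans(1,2) passes_split[OF assms(1) trans(3,4), of c] by simp
  next
    case (local x)
    show ?case
    proof (cases "x \<in> J")
      case True
      then show ?thesis using assms(2)[OF True] by (metis (no_types, lifting))
    next
      case False
      then show ?thesis by (intro exI[of _ 1]) (auto simp: subset_eq)
    qed
  qed
qed

context quandle
begin

lemma param_longitude_segment:
  assumes D: "regular_diagram D" and c: "c \<in> params D \<rightarrow> carrier Q" and fl: "flows Q D c {a..b}"
    and ab: "{a..b} \<subseteq> params D" and a: "a \<in> params D"
    and A: "A = {a..b} \<or> A = {a..<b}" and u: "u \<in> carrier Q"
  shows "act Q (param_longitude D c A) u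
       = act Q (passes D c A) (act Q (corrections D (c a) A) u)"
proof -
  let ?A = "unders D \<inter> A"
  have fin: "finite ?A" using finite_unders[OF D] by simp
  have "act Q (concat (map (\<lambda>t. [(\<not> along_normal D t, c t), (along_normal D t, c (over D t))])
      (sorted_list_of_set ?A))) u =
    act Q (map (\<lambda>t. (along_normal D t, c (over D t))) (sorted_list_of_set ?A))
      (act Q (map (\<lambda>t. (\<not> along_normal D t, c a)) (sorted_list_of_set ?A)) u)"
  proof (rule act_corrected_word)
    show "(\<lambda>t. c (over D t)) ` set (sorted_list_of_set ?A) \<subseteq> carrier Q"
      using fin c over_props(1)[OF D] by auto
    fix p t r assume "sorted_list_of_set ?A = p @ t # r"
    note p = sorted_list_of_set_prefix[OF fin this]
    have t: "t \<in> {a..b}" using p(2) A by auto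
    have "c t = act Q (passes D c {a..<t}) (c a)" using flowsD[OF fl, of a t] t by auto
    moreover have "unders D \<inter> {a..<t} = ?A \<inter> {..<t}" using t A by auto
    ultimately show "c t = act Q (map (\<lambda>t. (along_normal D t, c (over D t))) p) (c a)"
      unfolding p(1) passes_def word_def by (simp add: comp_def)
  qed (use a c u in auto)
  then show ?thesis by (simp add: passes_def param_longitude_def corrections_def word_def comp_def)
qed

end

section \<open>Local changes of a diagram\<close>

text \<open>
  The combinatorial content of \<open>D'\<close> arising from \<open>D\<close> by a change inside a disc whose intersection
  with the curve consists of the strands in \<open>\<J>\<close>.
\<close>

definition local_change :: "real set set \<Rightarrow> diagram \<Rightarrow> diagram \<Rightarrow> bool" where
  "local_change \<J> D D' \<longleftrightarrow> proper_diagram D \<and> proper_diagram D' \<and> params D' = params D \<and>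
     finite \<J> \<and> (\<forall>J\<in>\<J>. \<exists>a b. J = {a..b}) \<and> \<Union>\<J> \<subseteq> interior (params D) \<and>
     (\<forall>J\<in>\<J>. \<forall>K\<in>\<J>. J \<noteq> K \<longrightarrow> J \<inter> K = {}) \<and>
     unders D' - \<Union>\<J> = unders D - \<Union>\<J> \<and>
     (\<forall>t\<in>unders D - \<Union>\<J>. over D' t = over D t \<and> over D t \<notin> \<Union>\<J> \<and>
        along_normal D' t = along_normal D t) \<and>
     (\<forall>t\<in>unders D \<inter> \<Union>\<J>. over D t \<in> \<Union>\<J>) \<and>
     (\<forall>t\<in>unders D' \<inter> \<Union>\<J>. over D' t \<in> \<Union>\<J>)"

lemma local_change_sym: "local_change \<J> D D' \<Longrightarrow> local_change \<J> D' D"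
  by (auto simp: local_change_def)

lemma local_changeD:
  assumes "local_change \<J> D D'"
  shows "regular_diagram D" "regular_diagram D'" "params D' = params D" "finite \<J>"
    "\<Union>\<J> \<subseteq> params D" "\<Union>\<J> \<subseteq> interior (params D)"
    "unders D' - \<Union>\<J> = unders D - \<Union>\<J>"
proof -
  show "regular_diagram D" "regular_diagram D'" "params D' = params D" "finite \<J>"
    "unders D' - \<Union>\<J> = unders D - \<Union>\<J>"
    using assms by (simp_all add: local_change_def proper_diagram_def)
  show I: "\<Union>\<J> \<subseteq> interior (params D)" using assms unfolding local_change_def by meson
  then show "\<Union>\<J> \<subseteq> params D" using interior_subset by (rule subset_trans)
qed

lemma local_change_strand: "local_change \<J> D D' \<Longrightarrow> J \<in> \<J> \<Longrightarrow> J \<subseteq> params D"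
  using local_changeD(5) by (metis Sup_le_iff)

lemma local_change_interval:
  assumes "local_change \<J> D D'" "J \<in> \<J>"
  shows "\<exists>a b. J = {a..b}" "closed J" "is_interval J"
proof -
  show "\<exists>a b. J = {a..b}" using assms unfolding local_change_def by meson
  then show "closed J" "is_interval J" using is_interval_cc by auto
qed

lemma local_change_disjoint:
  "local_change \<J> D D' \<Longrightarrow> J \<in> \<J> \<Longrightarrow> K \<in> \<J> \<Longrightarrow> J \<noteq> K \<Longrightarrow> J \<inter> K = {}"
  unfolding local_change_def by meson

lemma local_change_outside:
  assumes "local_change \<J> D D'" "t \<in> unders D" "t \<notin> \<Union>\<J>"
  shows "over D' t = over D t" "over D t \<notin> \<Union>\<J>" "along_normal D' t = along_normal D t"
proof -
  have "\<forall>t\<in>unders D - \<Union>\<J>. over D' t = over D t \<and> over D t \<notin> \<Union>\<J> \<and>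
        along_normal D' t = along_normal D t"
    using assms(1) unfolding local_change_def by meson
  then show "over D' t = over D t" "over D t \<notin> \<Union>\<J>" "along_normal D' t = along_normal D t"
    using assms(2,3) by simp_all
qed

lemma local_change_closed: "local_change \<J> D D' \<Longrightarrow> closed (\<Union>\<J>)"
  using local_changeD(4) local_change_interval(2) closed_Union by metis

lemma collar:
  fixes a b :: real
  assumes "closed F" "a \<le> b" "{a..b} \<inter> F = {}"
  obtains d where "d > 0" "{a-d..b+d} \<inter> F = {}"
proof -
  obtain e where e: "e > 0" "\<And>s t. s \<in> {a..b} \<Longrightarrow> t \<in> F \<Longrightarrow> e \<le> dist s t"
    using separate_compact_closed[OF _ assms(1,3)] by auto
  have "t \<notin> F" if t: "t \<in> {a-e/2..b+e/2}" for t
  proof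
    assume "t \<in> F"
    moreover have "max a (min t b) \<in> {a..b}" using assms(2) by auto
    ultimately have "e \<le> dist (max a (min t b)) t" using e(2) by blast
    then show False using t e(1) assms(2) by (auto simp: dist_real_def max_def min_def split: if_splits)
  qed
  then have "{a-e/2..b+e/2} \<inter> F = {}" by blast
  then show ?thesis using that[of "e/2"] e(1) by simp
qed

lemma local_change_collar:
  assumes lc: "local_change \<J> D D'" and J: "{a..b} \<in> \<J>" and ab: "a \<le> b"
  obtains d where "d > 0" "{a-d..b+d} \<subseteq> params D" "{a-d..b+d} \<inter> \<Union>\<J> = {a..b}"
    "{a-d..b+d} \<inter> unders D \<subseteq> {a..b}" "{a-d..b+d} \<inter> unders D' \<subseteq> {a..b}"
proof -
  let ?F = "- interior (params D) \<union> (\<Union>(\<J> - {{a..b}}) \<union> ((unders D \<union> unders D') - {a..b}))"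
  have "finite (unders D \<union> unders D')"
    using local_changeD(1,2)[OF lc] finite_unders by simp
  then have "closed ((unders D \<union> unders D') - {a..b})"
    by (intro finite_imp_closed) simp
  moreover have "closed (\<Union>(\<J> - {{a..b}}))"
    using local_changeD(4)[OF lc] local_change_interval(2)[OF lc] by (intro closed_Union) simp_all
  ultimately have "closed ?F" by (intro closed_Un) auto
  moreover have "{a..b} \<inter> ?F = {}"
  proof -
    have "\<Union>(\<J> - {{a..b}}) \<inter> {a..b} = {}"
      using local_change_disjoint[OF lc _ J] by blast
    moreover have "{a..b} \<subseteq> interior (params D)"
      using local_changeD(6)[OF lc] J by blast
    ultimately show ?thesis by (simp only: Int_Un_distrib) blast
  qed
  ultimately obtain d where d: "d > 0" "{a-d..b+d} \<inter> ?F = {}"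
    using collar[OF _ ab] by blast
  have "{a-d..b+d} \<subseteq> params D"
    using d(2) interior_subset[of "params D"] by blast
  moreover have "{a-d..b+d} \<inter> \<Union>\<J> = {a..b}"
  proof
    show "{a-d..b+d} \<inter> \<Union>\<J> \<subseteq> {a..b}" using d(2) by blast
    have "{a..b} \<subseteq> {a-d..b+d}" using d(1) by auto
    then show "{a..b} \<subseteq> {a-d..b+d} \<inter> \<Union>\<J>" using J by blast
  qed
  moreover have "{a-d..b+d} \<inter> unders D \<subseteq> {a..b}" "{a-d..b+d} \<inter> unders D' \<subseteq> {a..b}"
    using d(2) by blast+
  ultimately show ?thesis using that d(1) by blast
qed

definition agree_off :: "real set set \<Rightarrow> diagram \<Rightarrow> (real \<Rightarrow> 'a) \<Rightarrow> (real \<Rightarrow> 'a) \<Rightarrow> bool" where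
  "agree_off \<J> D c c' \<longleftrightarrow> (\<forall>t\<in>params D - \<Union>\<J>. c' t = c t)"

definition agree_at_entries :: "real set set \<Rightarrow> (real \<Rightarrow> 'a) \<Rightarrow> (real \<Rightarrow> 'a) \<Rightarrow> bool" where
  "agree_at_entries \<J> c c' \<longleftrightarrow> (\<forall>a b. a \<le> b \<longrightarrow> {a..b} \<in> \<J> \<longrightarrow> c' a = c a)"

lemma collar_flow:
  assumes lc: "local_change \<J> D D'" and fl: "flows Q D c (params D)"
    and sub: "{a-d..b+d} \<subseteq> params D" "{a-d..b+d} \<inter> unders D \<subseteq> {a..b}" and "d > 0" and ab: "a \<le> b"
  shows "t \<in> {a-d..a} \<Longrightarrow> c t = c a"
    and "t \<in> {b<..b+d} \<Longrightarrow> c t = act Q (passes D c {a..b}) (c a)"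
proof -
  show "c t = c a" if t: "t \<in> {a-d..a}"
  proof -
    have u: "{t..a} \<subseteq> params D" "{t..<a} \<subseteq> {a-d..b+d}" using t sub(1) assms(5,6) by auto
    then have "unders D \<inter> {t..<a} = {}" using sub(2) by fastforce
    then show ?thesis using flows_const[OF fl, of t a] u t by simp
  qed
  show "c t = act Q (passes D c {a..b}) (c a)" if t: "t \<in> {b<..b+d}"
  proof -
    have u: "{a..t} \<subseteq> params D" "{a..<t} \<subseteq> {a-d..b+d}" using t sub(1) assms(5,6) by auto
    then have "unders D \<inter> {a..<t} = unders D \<inter> {a..b}" using sub(2) t by fastforce
    then have "passes D c {a..<t} = passes D c {a..b}" by (rule passes_eq) simp
    then show ?thesis using flowsD[OF fl, of a t] u t ab by simp
  qed
qed

text \<open>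
  The entry of a strand belongs to the disc, but no crossing separates it from the points just
  before it, which lie outside.
\<close>

lemma agree_off_entries:
  assumes lc: "local_change \<J> D D'" and "flows Q D c (params D)" "flows Q D' c' (params D')"
    and off: "agree_off \<J> D c c'"
  shows "agree_at_entries \<J> c c'"
  unfolding agree_at_entries_def
proof (intro allI impI)
  fix a b :: real assume ab: "a \<le> b" "{a..b} \<in> \<J>"
  obtain d where d: "d > 0" "{a-d..b+d} \<subseteq> params D" "{a-d..b+d} \<inter> \<Union>\<J> = {a..b}"
    "{a-d..b+d} \<inter> unders D \<subseteq> {a..b}" "{a-d..b+d} \<inter> unders D' \<subseteq> {a..b}"
    using local_change_collar[OF lc ab(2,1)] .
  have P: "params D' = params D" using lc by (simp add: local_change_def)
  have m: "a - d \<in> {a-d..b+d}" "a - d \<notin> {a..b}" using d(1) ab(1) by auto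
  then have "a - d \<in> params D" "a - d \<notin> \<Union>\<J>" using d(2,3) by blast+
  then have "c' (a - d) = c (a - d)" using off by (simp add: agree_off_def)
  moreover have "c (a - d) = c a"
    by (rule collar_flow(1)[OF lc assms(2) d(2,4,1) ab(1)]) (use d(1) in auto)
  moreover have "c' (a - d) = c' a"
    by (rule collar_flow(1)[OF local_change_sym[OF lc] assms(3) _ d(5,1) ab(1)]) (use d(1,2) P in auto)
  ultimately show "c' a = c a" by simp
qed

text \<open>
  \<open>D\<close> can be colored inside the disc in exactly one way for given colors of the strands that enter
  it. That the colors of the strands leaving the disc fit is a separate matter.
\<close>

definition fillable :: "'a magma2 \<Rightarrow> diagram \<Rightarrow> real set set \<Rightarrow> bool" where
  "fillable Q D \<J> \<longleftrightarrow>
     (\<forall>c \<in> params D \<rightarrow> carrier Q. \<exists>c' \<in> params D \<rightarrow> carrier Q.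
        agree_off \<J> D c c' \<and> agree_at_entries \<J> c c' \<and> (\<forall>J\<in>\<J>. flows Q D c' J)) \<and>
     (\<forall>c \<in> params D \<rightarrow> carrier Q. \<forall>c' \<in> params D \<rightarrow> carrier Q.
        agree_off \<J> D c c' \<longrightarrow> agree_at_entries \<J> c c' \<longrightarrow>
        (\<forall>J\<in>\<J>. flows Q D c J \<and> flows Q D c' J) \<longrightarrow> (\<forall>t\<in>\<Union>\<J>. c' t = c t))"

text \<open>
  The words of over-arcs are compared only on the entering color: a kink adds a letter, which fixes
  that color but not every element. Its contribution to the longitude is cancelled by a correction.
\<close>

definition same_effect :: "'a magma2 \<Rightarrow> diagram \<Rightarrow> diagram \<Rightarrow> real set set \<Rightarrow> bool" where
  "same_effect Q D D' \<J> \<longleftrightarrow>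
     (\<forall>c \<in> params D \<rightarrow> carrier Q. \<forall>c' \<in> params D \<rightarrow> carrier Q. agree_at_entries \<J> c c' \<longrightarrow>
        (\<forall>J\<in>\<J>. flows Q D c J \<and> flows Q D' c' J) \<longrightarrow>
        (\<forall>a b. a \<le> b \<longrightarrow> {a..b} \<in> \<J> \<longrightarrow>
           act Q (passes D' c' {a..b}) (c' a) = act Q (passes D c {a..b}) (c a) \<and>
           (\<forall>u\<in>carrier Q. act Q (param_longitude D' c' {a..b}) u =
                            act Q (param_longitude D c {a..b}) u)))"

lemma agree_at_entries_sym: "agree_at_entries \<J> c c' \<Longrightarrow> agree_at_entries \<J> c' c"
  by (simp add: agree_at_entries_def)

lemma same_effect_sym:
  assumes "same_effect Q D D' \<J>" "params D' = params D"
  shows "same_effect Q D' D \<J>"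
  unfolding same_effect_def
proof (intro ballI allI impI)
  fix c c' a b
  assume "c \<in> params D' \<rightarrow> carrier Q" "c' \<in> params D' \<rightarrow> carrier Q" "agree_at_entries \<J> c c'"
    "\<forall>J\<in>\<J>. flows Q D' c J \<and> flows Q D c' J" "a \<le> (b::real)" "{a..b} \<in> \<J>"
  then show "act Q (passes D c' {a..b}) (c' a) = act Q (passes D' c {a..b}) (c a) \<and>
      (\<forall>u\<in>carrier Q. act Q (param_longitude D c' {a..b}) u = act Q (param_longitude D' c {a..b}) u)"
    using assms(1)[unfolded same_effect_def, rule_format, of c' c a b] assms(2)
      agree_at_entries_sym[of \<J> c c'] by auto
qed

context quandle
begin

text \<open>
  The coloring condition is local. Around a strand of the disc it holds from the collar before the
  strand up to its end by the flow inside, and beyond its end because the two diagrams carry the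
  entering color to the same color.
\<close>

lemma glue_coloring:
  assumes lc: "local_change \<J> D D'" and c: "c \<in> param_colorings D Q"
    and c': "c' \<in> params D \<rightarrow>\<^sub>E carrier Q" and off: "agree_off \<J> D c c'"
    and ent: "agree_at_entries \<J> c c'" and fl: "\<forall>J\<in>\<J>. flows Q D' c' J"
    and ex: "\<And>a b. a \<le> b \<Longrightarrow> {a..b} \<in> \<J> \<Longrightarrow>
      act Q (passes D' c' {a..b}) (c' a) = act Q (passes D c {a..b}) (c a)"
  shows "c' \<in> param_colorings D' Q"
proof -
  note reg = local_changeD(1,2)[OF lc] and P = local_changeD(3)[OF lc]
  note cf = param_coloringsD(2)[OF c]
  have "flows Q D' c' (params D')"
  proof (rule flows_local[OF reg(2)])
    fix x assume x: "x \<in> params D'"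
    show "\<exists>d>0. \<forall>s t. s \<le> x \<and> x \<le> t \<and> t - s < d \<and> {s..t} \<subseteq> params D' \<longrightarrow>
      c' t = act Q (passes D' c' {s..<t}) (c' s)"
    proof (cases "x \<in> \<Union>\<J>")
      case False
      then obtain d where d: "d > 0" "ball x d \<inter> \<Union>\<J> = {}"
        using local_change_closed[OF lc] open_contains_ball_eq[of "- \<Union>\<J>"] by blast
      have "c' t = act Q (passes D' c' {s..<t}) (c' s)"
        if st: "s \<le> x" "x \<le> t" "t - s < d" "{s..t} \<subseteq> params D'" for s t
      proof -
        have "{s..t} \<subseteq> ball x d" using st by (auto simp: ball_eq_greaterThanLessThan)
        then have out: "{s..t} \<inter> \<Union>\<J> = {}" using d(2) by blast
        have U: "unders D' \<inter> {s..<t} = unders D \<inter> {s..<t}"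
        proof -
          have "{s..<t} \<inter> \<Union>\<J> = {}" using out atLeastLessThan_subseteq_atLeastAtMost_iff[of s t s t] by blast
          then show ?thesis using local_changeD(7)[OF lc] by blast
        qed
        have "passes D' c' {s..<t} = passes D c {s..<t}"
        proof (rule passes_eq[OF U])
          fix u assume u: "u \<in> unders D" "u \<in> {s..<t}"
          then have "u \<in> {s..t}" by simp
          then have "u \<notin> \<Union>\<J>" using out by blast
          note local_change_outside[OF lc u(1) this]
          then show "along_normal D' u = along_normal D u \<and> c' (over D' u) = c (over D u)"
            using off over_props(1)[OF reg(1) u(1)] by (auto simp: agree_off_def)
        qed
        moreover have "s \<in> params D - \<Union>\<J>" "t \<in> params D - \<Union>\<J>"
        proof -
          have "s \<in> {s..t}" "t \<in> {s..t}" using st by auto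
          then show "s \<in> params D - \<Union>\<J>" "t \<in> params D - \<Union>\<J>" using st(4) out P by blast+
        qed
        ultimately show ?thesis
          using flowsD[OF cf, of s t] st off P by (simp add: agree_off_def)
      qed
      then show ?thesis using d(1) by blast
    next
      case True
      then obtain a b where J: "{a..b} \<in> \<J>" "x \<in> {a..b}"
        using local_change_interval(1)[OF lc] by (metis UnionE)
      then have ab: "a \<le> b" by auto
      obtain d where d: "d > 0" "{a-d..b+d} \<subseteq> params D" "{a-d..b+d} \<inter> \<Union>\<J> = {a..b}"
        "{a-d..b+d} \<inter> unders D \<subseteq> {a..b}" "{a-d..b+d} \<inter> unders D' \<subseteq> {a..b}"
        using local_change_collar[OF lc J(1) ab] .
      have ca: "c' a = c a" using ent ab J(1) by (simp add: agree_at_entries_def)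
      have out: "c' r = c r" if "r \<in> {a-d..b+d}" "r \<notin> {a..b}" for r
      proof -
        have "r \<in> params D - \<Union>\<J>" using that d(2,3) by blast
        then show ?thesis using off by (simp add: agree_off_def)
      qed
      have "flows Q D' c' {a-d..b+d}"
      proof (rule flows_from_base[OF reg(2)])
        show "unders D' \<inter> {a-d..<a} = {}"
        proof -
          have "{a-d..<a} \<subseteq> {a-d..b+d} - {a..b}" using ab d(1) by auto
          then show ?thesis using d(5) by blast
        qed
        fix r assume r: "r \<in> {a-d..b+d}"
        consider "r < a" | "r \<in> {a..b}" | "r > b" by fastforce
        then show "c' r = act Q (passes D' c' {a..<r}) (c' a)"
        proof cases
          case 1
          then show ?thesis
            using out[OF r] collar_flow(1)[OF lc cf d(2,4,1) ab, of r] r ca by simp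
        next
          case 2
          then show ?thesis using flowsD[of Q D' c' "{a..b}" a r] fl J(1) by auto
        next
          case 3
          have "{a..<r} = {a..b} \<union> {b<..<r}" "{b<..<r} \<subseteq> {a-d..b+d} - {a..b}"
            using 3 r ab d(1) by auto
          then have "unders D' \<inter> {a..<r} = unders D' \<inter> {a..b}"
            using d(5) by blast
          then have "passes D' c' {a..<r} = passes D' c' {a..b}" by (rule passes_eq) simp
          then show ?thesis
            using out[OF r] collar_flow(2)[OF lc cf d(2,4,1) ab, of r] r 3 ex[OF ab J(1)] by simp
        qed
      qed
      then have "c' t = act Q (passes D' c' {s..<t}) (c' s)" if "s \<le> x" "x \<le> t" "t - s < d" for s t
        by (rule flowsD) (use that J(2) in auto)
      then show ?thesis using d(1) by blast
    qed
  qed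
  then show ?thesis using c' P by (simp add: param_colorings_def)
qed

lemma transferred_coloring_exists:
  assumes lc: "local_change \<J> D D'" and fi: "fillable Q D' \<J>" and se: "same_effect Q D D' \<J>"
    and c: "c \<in> param_colorings D Q"
  shows "\<exists>c' \<in> param_colorings D' Q. agree_off \<J> D c c'"
proof -
  note P = local_changeD(3)[OF lc] and I = local_changeD(5)[OF lc]
  note cc = param_coloringsD[OF c]
  obtain c' where c': "c' \<in> params D \<rightarrow> carrier Q" "agree_off \<J> D c c'" "agree_at_entries \<J> c c'"
    "\<forall>J\<in>\<J>. flows Q D' c' J"
    using bspec[OF conjunct1[OF fi[unfolded fillable_def]], of c] cc(1)
    unfolding P agree_off_def by blast
  define c2 where "c2 = restrict c' (params D)"
  have eq: "c2 t = c' t" if "t \<in> params D" for t using that by (simp add: c2_def)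
  have pe: "passes D' c2 A = passes D' c' A" for A
    by (rule passes_eq) (use eq over_props(1)[OF local_changeD(2)[OF lc]] P in auto)
  have c2: "c2 \<in> params D \<rightarrow>\<^sub>E carrier Q" using c'(1) by (auto simp: c2_def)
  have "\<forall>J\<in>\<J>. flows Q D' c2 J"
    unfolding flows_def
  proof (intro ballI allI impI)
    fix J s t assume J: "J \<in> \<J>" "s \<le> t" "{s..t} \<subseteq> J"
    then have "s \<in> J" "t \<in> J" by auto
    then have "s \<in> params D" "t \<in> params D" using I J(1) by blast+
    then show "c2 t = act Q (passes D' c2 {s..<t}) (c2 s)"
      using flowsD[of Q D' c' J s t] c'(4) J eq pe by simp
  qed
  moreover have off: "agree_off \<J> D c c2" using c'(2) eq by (auto simp: agree_off_def)
  moreover have ent: "agree_at_entries \<J> c c2"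
    unfolding agree_at_entries_def
  proof (intro allI impI)
    fix a b :: real assume ab: "a \<le> b" "{a..b} \<in> \<J>"
    then have "a \<in> {a..b}" by simp
    then have "a \<in> params D" using I ab(2) by blast
    then show "c2 a = c a" using c'(3) eq ab by (auto simp: agree_at_entries_def)
  qed
  moreover have "act Q (passes D' c2 {a..b}) (c2 a) = act Q (passes D c {a..b}) (c a)"
    if "a \<le> b" "{a..b} \<in> \<J>" for a b
  proof -
    have "\<forall>J\<in>\<J>. flows Q D c J" using flows_subset[OF cc(2)] local_change_strand[OF lc] by simp
    then show ?thesis
      using se[unfolded same_effect_def, rule_format, of c c2 a b] that cc(1) c2 ent
        \<open>\<forall>J\<in>\<J>. flows Q D' c2 J\<close> by (auto simp: PiE_def)
  qed
  ultimately have "c2 \<in> param_colorings D' Q" using glue_coloring[OF lc c c2] by blast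
  then show ?thesis using off by blast
qed

lemma transferred_coloring_unique:
  assumes lc: "local_change \<J> D D'" and fi: "fillable Q D \<J>"
    and c: "c1 \<in> param_colorings D Q" "c2 \<in> param_colorings D Q" and off: "agree_off \<J> D c1 c2"
  shows "c1 = c2"
proof (rule extensionalityI[OF param_coloringsD(3)[OF c(1)] param_coloringsD(3)[OF c(2)]])
  note I = local_changeD(5)[OF lc]
  have lD: "local_change \<J> D D" 
    using lc local_change_outside(2)[OF lc] by (simp add: local_change_def del: Union_iff)
  note f1 = param_coloringsD(2)[OF c(1)] and f2 = param_coloringsD(2)[OF c(2)]
  have "\<forall>J\<in>\<J>. flows Q D c1 J \<and> flows Q D c2 J"
    using local_change_strand[OF lc] flows_subset[OF f1] flows_subset[OF f2] by simp
  moreover have "agree_at_entries \<J> c1 c2" by (rule agree_off_entries[OF lD f1 f2 off])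
  ultimately have "\<forall>t\<in>\<Union>\<J>. c2 t = c1 t"
    using fi[unfolded fillable_def, THEN conjunct2, rule_format, of c1 c2] off
      param_coloringsD(1)[OF c(1)] param_coloringsD(1)[OF c(2)] by blast
  then show "c1 t = c2 t" if "t \<in> params D" for t
    using off that by (cases "t \<in> \<Union>\<J>") (auto simp: agree_off_def)
qed

lemma transferred_longitude:
  assumes lc: "local_change \<J> D D'" and se: "same_effect Q D D' \<J>"
    and c: "c \<in> param_colorings D Q" "c' \<in> param_colorings D' Q" and off: "agree_off \<J> D c c'"
    and S: "\<And>J. J \<in> \<J> \<Longrightarrow> J \<subseteq> S \<or> J \<inter> S = {}" and u: "u \<in> carrier Q"
  shows "act Q (param_longitude D c S) u = act Q (param_longitude D' c' S) u"
proof -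
  note reg = local_changeD(1,2)[OF lc] and P = local_changeD(3)[OF lc] and I = local_changeD(5)[OF lc]
  note f1 = param_coloringsD(2)[OF c(1)] and f2 = param_coloringsD(2)[OF c(2)]
  note v1 = param_coloringsD(1)[OF c(1)] and v2 = param_coloringsD(1)[OF c(2)]
  have fl: "\<forall>J\<in>\<J>. flows Q D c J \<and> flows Q D' c' J"
    using local_change_strand[OF lc] flows_subset[OF f1] flows_subset[OF f2] P by simp
  have ent: "agree_at_entries \<J> c c'" by (rule agree_off_entries[OF lc f1 f2 off])
  show ?thesis
    unfolding param_longitude_def
  proof (rule act_word_replace_all[of \<J>, OF _ _ _ _ _ _ _ _ _ _ u])
    show "unders D \<inter> S - \<Union>\<J> = unders D' \<inter> S - \<Union>\<J>"
    proof -
      have "A \<inter> S - I = B \<inter> S - I" if "A - I = B - I" for A B I :: "real set" using that by blast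
      then show ?thesis using local_changeD(7)[OF lc] by metis
    qed
    show "corrected_passing D c t = corrected_passing D' c' t" if t: "t \<in> unders D \<inter> S - \<Union>\<J>" for t
    proof -
      have tU: "t \<in> unders D" "t \<notin> \<Union>\<J>" using t by (simp_all del: Union_iff)
      show ?thesis
        using local_change_outside[OF lc tU] off over_props(1,3)[OF reg(1) tU(1)] tU(2)
        by (simp add: agree_off_def del: Union_iff)
    qed
    show "is_interval J" if "J \<in> \<J>" for J
      using local_change_interval(3)[OF lc that] .
    show "J \<inter> K = {}" if "J \<in> \<J>" "K \<in> \<J>" "J \<noteq> K" for J K
      using local_change_disjoint[OF lc that] .
    show "finite \<J>" using local_changeD(4)[OF lc] .
    fix J v assume J: "J \<in> \<J>" and v: "v \<in> carrier Q"
    show "act Q (word (corrected_passing D c) (unders D \<inter> S \<inter> J)) v =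
        act Q (word (corrected_passing D' c') (unders D' \<inter> S \<inter> J)) v"
    proof (cases "J \<inter> S = {}")
      case True
      then have "unders D \<inter> S \<inter> J = {}" "unders D' \<inter> S \<inter> J = {}" by auto
      then show ?thesis by simp
    next
      case False
      then have JS: "unders D \<inter> S \<inter> J = unders D \<inter> J" "unders D' \<inter> S \<inter> J = unders D' \<inter> J"
        using S[OF J] by auto
      obtain a b where ab: "J = {a..b}" using local_change_interval(1)[OF lc J] by blast
      then have "a \<le> b" using False by auto
      then show ?thesis
        using se[unfolded same_effect_def, rule_format, of c c' a b] v1 v2 P ent fl J ab v JS
        by (simp add: param_longitude_def)
    qed
  qed (use finite_unders[OF reg(1)] finite_unders[OF reg(2)] v1 v2 over_props(1,3)[OF reg(1)]
         over_props(1,3)[OF reg(2)] in \<open>auto simp: Pi_iff\<close>)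
qed

end

lemma sum_eq_by_matching:
  assumes ex: "\<And>a. a \<in> A \<Longrightarrow> \<exists>b\<in>B. R a b" "\<And>b. b \<in> B \<Longrightarrow> \<exists>a\<in>A. R a b"
    and un: "\<And>a b b'. a \<in> A \<Longrightarrow> b \<in> B \<Longrightarrow> b' \<in> B \<Longrightarrow> R a b \<Longrightarrow> R a b' \<Longrightarrow> b = b'"
      "\<And>a a' b. a \<in> A \<Longrightarrow> a' \<in> A \<Longrightarrow> b \<in> B \<Longrightarrow> R a b \<Longrightarrow> R a' b \<Longrightarrow> a = a'"
    and fg: "\<And>a b. a \<in> A \<Longrightarrow> b \<in> B \<Longrightarrow> R a b \<Longrightarrow> f a = g b"
  shows "sum f A = sum g B"
proof -
  define h where "h a = (SOME b. b \<in> B \<and> R a b)" for a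
  have h: "h a \<in> B \<and> R a (h a)" if "a \<in> A" for a
    unfolding h_def by (rule someI_ex) (use ex(1)[OF that] in blast)
  have "bij_betw h A B"
    unfolding bij_betw_def inj_on_def using h ex(2) un by (auto simp: image_iff) metis+
  then have "sum g B = (\<Sum>a\<in>A. g (h a))" by (simp add: sum.reindex_bij_betw)
  also have "\<dots> = sum f A" using h fg by (metis (no_types, lifting) sum.cong)
  finally show ?thesis by simp
qed

text \<open>
  Colorings of \<open>D\<close> and of \<open>D'\<close> correspond to each other if they agree outside the disc; this
  respects every condition \<open>\<beta>\<close> on the colors outside.
\<close>

theorem (in quandle) local_change_invariance:
  assumes lc: "local_change \<J> D D'" and fi: "fillable Q D \<J>" "fillable Q D' \<J>"
    and se: "same_effect Q D D' \<J>"
    and S: "\<And>J. J \<in> \<J> \<Longrightarrow> J \<subseteq> S1 \<or> J \<inter> S1 = {}" "\<And>J. J \<in> \<J> \<Longrightarrow> J \<subseteq> S2 \<or> J \<inter> S2 = {}"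
    and \<beta>: "\<And>c c'. agree_off \<J> D c c' \<Longrightarrow> \<beta> c \<longleftrightarrow> \<beta> c'" and x: "x \<in> carrier Q"
  shows "(\<Sum>c \<in> {c \<in> param_colorings D Q. \<beta> c}.
            h (act Q (param_longitude D c S1 @ param_longitude D c S2) x)) =
         (\<Sum>c \<in> {c \<in> param_colorings D' Q. \<beta> c}.
            h (act Q (param_longitude D' c S1 @ param_longitude D' c S2) x))"
proof (rule sum_eq_by_matching[where R = "agree_off \<J> D"])
  note lc' = local_change_sym[OF lc]
  have P: "params D' = params D" using lc by (simp add: local_change_def)
  have off': "agree_off \<J> D' c c' \<longleftrightarrow> agree_off \<J> D c' c" for c c' :: "real \<Rightarrow> 'a"
    using P by (auto simp: agree_off_def)
  show "\<exists>b\<in>{c \<in> param_colorings D' Q. \<beta> c}. agree_off \<J> D a b"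
    if "a \<in> {c \<in> param_colorings D Q. \<beta> c}" for a
    using transferred_coloring_exists[OF lc fi(2) se] \<beta> that by blast
  show "\<exists>a\<in>{c \<in> param_colorings D Q. \<beta> c}. agree_off \<J> D a b"
    if "b \<in> {c \<in> param_colorings D' Q. \<beta> c}" for b
    using transferred_coloring_exists[OF lc' fi(1) same_effect_sym[OF se P]] \<beta> that off' by blast
  show "b = b'" if "b \<in> {c \<in> param_colorings D' Q. \<beta> c}" "b' \<in> {c \<in> param_colorings D' Q. \<beta> c}"
    "agree_off \<J> D a b" "agree_off \<J> D a b'" for a b b'
    by (rule transferred_coloring_unique[OF lc' fi(2)])
      (use that P in \<open>auto simp: agree_off_def\<close>)
  show "a = a'" if "a \<in> {c \<in> param_colorings D Q. \<beta> c}" "a' \<in> {c \<in> param_colorings D Q. \<beta> c}"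
    "agree_off \<J> D a b" "agree_off \<J> D a' b" for a a' b
    by (rule transferred_coloring_unique[OF lc fi(1)])
      (use that in \<open>auto simp: agree_off_def\<close>)
  show "h (act Q (param_longitude D a S1 @ param_longitude D a S2) x) =
        h (act Q (param_longitude D' b S1 @ param_longitude D' b S2) x)"
    if ab: "a \<in> {c \<in> param_colorings D Q. \<beta> c}" "b \<in> {c \<in> param_colorings D' Q. \<beta> c}"
      "agree_off \<J> D a b" for a b
  proof -
    have reg: "regular_diagram D" using lc proper_regular by (auto simp: local_change_def)
    have 1: "act Q (param_longitude D a S1) x = act Q (param_longitude D' b S1) x"
      by (rule transferred_longitude[OF lc se _ _ ab(3) S(1) x]) (use ab in auto)
    have "act Q (param_longitude D a S1) x \<in> carrier Q"
      using ab param_coloringsD(1) x by (intro act_closed param_longitude_colors reg) auto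
    then have "act Q (param_longitude D a S2) (act Q (param_longitude D a S1) x) =
        act Q (param_longitude D' b S2) (act Q (param_longitude D a S1) x)"
      by (intro transferred_longitude[OF lc se _ _ ab(3) S(2)]) (use ab in auto)
    then show ?thesis using 1 by simp
  qed
qed

section \<open>Coloring the disc of a Reidemeister move\<close>

lemma flows_cong:
  assumes fl: "flows Q D c J" and eq: "\<And>t. t \<in> J \<Longrightarrow> c' t = c t"
    and ov: "\<And>u. u \<in> unders D \<Longrightarrow> u \<in> J \<Longrightarrow> c' (over D u) = c (over D u)"
  shows "flows Q D c' J"
  unfolding flows_def
proof (intro allI impI)
  fix s t assume st: "s \<le> t" "{s..t} \<subseteq> J"
  have "passes D c' {s..<t} = passes D c {s..<t}"
    by (rule passes_eq) (use st ov in \<open>auto simp: subset_iff\<close>)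
  moreover have "s \<in> J" "t \<in> J" using st by auto
  ultimately show "c' t = act Q (passes D c' {s..<t}) (c' s)"
    using flowsD[OF fl st] eq by simp
qed

lemma flows_unique:
  assumes fl: "flows Q D c {a..b}" "flows Q D c' {a..b}" and a: "c' a = c a" and t: "t \<in> {a..b}"
    and ov: "\<And>u. u \<in> unders D \<Longrightarrow> u \<in> {a..b} \<Longrightarrow> c' (over D u) = c (over D u)"
  shows "c' t = c t"
proof -
  have "passes D c' {a..<t} = passes D c {a..<t}"
    by (rule passes_eq) (use t ov in auto)
  then show ?thesis
    using flowsD[OF fl(1), of a t] flowsD[OF fl(2), of a t] t a by simp
qed

definition extend_along :: "'a magma2 \<Rightarrow> diagram \<Rightarrow> (real \<Rightarrow> 'a) \<Rightarrow> real \<Rightarrow> real \<Rightarrow> real \<Rightarrow> 'a" where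
  "extend_along Q D c a b t = (if t \<in> {a..b} then act Q (passes D c {a..<t}) (c a) else c t)"

lemma extend_along_start: "extend_along Q D c a b a = c a"
  by (simp add: extend_along_def)

lemma extend_along_off: "t \<notin> {a..b} \<Longrightarrow> extend_along Q D c a b t = c t"
  by (auto simp: extend_along_def)

text \<open>
  The over-arcs met along the segment lie on other strands, so extending the coloring does not
  change the word that defines the extension.
\<close>

lemma flows_extend_along:
  assumes "regular_diagram D"
    and "\<And>u. u \<in> unders D \<Longrightarrow> u \<in> {a..b} \<Longrightarrow> over D u \<notin> {a..b}"
  shows "flows Q D (extend_along Q D c a b) {a..b}"
proof (rule flows_from_base[OF assms(1)])
  fix t assume t: "t \<in> {a..b}"
  have "passes D (extend_along Q D c a b) {a..<t} = passes D c {a..<t}"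
  proof (rule passes_eq)
    fix u assume "u \<in> unders D" "u \<in> {a..<t}"
    then have "over D u \<notin> {a..b}" using assms(2) t by auto
    then show "along_normal D u = along_normal D u \<and>
        extend_along Q D c a b (over D u) = c (over D u)"
      by (simp only: extend_along_off simp_thms)
  qed simp
  then show "extend_along Q D c a b t = act Q (passes D (extend_along Q D c a b) {a..<t}) (c a)"
    using t by (simp add: extend_along_def)
qed simp

text \<open>
  Every over-arc lies on a strand above the one that passes under it; so no strand passes under
  itself, and the colors of the upper strands determine those of the lower ones.
\<close>

definition layered :: "diagram \<Rightarrow> real set \<Rightarrow> real set \<Rightarrow> real set \<Rightarrow> bool" where
  "layered D X Y Z \<longleftrightarrow> regular_diagram D \<and> X \<union> Y \<union> Z \<subseteq> params D \<and>
     X \<inter> Y = {} \<and> X \<inter> Z = {} \<and> Y \<inter> Z = {} \<and> unders D \<inter> X = {} \<and>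
     (\<forall>t\<in>unders D \<inter> Y. over D t \<in> X) \<and> (\<forall>t\<in>unders D \<inter> Z. over D t \<in> X \<union> Y)"

context quandle
begin

lemma extend_along_closed:
  assumes "regular_diagram D" "c \<in> params D \<rightarrow> carrier Q" "{a..b} \<subseteq> params D"
  shows "extend_along Q D c a b \<in> params D \<rightarrow> carrier Q"
proof
  fix t assume t: "t \<in> params D"
  show "extend_along Q D c a b t \<in> carrier Q"
  proof (cases "t \<in> {a..b}")
    case True
    then have "a \<in> params D" using assms(3) by (auto simp: subset_iff Pi_iff)
    then have "c a \<in> carrier Q" using assms(2) by auto
    then show ?thesis
      using True act_closed[OF _ passes_colors[OF assms(1,2)]] by (simp add: extend_along_def)
  qed (use t assms(2) in \<open>auto simp: extend_along_off\<close>)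
qed

text \<open>The strands are colored one after the other, from the top layer to the bottom layer.\<close>

lemma layered_fillable:
  assumes l: "layered D X Y Z" and X: "X = {ax..bx}" and Y: "Y = {ay..by}" and Z: "Z = {az..bz}"
  shows "fillable Q D {X, Y, Z}"
  unfolding fillable_def
proof (intro conjI ballI impI)
  have reg: "regular_diagram D" using l by (simp add: layered_def)
  have P: "{ax..bx} \<subseteq> params D" "{ay..by} \<subseteq> params D" "{az..bz} \<subseteq> params D"
    using l by (auto simp: layered_def X Y Z)
  have dj: "X \<inter> Y = {}" "X \<inter> Z = {}" "Y \<inter> Z = {}" using l by (simp_all add: layered_def)
  have oX: "t \<notin> X" if "t \<in> unders D" for t using that l by (auto simp: layered_def)
  have oY: "over D t \<in> X" if "t \<in> unders D" "t \<in> Y" for t using that l by (auto simp: layered_def)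
  have oZ: "over D t \<in> X \<union> Y" if "t \<in> unders D" "t \<in> Z" for t
    using that l by (auto simp: layered_def)
  {
    fix c assume c: "c \<in> params D \<rightarrow> carrier Q"
    define c1 where "c1 = extend_along Q D c ax bx"
    define c2 where "c2 = extend_along Q D c1 ay by"
    define c3 where "c3 = extend_along Q D c2 az bz"
    have e1: "c1 t = c t" if "t \<notin> X" for t using that by (simp add: c1_def X extend_along_off)
    have e2: "c2 t = c1 t" if "t \<notin> Y" for t using that by (simp add: c2_def Y extend_along_off)
    have e3: "c3 t = c2 t" if "t \<notin> Z" for t using that by (simp add: c3_def Z extend_along_off)
    have c1: "c1 \<in> params D \<rightarrow> carrier Q"
      unfolding c1_def by (rule extend_along_closed[OF reg c P(1)])
    have c2: "c2 \<in> params D \<rightarrow> carrier Q"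
      unfolding c2_def by (rule extend_along_closed[OF reg c1 P(2)])
    have c3: "c3 \<in> params D \<rightarrow> carrier Q"
      unfolding c3_def by (rule extend_along_closed[OF reg c2 P(3)])
    have "flows Q D c1 X"
      unfolding c1_def X by (rule flows_extend_along[OF reg]) (use oX X in blast)
    then have f1: "flows Q D c3 X"
      by (rule flows_cong) (use oX in \<open>metis e2 e3 dj disjoint_iff\<close>)+
    have "flows Q D c2 Y"
      unfolding c2_def Y by (rule flows_extend_along[OF reg]) (use oY Y dj in blast)
    then have f2: "flows Q D c3 Y"
      by (rule flows_cong) (metis e3 dj oY disjoint_iff)+
    have f3: "flows Q D c3 Z"
      unfolding c3_def Z by (rule flows_extend_along[OF reg]) (use oZ Z dj in blast)
    have off: "agree_off {X, Y, Z} D c c3"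
      using e1 e2 e3 by (auto simp: agree_off_def)
    have start: "c3 a = c a" if ab: "a \<le> b" "{a..b} \<in> {X, Y, Z}" for a b
    proof -
      have a: "a \<in> {a..b}" using ab by simp
      from ab(2) consider "{a..b} = X" | "{a..b} = Y" | "{a..b} = Z" by blast
      then show ?thesis
      proof cases
        case 1
        then have "a = ax" using ab X by (simp add: Icc_eq_Icc)
        moreover have "a \<notin> Y" "a \<notin> Z" using a 1 dj by auto
        ultimately show ?thesis using e2 e3 by (simp add: c1_def extend_along_start)
      next
        case 2
        then have "a = ay" using ab Y by (simp add: Icc_eq_Icc)
        moreover have "a \<notin> X" "a \<notin> Z" using a 2 dj by auto
        ultimately show ?thesis using e1 e3 by (simp add: c2_def extend_along_start)
      next
        case 3
        then have "a = az" using ab Z by (simp add: Icc_eq_Icc)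
        moreover have "a \<notin> X" "a \<notin> Y" using a 3 dj by auto
        ultimately show ?thesis using e1 e2 by (simp add: c3_def extend_along_start)
      qed
    qed
    show "\<exists>c'\<in>params D \<rightarrow> carrier Q. agree_off {X, Y, Z} D c c' \<and>
        agree_at_entries {X, Y, Z} c c' \<and> (\<forall>J\<in>{X, Y, Z}. flows Q D c' J)"
      using c3 off start f1 f2 f3 by (auto simp: agree_at_entries_def)
  next
    fix c c' t
    assume ent: "agree_at_entries {X, Y, Z} c c'"
      and fl: "\<forall>J\<in>{X, Y, Z}. flows Q D c J \<and> flows Q D c' J" and t: "t \<in> \<Union>{X, Y, Z}"
    have uX: "c' t = c t" if "t \<in> X" for t
    proof -
      have "ax \<le> bx" using that X by simp
      then have "c' ax = c ax" using ent X by (simp add: agree_at_entries_def)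
      then show ?thesis
        using flows_unique[of Q D c ax bx c' t] fl that oX X by blast
    qed
    have uY: "c' t = c t" if "t \<in> Y" for t
    proof -
      have "ay \<le> by" using that Y by simp
      then have "c' ay = c ay" using ent Y by (simp add: agree_at_entries_def)
      then show ?thesis
        using flows_unique[of Q D c ay "by" c' t] fl that oY uX Y by blast
    qed
    have uZ: "c' t = c t" if "t \<in> Z" for t
    proof -
      have "az \<le> bz" using that Z by simp
      then have "c' az = c az" using ent Z by (simp add: agree_at_entries_def)
      then show ?thesis
        using flows_unique[of Q D c az bz c' t] fl that oZ uX uY Z by blast
    qed
    show "c' t = c t" using t uX uY uZ by blast
  }
qed

text \<open>
  A kink with incoming color \<open>x\<close> and outgoing color \<open>y\<close> is passed over by its own incoming or
  outgoing arc. So \<open>y\<close> is the image of \<open>x\<close> under \<open>x\<close> or under \<open>y\<close>, and \<open>y = x\<close> by idempotence.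
\<close>

lemma loop_const:
  assumes D: "regular_diagram D" and c: "c \<in> params D \<rightarrow> carrier Q" and fl: "flows Q D c {a..b}"
    and P: "{a..b} \<subseteq> params D" and U: "unders D \<inter> {a..b} \<subseteq> {t}"
    and o: "t \<in> unders D \<inter> {a..b} \<Longrightarrow> over D t \<in> {a..b}" and r: "r \<in> {a..b}"
  shows "c r = c a"
proof -
  have before: "c r = c a" if "r \<in> {a..b}" "t \<notin> unders D \<inter> {a..<r}" for r
  proof -
    have "unders D \<inter> {a..<r} \<subseteq> unders D \<inter> {a..b}" using that(1) by auto
    then have "unders D \<inter> {a..<r} = {}" using U that(2) by blast
    then show ?thesis using flows_const[OF fl, of a r] that(1) by auto
  qed
  show ?thesis
  proof (cases "t \<in> unders D \<inter> {a..<r}")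
    case True
    let ?s = "over D t" and ?e = "along_normal D t"
    have t: "t \<in> unders D" "t \<in> {a..b}" using True r by auto
    have s: "?s \<in> {a..b}" using o t by simp
    have C: "c a \<in> carrier Q" "c ?s \<in> carrier Q" using c P s t by (auto simp: subset_iff Pi_iff)
    have after: "c r = qop Q ?e (c a) (c ?s)" if r: "r \<in> {a..b}" "t < r" for r
    proof -
      have "unders D \<inter> {a..<r} = {t}" using U t r by auto
      then have "passes D c {a..<r} = passing D c t" by (simp add: passes_def)
      then show ?thesis using flowsD[OF fl, of a r] r t by simp
    qed
    have "c ?s = c a"
    proof (cases "?s < t")
      case True
      then show ?thesis using before[OF s] by simp
    next
      case False
      then have "t < ?s" using over_props(4)[OF D t(1)] by simp
      then have "qop Q ?e (c a) (c ?s) = c ?s" using after s by metis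
      then have "c a = qop Q (\<not> ?e) (c ?s) (c ?s)"
        using qop_cancel_iff[of "c a" "c ?s" "c ?s" ?e] C by blast
      then show ?thesis using C by simp
    qed
    moreover have "t < r" using True by simp
    ultimately have "c r = qop Q ?e (c a) (c a)" using after[OF r] by (simp only:)
    then show ?thesis using qop_idem[OF C(1)] by (simp only:)
  next
    case False
    show ?thesis by (rule before[OF r False])
  qed
qed

lemma loop_fillable:
  assumes D: "regular_diagram D" and P: "{a..b} \<subseteq> params D" and U: "unders D \<inter> {a..b} \<subseteq> {t}"
    and o: "t \<in> unders D \<inter> {a..b} \<Longrightarrow> over D t \<in> {a..b}"
  shows "fillable Q D {{a..b}}"
  unfolding fillable_def
proof (intro conjI ballI impI)
  fix c assume c: "c \<in> params D \<rightarrow> carrier Q"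
  define c' where "c' t = (if t \<in> {a..b} then c a else c t)" for t
  have c': "c' \<in> params D \<rightarrow> carrier Q" using c P by (auto simp: c'_def subset_iff Pi_iff)
  have "flows Q D c' {a..b}"
    unfolding flows_def
  proof (intro allI impI)
    fix s r assume sr: "s \<le> r" "{s..r} \<subseteq> {a..b}"
    then have m: "s \<in> {a..b}" "r \<in> {a..b}" by auto
    then have C: "c a \<in> carrier Q" using c P by (auto simp: subset_iff Pi_iff)
    have "act Q (passes D c' {s..<r}) (c a) = c a"
      unfolding passes_def
    proof (rule act_word_id[OF C])
      fix u assume u: "u \<in> unders D \<inter> {s..<r}"
      then have "u = t" "u \<in> unders D \<inter> {a..b}" using U m by auto
      then show "act Q (passing D c' u) (c a) = c a" using o C by (simp add: c'_def)
    qed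
    then show "c' r = act Q (passes D c' {s..<r}) (c' s)" using m by (simp add: c'_def)
  qed
  moreover have "agree_off {{a..b}} D c c'" by (auto simp: agree_off_def c'_def)
  moreover have "agree_at_entries {{a..b}} c c'"
    by (auto simp: agree_at_entries_def c'_def Icc_eq_Icc)
  ultimately show "\<exists>c'\<in>params D \<rightarrow> carrier Q. agree_off {{a..b}} D c c' \<and>
      agree_at_entries {{a..b}} c c' \<and> (\<forall>J\<in>{{a..b}}. flows Q D c' J)"
    using c' by auto
next
  fix c c' r
  assume c: "c \<in> params D \<rightarrow> carrier Q" "c' \<in> params D \<rightarrow> carrier Q"
    and ent: "agree_at_entries {{a..b}} c c'"
    and fl: "\<forall>J\<in>{{a..b}}. flows Q D c J \<and> flows Q D c' J" and "r \<in> \<Union>{{a..b}}"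
  then have r: "r \<in> {a..b}" by simp
  then have "c' a = c a" using ent by (auto simp: agree_at_entries_def)
  then show "c' r = c r"
    using loop_const[OF D c(1) _ P U o r] loop_const[OF D c(2) _ P U o r] fl by simp
qed

section \<open>The effect of the Reidemeister moves\<close>

lemma reidemeister1_effect:
  assumes D: "regular_diagram D" "unders D \<inter> {a..b} = {}"
    and D': "regular_diagram D'" "params D' = params D" "unders D' \<inter> {a..b} = {t}" "over D' t \<in> {a..b}"
    and P: "{a..b} \<subseteq> params D"
  shows "same_effect Q D D' {{a..b}}"
  unfolding same_effect_def
proof (intro ballI allI impI)
  fix c c' l h
  assume c: "c \<in> params D \<rightarrow> carrier Q" "c' \<in> params D \<rightarrow> carrier Q" "agree_at_entries {{a..b}} c c'"
    "\<forall>J\<in>{{a..b}}. flows Q D c J \<and> flows Q D' c' J" "l \<le> (h::real)" "{l..h} \<in> {{a..b}}"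
  then have lh: "l = a" "h = b" by (auto simp: Icc_eq_Icc)
  have ab: "a \<le> b" using c(5) lh by simp
  have ca: "c' a = c a" using c(3) ab by (simp add: agree_at_entries_def)
  have const: "c' r = c a" if "r \<in> {a..b}" for r
  proof -
    have "c' r = c' a"
      by (rule loop_const[OF D'(1) _ _ _ _ _ that, where t = t]) (use c P D' in auto)
    then show ?thesis using ca by simp
  qed
  have t: "t \<in> {a..b}" using D'(3) by auto
  have C: "c a \<in> carrier Q" using c(1) P ab by (auto simp: subset_iff Pi_iff)
  show "act Q (passes D' c' {l..h}) (c' l) = act Q (passes D c {l..h}) (c l) \<and>
      (\<forall>u\<in>carrier Q. act Q (param_longitude D' c' {l..h}) u = act Q (param_longitude D c {l..h}) u)"
    using const[OF t] const[OF D'(4)] C D(2) D'(3) ca unfolding lh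
    by (simp add: passes_def param_longitude_def)
qed

text \<open>
  The contribution of a strand to the longitude splits into the corrections by its initial color
  and the word of over-arcs, so these can be compared separately.
\<close>

lemma same_effect_strand:
  assumes D: "regular_diagram D" "c \<in> params D \<rightarrow> carrier Q" "flows Q D c {a..b}" "{a..b} \<subseteq> params D"
    and D': "regular_diagram D'" "c' \<in> params D' \<rightarrow> carrier Q" "flows Q D' c' {a..b}"
      "{a..b} \<subseteq> params D'"
    and ca: "c' a = c a" and ab: "a \<le> b"
    and W: "\<And>u. u \<in> carrier Q \<Longrightarrow> act Q (passes D' c' {a..b}) u = act Q (passes D c {a..b}) u"
    and N: "\<And>u. u \<in> carrier Q \<Longrightarrow>
      act Q (corrections D' (c a) {a..b}) u =
      act Q (corrections D (c a) {a..b}) u"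
  shows "act Q (passes D' c' {a..b}) (c' a) = act Q (passes D c {a..b}) (c a) \<and>
      (\<forall>u\<in>carrier Q. act Q (param_longitude D' c' {a..b}) u = act Q (param_longitude D c {a..b}) u)"
proof (intro conjI ballI)
  have a: "a \<in> params D" "a \<in> params D'" using ab D(4) D'(4) by (auto simp: subset_iff Pi_iff)
  then have C: "c a \<in> carrier Q" using D(2) by auto
  then show "act Q (passes D' c' {a..b}) (c' a) = act Q (passes D c {a..b}) (c a)"
    using W ca by simp
  fix u assume u: "u \<in> carrier Q"
  have "act Q (corrections D (c a) {a..b}) u \<in> carrier Q"
    unfolding corrections_def using u C by (intro act_closed word_colors) auto
  then show "act Q (param_longitude D' c' {a..b}) u = act Q (param_longitude D c {a..b}) u"
    using param_longitude_segment[OF D(1-4) a(1) _ u, of "{a..b}"]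
      param_longitude_segment[OF D'(1-4) a(2) _ u, of "{a..b}"] N[OF u] W ca by simp
qed

text \<open>
  The strand \<open>Z\<close> passes twice under \<open>X\<close>, which has one color, in opposite directions. The empty
  set takes the place of a middle layer.
\<close>

lemma reidemeister2_effect:
  assumes D: "layered D X {} Z" "unders D \<inter> Z = {}"
    and D': "layered D' X {} Z" "params D' = params D" "unders D' \<inter> Z = {t1, t2}" "t1 \<noteq> t2"
      "along_normal D' t1 \<noteq> along_normal D' t2"
    and X: "X = {ax..bx}" and Z: "Z = {az..bz}"
  shows "same_effect Q D D' {X, {}, Z}"
  unfolding same_effect_def
proof (intro ballI allI impI)
  fix c c' l h
  assume c: "c \<in> params D \<rightarrow> carrier Q" "c' \<in> params D \<rightarrow> carrier Q" "agree_at_entries {X, {}, Z} c c'"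
    "\<forall>J\<in>{X, {}, Z}. flows Q D c J \<and> flows Q D' c' J" and lh: "l \<le> (h::real)" "{l..h} \<in> {X, {}, Z}"
  have reg: "regular_diagram D" "regular_diagram D'" using D D' by (auto simp: layered_def)
  have XZ: "X \<subseteq> params D" "Z \<subseteq> params D" "unders D \<inter> X = {}" "unders D' \<inter> X = {}"
    using D D' by (auto simp: layered_def)
  have cl: "c' l = c l" using c(3) lh by (auto simp: agree_at_entries_def)
  have lP: "{l..h} \<subseteq> params D" using lh XZ by auto
  have C: "c l \<in> carrier Q" using c(1) lP lh(1) by (auto simp: subset_iff Pi_iff)
  have WN: "act Q (passes D' c' {l..h}) u = act Q (passes D c {l..h}) u \<and>
      act Q (corrections D' (c l) {l..h}) u = act Q (corrections D (c l) {l..h}) u"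
    if u: "u \<in> carrier Q" for u
  proof -
    from lh consider "{l..h} = X" | "{l..h} = Z" by fastforce
    then show ?thesis
    proof cases
      case 1
      then show ?thesis
        using XZ by (simp add: passes_def corrections_def)
    next
      case 2
      obtain t s where ts: "t < s" "{t1, t2} = {t, s}"
        using D'(4) by (metis insert_commute linorder_neqE)
      have e: "along_normal D' s \<longleftrightarrow> \<not> along_normal D' t" using D'(5) ts(2) by (auto simp: doubleton_eq_iff)
      have ov: "over D' t \<in> X" "over D' s \<in> X" using D'(1,3) ts(2) by (auto simp: layered_def)
      have const: "c' r = c' ax" if "r \<in> X" for r
      proof -
        have "{ax..r} \<subseteq> X" "{ax..<r} \<subseteq> X" using that X by auto
        then show ?thesis using flows_const[of Q D' c' X ax r] c(4) that XZ(4) X by auto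
      qed
      have CX: "c' ax \<in> carrier Q" using c(2) XZ(1) ov X by (auto simp: subset_iff Pi_iff)
      show ?thesis
        using 2 D(2) D'(3) ts u C CX e const[OF ov(1)] const[OF ov(2)]
        by (auto simp: passes_def corrections_def word_pair)
    qed
  qed
  show "act Q (passes D' c' {l..h}) (c' l) = act Q (passes D c {l..h}) (c l) \<and>
      (\<forall>u\<in>carrier Q. act Q (param_longitude D' c' {l..h}) u = act Q (param_longitude D c {l..h}) u)"
    by (rule same_effect_strand[OF reg(1) c(1) _ lP reg(2) _ _ _ cl lh(1) WN[THEN conjunct1] WN[THEN conjunct2]])
      (use c lh lP D'(2) in auto)
qed

text \<open>
  Three strands crossing pairwise: \<open>e1\<close>, \<open>e2\<close>, \<open>e3\<close> are the signs of the crossings of \<open>X\<close> over \<open>Y\<close>,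
  \<open>X\<close> over \<open>Z\<close> and \<open>Y\<close> over \<open>Z\<close>. The flag \<open>r\<close> tells whether \<open>Y\<close> meets \<open>X\<close> before \<open>Z\<close>, and \<open>p\<close>
  whether \<open>Z\<close> meets \<open>X\<close> before \<open>Y\<close>.
\<close>

definition triangle ::
  "diagram \<Rightarrow> real set \<Rightarrow> real set \<Rightarrow> real set \<Rightarrow> bool \<Rightarrow> bool \<Rightarrow> bool \<Rightarrow> bool \<Rightarrow> bool \<Rightarrow> bool" where
  "triangle D X Y Z e1 e2 e3 r p \<longleftrightarrow> layered D X Y Z \<and> (\<exists>y1 z1 z2.
     unders D \<inter> Y = {y1} \<and> along_normal D y1 = e1 \<and>
     unders D \<inter> Z = {z1, z2} \<and> z1 \<noteq> z2 \<and>
     over D z1 \<in> X \<and> along_normal D z1 = e2 \<and> over D z2 \<in> Y \<and> along_normal D z2 = e3 \<and>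
     (y1 < over D z2 \<longleftrightarrow> r) \<and> (z1 < z2 \<longleftrightarrow> p))"

lemma qop_commute:
  assumes "u \<in> carrier Q" "z \<in> carrier Q"
  shows "qop Q d (qop Q e u z) z = qop Q e (qop Q d u z) z"
  using qop_distrib[of u z z d e] assms by simp

lemma triangle_action:
  assumes tr: "triangle D X Y Z e1 e2 e3 r p"
    and X: "X = {ax..bx}" and Y: "Y = {ay..by}" and Z: "Z = {az..bz}"
    and c: "c \<in> params D \<rightarrow> carrier Q" and fl: "flows Q D c X" "flows Q D c Y"
  shows "act Q (passes D c Y) u = qop Q e1 u (c ax)" (is ?Y)
    and "act Q (passes D c Z) u =
      (let m = if r then qop Q e1 (c ay) (c ax) else c ay in
       if p then qop Q e3 (qop Q e2 u (c ax)) m else qop Q e2 (qop Q e3 u m) (c ax))" (is ?Z)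
    and "corrections D z Y = [(\<not> e1, z)]" (is ?NY)
    and "z \<in> carrier Q \<Longrightarrow> u \<in> carrier Q \<Longrightarrow>
      act Q (corrections D z Z) u =
      qop Q (\<not> e2) (qop Q (\<not> e3) u z) z"
    and "ax \<in> params D" "ay \<in> params D" "ax \<le> bx" "ay \<le> by"
proof -
  have l: "layered D X Y Z" using tr by (simp add: triangle_def)
  obtain y1 z1 z2 where t: "unders D \<inter> Y = {y1}" "along_normal D y1 = e1"
    "unders D \<inter> Z = {z1, z2}" "z1 \<noteq> z2"
    "over D z1 \<in> X" "along_normal D z1 = e2" "over D z2 \<in> Y" "along_normal D z2 = e3"
    "y1 < over D z2 \<longleftrightarrow> r" "z1 < z2 \<longleftrightarrow> p"
    using tr unfolding triangle_def by auto
  have uX: "unders D \<inter> X = {}" and oy: "over D y1 \<in> X"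
    using l t(1) by (auto simp: layered_def)
  have const: "c v = c ax" if "v \<in> X" for v
  proof -
    have "{ax..v} \<subseteq> X" "{ax..<v} \<subseteq> X" using that X by auto
    then show ?thesis using flows_const[OF fl(1), of ax v] that uX X by auto
  qed
  note cx = const[OF oy] const[OF t(5)]
  show ?Y ?NY using t(1,2) cx by (simp_all add: passes_def corrections_def)
  let ?m = "if r then qop Q e1 (c ay) (c ax) else c ay"
  have cm: "c (over D z2) = ?m"
  proof -
    have m: "over D z2 \<in> {ay..by}" "{ay..over D z2} \<subseteq> Y" using t(7) Y by auto
    have "over D z2 \<noteq> y1"
      using t(1,3) over_props(2)[of D z2] l by (auto simp: layered_def)
    have ivl: "{ay..<over D z2} \<subseteq> Y" using m(2) by auto
    have "unders D \<inter> {ay..<over D z2} = {y1} \<inter> {ay..<over D z2}" using t(1) ivl by blast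
    also have "\<dots> = (if r then {y1} else {})" using t(1,9) Y by auto
    finally have "passes D c {ay..<over D z2} = (if r then passing D c y1 else [])"
      by (simp add: passes_def)
    then show ?thesis using flowsD[OF fl(2), of ay "over D z2"] m cx t(2) by simp
  qed
  show ?Z
    using t(3,4,6,8,10) cx cm word_pair[of z1 z2 "passing D c"] word_pair[of z2 z1 "passing D c"]
    by (cases p) (simp_all add: passes_def Let_def insert_commute)
  show "act Q (corrections D z Z) u =
      qop Q (\<not> e2) (qop Q (\<not> e3) u z) z" if "z \<in> carrier Q" "u \<in> carrier Q"
    using t(3,4,6,8,10) qop_commute[OF that(2,1), of "\<not> e3" "\<not> e2"]
      word_pair[of z1 z2 "\<lambda>t. [(\<not> along_normal D t, z)]"]
      word_pair[of z2 z1 "\<lambda>t. [(\<not> along_normal D t, z)]"]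
    by (cases p) (simp_all add: corrections_def insert_commute)
  show "ax \<in> params D" "ay \<in> params D" "ax \<le> bx" "ay \<le> by" using l t(5,7) X Y by (auto simp: layered_def subset_iff)
qed

text \<open>
  The strand \<open>Z\<close> passes under \<open>X\<close>, of color \<open>x\<close>, and under an arc of \<open>Y\<close>, in one order in \<open>D\<close> and in
  the other one in \<open>D'\<close>. These arcs of \<open>Y\<close> lie on different sides of \<open>X\<close>: one has the initial color
  \<open>y\<close>, the other one the image of \<open>y\<close> under \<open>x\<close>. By self-distributivity the exchange is harmless if
  moving an element past \<open>x\<close> along \<open>Z\<close> has the effect that \<open>x\<close> has on \<open>Y\<close> or the inverse effect,
  according to the orders. This is what the relation between orders and signs says.
\<close>

lemma triangle_effect:
  assumes tr: "triangle D X Y Z e1 e2 e3 r p" and tr': "triangle D' X Y Z e1 e2 e3 (\<not> r) (\<not> p)"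
    and P: "params D' = params D" and sgn: "p = r \<longleftrightarrow> e1 = e2"
    and X: "X = {ax..bx}" and Y: "Y = {ay..by}" and Z: "Z = {az..bz}"
  shows "same_effect Q D D' {X, Y, Z}"
  unfolding same_effect_def
proof (intro ballI allI impI)
  fix c c' l h
  assume c: "c \<in> params D \<rightarrow> carrier Q" "c' \<in> params D \<rightarrow> carrier Q" "agree_at_entries {X, Y, Z} c c'"
    "\<forall>J\<in>{X, Y, Z}. flows Q D c J \<and> flows Q D' c' J" and lh: "l \<le> (h::real)" "{l..h} \<in> {X, Y, Z}"
  have l: "layered D X Y Z" "layered D' X Y Z" using tr tr' by (auto simp: triangle_def)
  then have reg: "regular_diagram D" "regular_diagram D'" by (auto simp: layered_def)
  have sub: "X \<subseteq> params D" "Y \<subseteq> params D" "Z \<subseteq> params D"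
    and uX: "unders D \<inter> X = {}" "unders D' \<inter> X = {}"
    using l by (auto simp: layered_def)
  have fl: "flows Q D c X" "flows Q D c Y" "flows Q D' c' X" "flows Q D' c' Y" using c(4) by auto
  note A = triangle_action[OF tr X Y Z c(1) fl(1,2)]
  note A' = triangle_action[OF tr' X Y Z _ fl(3,4), unfolded P, OF c(2)]
  have cc: "c' ax = c ax" "c' ay = c ay" "c' l = c l"
    using c(3) lh A(7,8) X Y by (auto simp: agree_at_entries_def)
  have lP: "{l..h} \<subseteq> params D" using lh(2) sub by auto
  have C: "c l \<in> carrier Q" "c ax \<in> carrier Q" "c ay \<in> carrier Q"
    using c(1) lP lh(1) A(5,6) by (auto simp: subset_iff Pi_iff)
  have move: "act Q (passes D' c' Z) u = act Q (passes D c Z) u" if u: "u \<in> carrier Q" for u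
  proof -
    let ?x = "c ax" and ?y = "c ay"
    have "qop Q e2 (qop Q e3 u ?y) ?x = qop Q e3 (qop Q e2 u ?x) (qop Q e2 ?y ?x)"
      using qop_distrib[of u ?y ?x e2 e3] u C by simp
    moreover have "qop Q e2 (qop Q e3 u (qop Q (\<not> e2) ?y ?x)) ?x = qop Q e3 (qop Q e2 u ?x) ?y"
      using qop_distrib[of u "qop Q (\<not> e2) ?y ?x" ?x e2 e3] u C by simp
    moreover have "e1 = (\<not> e2)" if "p \<noteq> r" using that sgn by auto
    ultimately show ?thesis
      unfolding A(2) A'(2) cc using sgn by (cases p; cases r) (auto simp: Let_def)
  qed
  have WN: "act Q (passes D' c' {l..h}) u = act Q (passes D c {l..h}) u \<and>
      act Q (corrections D' (c l) {l..h}) u = act Q (corrections D (c l) {l..h}) u"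
    if u: "u \<in> carrier Q" for u
  proof -
    from lh(2) consider "{l..h} = X" | "{l..h} = Y" | "{l..h} = Z" by blast
    then show ?thesis
    proof cases
      case 1
      then show ?thesis
        using uX by (simp add: passes_def corrections_def)
    next
      case 2
      then show ?thesis
        using A(1,3) A'(1,3) cc by simp
    next
      case 3
      then show ?thesis
        using A(4) A'(4) move[OF u] u C(1) by simp
    qed
  qed
  show "act Q (passes D' c' {l..h}) (c' l) = act Q (passes D c {l..h}) (c l) \<and>
      (\<forall>u\<in>carrier Q. act Q (param_longitude D' c' {l..h}) u = act Q (param_longitude D c {l..h}) u)"
    by (rule same_effect_strand[OF reg(1) c(1) _ lP reg(2) _ _ _ cc(3) lh(1) WN[THEN conjunct1] WN[THEN conjunct2]])
      (use c lh lP P in auto)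
qed

end

section \<open>Colors of arcs and colors of parameters\<close>

lemma arc_props:
  assumes "A \<in> arcs D"
  shows "connected A" "A \<subseteq> params D - unders D" "\<exists>t. t \<in> A"
  using assms in_components_connected in_components_subset in_components_nonempty
  unfolding arcs_def by blast+

lemma arc_eqI: "A \<in> arcs D \<Longrightarrow> B \<in> arcs D \<Longrightarrow> t \<in> A \<Longrightarrow> t \<in> B \<Longrightarrow> A = B"
  unfolding arcs_def using components_nonoverlap[of A _ B] by blast

lemma arc_at_props:
  assumes "t \<in> params D - unders D"
  shows "arc_at D t \<in> arcs D" "t \<in> arc_at D t"
proof -
  let ?A = "connected_component_set (params D - unders D) t"
  have "?A \<in> arcs D \<and> t \<in> ?A"
    using assms by (simp add: arcs_def componentsI)
  then have "\<exists>!A. A \<in> arcs D \<and> t \<in> A" using arc_eqI by blast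
  from theI'[OF this] show "arc_at D t \<in> arcs D" "t \<in> arc_at D t"
    unfolding arc_at_def by auto
qed

lemma arc_at_eqI:
  assumes "A \<in> arcs D" "t \<in> A"
  shows "arc_at D t = A"
proof -
  have "t \<in> params D - unders D"
    using arc_props(2) assms by blast
  then show ?thesis using arc_at_props arc_eqI assms by metis
qed

lemma arc_at_connected:
  assumes "connected I" "I \<subseteq> params D - unders D" "s \<in> I"
  shows "I \<subseteq> arc_at D s"
proof -
  have "arc_at D s \<in> components (params D - unders D)" "s \<in> arc_at D s"
    using arc_at_props[of s D] assms by (auto simp: arcs_def)
  then show ?thesis
    using components_maximal[of "arc_at D s" _ I] assms by blast
qed

lemma arc_at_same:
  assumes "connected I" "I \<subseteq> params D - unders D" "s \<in> I" "t \<in> I"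
  shows "arc_at D s = arc_at D t"
proof -
  have "t \<in> arc_at D s" using arc_at_connected[OF assms(1-3)] assms(4) by blast
  moreover have "arc_at D s \<in> arcs D" using arc_at_props(1)[of s D] assms by blast
  ultimately show ?thesis using arc_at_eqI by metis
qed

lemma unders_isolated:
  assumes "proper_diagram D"
  obtains d where "d > 0" "{x-d..x+d} \<inter> unders D \<subseteq> {x}" "x \<in> unders D \<Longrightarrow> {x-d..x+d} \<subseteq> params D"
proof -
  let ?F = "(unders D - {x}) \<union> (if x \<in> unders D then - interior (params D) else {})"
  have "closed (unders D - {x})"
    by (rule finite_imp_closed) (use finite_unders[OF proper_regular[OF assms]] in simp)
  then have "closed ?F" by (rule closed_Un) auto
  moreover have "{x..x} \<inter> ?F = {}" using proper_interior(1)[OF assms, of x] by auto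
  ultimately obtain d where d: "d > 0" "{x-d..x+d} \<inter> ?F = {}"
    using collar[of ?F x x] by blast
  show ?thesis
  proof (rule that[OF d(1)])
    show "{x-d..x+d} \<inter> unders D \<subseteq> {x}" using d(2) by blast
    show "{x-d..x+d} \<subseteq> params D" if "x \<in> unders D"
      using d(2) that interior_subset[of "params D"] by auto
  qed
qed

lemma arcs_at_under:
  assumes "l < t" "t < r" "{l..r} \<subseteq> params D" "unders D \<inter> {l..r} \<subseteq> {t}"
  shows "arc_before D t = arc_at D l" "arc_after D t = arc_at D r"
proof -
  have sub: "{l..<t} \<subseteq> params D - unders D" "{t<..r} \<subseteq> params D - unders D"
    using assms by (force simp: subset_iff)+
  have A: "{l..<t} \<subseteq> arc_at D l" "{t<..r} \<subseteq> arc_at D r"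
    using arc_at_connected[OF _ sub(1), of l] arc_at_connected[OF _ sub(2), of r] assms(1,2) by simp_all
  have arcs: "arc_at D l \<in> arcs D" "arc_at D r \<in> arcs D"
    using arc_at_props(1)[OF subsetD[OF sub(1)]] arc_at_props(1)[OF subsetD[OF sub(2)]] assms(1,2)
    by simp_all
  show "arc_before D t = arc_at D l"
    unfolding arc_before_def
  proof (rule the_equality)
    have "{t - (t - l)<..<t} \<subseteq> arc_at D l" using A(1) by (auto simp: subset_iff)
    then show "arc_at D l \<in> arcs D \<and> (\<exists>e>0. {t - e<..<t} \<subseteq> arc_at D l)"
      using arcs(1) assms(1) by (intro conjI exI[of _ "t - l"]) auto
    fix B assume B: "B \<in> arcs D \<and> (\<exists>e>0. {t - e<..<t} \<subseteq> B)"
    then obtain e where e: "e > 0" "{t - e<..<t} \<subseteq> B" by auto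
    let ?m = "(max (t - e) l + t) / 2"
    have "?m \<in> {t - e<..<t}" "?m \<in> {l..<t}" using e(1) assms(1) by (auto simp: max_def)
    then show "B = arc_at D l" using e(2) A(1) B arcs(1) arc_eqI by blast
  qed
  show "arc_after D t = arc_at D r"
    unfolding arc_after_def
  proof (rule the_equality)
    have "{t<..<t + (r - t)} \<subseteq> arc_at D r" using A(2) by (auto simp: subset_iff)
    then show "arc_at D r \<in> arcs D \<and> (\<exists>e>0. {t<..<t + e} \<subseteq> arc_at D r)"
      using arcs(2) assms(2) by (intro conjI exI[of _ "r - t"]) auto
    fix B assume B: "B \<in> arcs D \<and> (\<exists>e>0. {t<..<t + e} \<subseteq> B)"
    then obtain e where e: "e > 0" "{t<..<t + e} \<subseteq> B" by auto
    let ?m = "(min (t + e) r + t) / 2"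
    have "?m \<in> {t<..<t + e}" "?m \<in> {t<..r}" using e(1) assms(2) by (auto simp: min_def)
    then show "B = arc_at D r" using e(2) A(2) B arcs(2) arc_eqI by blast
  qed
qed

lemma under_neighbourhood:
  assumes D: "proper_diagram D" and t: "t \<in> unders D"
  obtains l r where "l < t" "t < r" "{l..r} \<subseteq> params D" "unders D \<inter> {l..r} = {t}"
    "arc_before D t = arc_at D l" "arc_after D t = arc_at D r"
    "l \<in> params D - unders D" "r \<in> params D - unders D"
proof -
  obtain d where d: "d > 0" "{t-d..t+d} \<inter> unders D \<subseteq> {t}"
    "t \<in> unders D \<Longrightarrow> {t-d..t+d} \<subseteq> params D"
    using unders_isolated[OF D, of t] by blast
  note sub = d(3)[OF t]
  have m: "t - d \<in> {t-d..t+d}" "t + d \<in> {t-d..t+d}" "t \<in> {t-d..t+d}" "t - d \<noteq> t" "t + d \<noteq> t"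
    using d(1) by auto
  have U: "unders D \<inter> {t-d..t+d} = {t}" using d(2) t m(3) by blast
  show ?thesis
  proof (rule that[of "t - d" "t + d"])
    show "arc_before D t = arc_at D (t - d)" "arc_after D t = arc_at D (t + d)"
      using arcs_at_under[of "t - d" t "t + d" D] d(1) sub U by simp_all
    show "t - d \<in> params D - unders D" "t + d \<in> params D - unders D"
      using m sub U by blast+
  qed (use d(1) sub U in simp_all)
qed

definition color_at :: "diagram \<Rightarrow> (real set \<Rightarrow> 'a) \<Rightarrow> real \<Rightarrow> 'a" where
  "color_at D C = (\<lambda>t\<in>params D. if t \<in> unders D then C (arc_before D t) else C (arc_at D t))"

lemma color_at_under:
  "regular_diagram D \<Longrightarrow> t \<in> unders D \<Longrightarrow> color_at D C t = C (arc_before D t)"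
  using over_props(3) by (auto simp: color_at_def)

lemma color_at_arc: "t \<in> params D - unders D \<Longrightarrow> color_at D C t = C (arc_at D t)"
  by (simp add: color_at_def)

lemma color_at_over:
  "regular_diagram D \<Longrightarrow> t \<in> unders D \<Longrightarrow> color_at D C (over D t) = C (over_arc D t)"
  using over_props(1,2) by (auto simp: color_at_def over_arc_def)

lemma longitude_param:
  assumes "regular_diagram D"
  shows "longitude D C A = param_longitude D (color_at D C) A"
  unfolding longitude_def param_longitude_def word_def
proof (rule arg_cong[where f = concat], rule map_cong[OF refl])
  fix t assume "t \<in> set (sorted_list_of_set (unders D \<inter> A))"
  then have "t \<in> unders D" using finite_unders[OF assms] by simp
  then show "[(\<not> along_normal D t, C (arc_before D t)), (along_normal D t, C (over_arc D t))] =
      corrected_passing D (color_at D C) t"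
    using color_at_under[OF assms, of t C] color_at_over[OF assms, of t C] by simp
qed

lemma color_at_const:
  assumes "connected I" "I \<subseteq> params D - unders D" "s \<in> I" "t \<in> I"
  shows "color_at D C t = color_at D C s"
  using color_at_arc[of s D C] color_at_arc[of t D C] arc_at_same[OF assms] assms(2-4) by (metis subsetD)

lemma color_at_before:
  assumes D: "proper_diagram D" and st: "s \<le> t" "{s..t} \<subseteq> params D" "unders D \<inter> {s..<t} = {}"
  shows "color_at D C t = color_at D C s"
proof (cases "t \<in> unders D \<and> s < t")
  case True
  obtain l r where lr: "l < t" "t < r" "{l..r} \<subseteq> params D" "unders D \<inter> {l..r} = {t}"
    "arc_before D t = arc_at D l" "arc_after D t = arc_at D r"
    "l \<in> params D - unders D" "r \<in> params D - unders D"
    using under_neighbourhood[OF D conjunct1[OF True]] .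
  have "{min l s..<t} \<subseteq> ({l..r} - {t}) \<union> {s..<t}" "{s..<t} \<subseteq> {s..t}" using lr(1,2) by auto
  then have sub: "{min l s..<t} \<subseteq> params D - unders D" using lr(3,4) st(2,3) by blast
  have "color_at D C l = color_at D C s"
    by (rule color_at_const[OF _ sub]) (use lr(1) True in auto)
  then show ?thesis
    using color_at_under[OF proper_regular[OF D], of t C] True lr(5) color_at_arc[OF lr(7), of C] by simp
next
  case False
  show ?thesis
  proof (cases "s = t")
    case ne: False
    then have "t \<notin> unders D" using False st(1) by auto
    then have sub: "{s..t} \<subseteq> params D - unders D"
      using st by (force simp: subset_iff disjoint_iff)
    show ?thesis by (rule color_at_const[OF _ sub]) (use st(1) in auto)
  qed simp
qed

context quandle
begin

lemma color_at_mem: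
  assumes D: "proper_diagram D" and C: "C \<in> arcs D \<rightarrow> carrier Q"
  shows "color_at D C \<in> params D \<rightarrow>\<^sub>E carrier Q"
proof
  fix t assume t: "t \<in> params D"
  show "color_at D C t \<in> carrier Q"
  proof (cases "t \<in> unders D")
    case True
    obtain l r where "l < t" "t < r" "{l..r} \<subseteq> params D" "unders D \<inter> {l..r} = {t}"
      "arc_before D t = arc_at D l" "arc_after D t = arc_at D r"
      "l \<in> params D - unders D" "r \<in> params D - unders D"
      using under_neighbourhood[OF D True] .
    then show ?thesis
      using C arc_at_props(1)[of l D] True t by (auto simp: color_at_def Pi_iff)
  next
    case False
    then show ?thesis using C arc_at_props(1)[of t D] t by (auto simp: color_at_def Pi_iff)
  qed
qed (auto simp: color_at_def)

text \<open>
  A small interval contains at most one under-crossing, and there the word of over-arcs has one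
  letter: the flow condition becomes the condition on colorings.
\<close>

lemma color_at_coloring:
  assumes D: "proper_diagram D" and C: "C \<in> colorings D Q"
  shows "color_at D C \<in> param_colorings D Q"
proof -
  let ?c = "color_at D C"
  note reg = proper_regular[OF D]
  have CA: "C \<in> arcs D \<rightarrow> carrier Q" using C by (auto simp: colorings_def)
  note mem = color_at_mem[OF D CA]
  have "flows Q D ?c (params D)"
  proof (rule flows_local[OF reg])
    fix x assume x: "x \<in> params D"
    obtain d where d: "d > 0" "{x-d..x+d} \<inter> unders D \<subseteq> {x}"
      "x \<in> unders D \<Longrightarrow> {x-d..x+d} \<subseteq> params D"
      using unders_isolated[OF D, of x] by blast
    have "?c t = act Q (passes D ?c {s..<t}) (?c s)"
      if st: "s \<le> x" "x \<le> t" "t - s < d" "{s..t} \<subseteq> params D" for s t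
    proof (cases "unders D \<inter> {s..<t} = {}")
      case True
      then show ?thesis
        using color_at_before[OF D _ st(4) True, of C] st passes_empty[OF True, of ?c] by simp
    next
      case False
      have ivl: "{s..t} \<subseteq> {x-d..x+d}" using st by auto
      then have U: "unders D \<inter> {s..t} \<subseteq> {x}" using d(2) by blast
      moreover have "{s..<t} \<subseteq> {s..t}" by auto
      ultimately have ux: "unders D \<inter> {s..<t} = {x}" using False by blast
      then have xU: "x \<in> unders D" and xt: "x < t" by auto
      have "t \<notin> unders D" using U xt st by fastforce
      then have tP: "t \<in> params D - unders D" using st by (auto simp: subset_iff)
      have "unders D \<inter> {x-d..t} \<subseteq> {x}" "{x-d..t} \<subseteq> params D"
        using d(2) d(3)[OF xU] ivl st xt by (auto simp: subset_iff)
      then have "arc_after D x = arc_at D t"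
        using arcs_at_under(2)[of "x-d" x t D] d(1) xt by simp
      then have af: "C (arc_after D x) = ?c t" using color_at_arc[OF tP, of C] by simp
      have "unders D \<inter> {s..<x} = {}"
      proof -
        have "{s..<x} \<subseteq> {s..<t} - {x}" using xt by auto
        then show ?thesis using ux by blast
      qed
      moreover have "{s..x} \<subseteq> params D" using st xt by (auto simp: subset_iff)
      ultimately have be: "C (arc_before D x) = ?c s"
        using color_at_before[OF D st(1), of C] color_at_under[OF reg xU, of C] by simp
      have ov: "C (over_arc D x) = ?c (over D x)" using color_at_over[OF reg xU, of C] by simp
      have sP: "s \<in> params D" using st by (auto simp: subset_iff)
      have m: "?c t \<in> carrier Q" "?c s \<in> carrier Q" "?c (over D x) \<in> carrier Q"
        using mem tP sP over_props(1)[OF reg xU] by (auto simp: PiE_iff)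
      have "if along_normal D x
            then C (arc_after D x) = star Q (C (arc_before D x)) (C (over_arc D x))
            else C (arc_before D x) = star Q (C (arc_after D x)) (C (over_arc D x))"
        using C xU unfolding colorings_def by blast
      then have "?c t = qop Q (along_normal D x) (?c s) (?c (over D x))"
        unfolding af be ov using m by (auto simp: qop_def star_costar split: if_splits)
      then show ?thesis using ux by (simp add: passes_def)
    qed
    then show "\<exists>d>0. \<forall>s t. s \<le> x \<and> x \<le> t \<and> t - s < d \<and> {s..t} \<subseteq> params D \<longrightarrow>
        ?c t = act Q (passes D ?c {s..<t}) (?c s)"
      using d(1) by blast
  qed
  then show ?thesis using mem by (simp add: param_colorings_def)
qed

lemma color_at_surj:
  assumes D: "proper_diagram D" and c: "c \<in> param_colorings D Q"
  shows "\<exists>C \<in> colorings D Q. color_at D C = c"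
proof -
  note reg = proper_regular[OF D]
  note fl = param_coloringsD(2)[OF c] and mem = param_coloringsD(1)[OF c]
  define C where "C = (\<lambda>A\<in>arcs D. c (SOME t. t \<in> A))"
  have const: "c s = c t" if "A \<in> arcs D" "s \<in> A" "t \<in> A" "s \<le> t" for A s t
  proof -
    have "{s..t} \<subseteq> A"
      using that arc_props(1)[OF that(1)] connected_contains_Icc by blast
    then have "{s..t} \<subseteq> params D - unders D" using arc_props(2)[OF that(1)] by blast
    then have "{s..t} \<subseteq> params D" "unders D \<inter> {s..t} = {}" by blast+
    moreover from this(2) have "unders D \<inter> {s..<t} = {}" by (auto simp: disjoint_iff)
    ultimately show ?thesis using flows_const[OF fl that(4)] by simp
  qed
  have CA: "C A = c t" if "A \<in> arcs D" "t \<in> A" for A t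
  proof -
    have "(SOME t. t \<in> A) \<in> A" using that(2) by (rule someI)
    then have "c (SOME t. t \<in> A) = c t" using const[OF that(1)] that(2) by (metis linear)
    then show ?thesis using that(1) by (simp add: C_def)
  qed
  have Cat: "C (arc_at D t) = c t" if "t \<in> params D - unders D" for t
    using CA[OF arc_at_props[OF that]] .
  have cross: "C (arc_before D t) = c t \<and> c t \<in> carrier Q \<and>
     C (arc_after D t) = qop Q (along_normal D t) (c t) (c (over D t))" if t: "t \<in> unders D" for t
  proof -
    obtain l r where lr: "l < t" "t < r" "{l..r} \<subseteq> params D" "unders D \<inter> {l..r} = {t}"
      "arc_before D t = arc_at D l" "arc_after D t = arc_at D r"
      "l \<in> params D - unders D" "r \<in> params D - unders D"
      using under_neighbourhood[OF D t] .
    have sub: "{l..t} \<subseteq> params D" "{t..r} \<subseteq> params D" using lr(1-3) by (auto simp: subset_iff)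
    have "{l..<t} \<subseteq> {l..r} - {t}" "{t..<r} \<subseteq> {l..r}" "t \<in> {t..<r}" using lr(1,2) by auto
    then have U: "unders D \<inter> {l..<t} = {}" "unders D \<inter> {t..<r} = {t}" using lr(4) by blast+
    have "c t = c l" using flows_const[OF fl _ sub(1) U(1)] lr(1) by simp
    moreover have "c r = qop Q (along_normal D t) (c t) (c (over D t))"
      using flowsD[OF fl _ sub(2)] lr(2) U(2) by (simp add: passes_def)
    ultimately show ?thesis using lr(5,6) Cat[OF lr(7)] Cat[OF lr(8)] mem lr(7) by (auto simp: Pi_iff)
  qed
  have "C A \<in> carrier Q" if A: "A \<in> arcs D" for A
  proof -
    obtain t where t: "t \<in> A" using arc_props(3)[OF A] by blast
    then have "t \<in> params D" using arc_props(2)[OF A] t by blast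
    then show ?thesis using CA[OF A t] mem by auto
  qed
  then have "C \<in> arcs D \<rightarrow>\<^sub>E carrier Q" by (auto simp: C_def)
  moreover have "if along_normal D t
     then C (arc_after D t) = star Q (C (arc_before D t)) (C (over_arc D t))
     else C (arc_before D t) = star Q (C (arc_after D t)) (C (over_arc D t))"
    if t: "t \<in> unders D" for t
  proof -
    have "over D t \<in> params D - unders D" using over_props(1,2)[OF reg t] by blast
    then have "C (over_arc D t) = c (over D t)" "c (over D t) \<in> carrier Q"
      using Cat mem by (auto simp: over_arc_def Pi_iff)
    then show ?thesis
      using cross[OF t] by (auto simp: qop_def costar_star)
  qed
  ultimately have "C \<in> colorings D Q" by (simp add: colorings_def)
  moreover have "color_at D C = c"
  proof (rule extensionalityI[of _ "params D"])
    show "c \<in> extensional (params D)" by (rule param_coloringsD(3)[OF c])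
    show "color_at D C t = c t" if "t \<in> params D" for t
      using that cross Cat by (auto simp: color_at_def)
  qed (auto simp: color_at_def)
  ultimately show ?thesis by blast
qed

lemma color_at_bij:
  assumes D: "proper_diagram D"
  shows "bij_betw (color_at D) (colorings D Q) (param_colorings D Q)"
  unfolding bij_betw_def
proof
  show "inj_on (color_at D) (colorings D Q)"
  proof (rule inj_onI)
    fix C C' assume C: "C \<in> colorings D Q" "C' \<in> colorings D Q" "color_at D C = color_at D C'"
    show "C = C'"
    proof (rule extensionalityI[of _ "arcs D"])
      fix A assume A: "A \<in> arcs D"
      obtain t where t: "t \<in> A" using arc_props(3)[OF A] by blast
      have "t \<in> params D - unders D" using arc_props(2)[OF A] t by blast
      then show "C A = C' A"
        using color_at_arc[of t D C] color_at_arc[of t D C'] arc_at_eqI[OF A t] C(3) by simp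
    qed (use C in \<open>auto simp: colorings_def PiE_def\<close>)
  qed
  show "color_at D ` colorings D Q = param_colorings D Q"
    using color_at_coloring[OF D] color_at_surj[OF D] by blast
qed

end

section \<open>Formal sums over functions of the parameter\<close>

definition initially :: "'a \<Rightarrow> (real \<Rightarrow> 'a) \<Rightarrow> bool" where
  "initially q c \<longleftrightarrow> (\<exists>M. \<forall>t\<le>M. c t = q)"

definition on_boundary :: "'a \<Rightarrow> (real \<Rightarrow> 'a) \<Rightarrow> bool" where
  "on_boundary q c \<longleftrightarrow> (\<forall>t\<in>endpoints. c t = q)"

definition longitude_sum ::
  "'a magma2 \<Rightarrow> diagram \<Rightarrow> ((real \<Rightarrow> 'a) \<Rightarrow> bool) \<Rightarrow> real set \<Rightarrow> real set \<Rightarrow> 'a \<Rightarrow> 'a \<Rightarrow>\<^sub>0 int" where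
  "longitude_sum Q D \<beta> S1 S2 x = (\<Sum>c \<in> {c \<in> param_colorings D Q. \<beta> c}.
     Poly_Mapping.single (act Q (param_longitude D c S1 @ param_longitude D c S2) x) 1)"

lemma initially_color_at:
  assumes D: "long_knot_diagram D"
  shows "C (initial_arc D) = q \<longleftrightarrow> initially q (color_at D C)"
proof -
  have reg: "regular_diagram D" and P: "params D = UNIV"
    using D by (auto simp: long_knot_diagram_def)
  define M where "M = Min (insert 0 (unders D)) - 1"
  have M: "M < u" if "u \<in> unders D" for u
  proof -
    have "Min (insert 0 (unders D)) \<le> u" by (rule Min_le) (use finite_unders[OF reg] that in auto)
    then show ?thesis by (simp add: M_def)
  qed
  have sub: "{..M} \<subseteq> params D - unders D" using M P by force
  have con: "connected {..M}" by simp
  have at: "arc_at D t = arc_at D M" if "t \<le> M" for t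
    by (rule arc_at_same[OF con sub]) (use that in auto)
  have "initial_arc D = arc_at D M"
    unfolding initial_arc_def
  proof (rule the_equality)
    have A: "arc_at D M \<in> arcs D" by (rule arc_at_props) (use sub in auto)
    have "{..M} \<subseteq> arc_at D M" by (rule arc_at_connected[OF con sub]) simp
    then show "arc_at D M \<in> arcs D \<and> (\<exists>N. {..N} \<subseteq> arc_at D M)" using A by blast
    fix B assume B: "B \<in> arcs D \<and> (\<exists>N. {..N} \<subseteq> B)"
    then obtain N where "{..N} \<subseteq> B" by auto
    then have "min M N \<in> B" "min M N \<in> arc_at D M" using \<open>{..M} \<subseteq> arc_at D M\<close> by auto
    then show "B = arc_at D M" using arc_eqI A B by blast
  qed
  moreover have "color_at D C t = C (arc_at D M)" if "t \<le> M" for t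
    using color_at_arc[of t D C] at[OF that] sub that by auto
  ultimately show ?thesis
    unfolding initially_def by (metis linear)
qed

lemma on_boundary_color_at:
  assumes D: "tangle_diagram D"
  shows "(\<forall>t\<in>endpoints. C (arc_at D t) = q) \<longleftrightarrow> on_boundary q (color_at D C)"
proof -
  have "color_at D C t = C (arc_at D t)" if t: "t \<in> endpoints" for t
  proof (rule color_at_arc)
    have P: "params D = strand1 \<union> strand2" using D by (simp add: tangle_diagram_def)
    have "t \<notin> unders D" using tangle_endpoint_not_under[OF D] t by blast
    then show "t \<in> params D - unders D"
      using t P by (auto simp: endpoints_def strand1_def strand2_def)
  qed
  then show ?thesis by (auto simp: on_boundary_def)
qed

lemma param_longitude_empty [simp]: "param_longitude D c {} = []"
  by (simp add: param_longitude_def)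

context quandle
begin

lemma longitude_sum_eq:
  assumes D: "proper_diagram D" and \<beta>: "\<And>C. C \<in> colorings D Q \<Longrightarrow> \<alpha> C \<longleftrightarrow> \<beta> (color_at D C)"
  shows "(\<Sum>C\<in>{C \<in> colorings D Q. \<alpha> C}.
      Poly_Mapping.single (act Q (longitude D C S1 @ longitude D C S2) x) 1) =
    longitude_sum Q D \<beta> S1 S2 x"
proof -
  have b: "bij_betw (color_at D) (colorings D Q) (param_colorings D Q)" by (rule color_at_bij[OF D])
  have "color_at D ` {C \<in> colorings D Q. \<alpha> C} = {c \<in> param_colorings D Q. \<beta> c}"
    using bij_betw_imp_surj_on[OF b] \<beta> by fastforce
  moreover have "inj_on (color_at D) {C \<in> colorings D Q. \<alpha> C}"
    using bij_betw_imp_inj_on[OF b] by (rule inj_on_subset) auto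
  ultimately have "bij_betw (color_at D) {C \<in> colorings D Q. \<alpha> C} {c \<in> param_colorings D Q. \<beta> c}"
    by (simp add: bij_betw_def)
  from sum.reindex_bij_betw[OF this,
      of "\<lambda>c. Poly_Mapping.single (act Q (param_longitude D c S1 @ param_longitude D c S2) x) 1"]
  show ?thesis
    unfolding longitude_sum_def longitude_param[OF proper_regular[OF D]] .
qed

lemma S_Phi_eq:
  assumes "long_knot_diagram D"
  shows "S_Phi Q q x D = longitude_sum Q D (initially q) UNIV {} x"
proof -
  have "(\<Sum>C\<in>{C \<in> colorings D Q. C (initial_arc D) = q}.
      Poly_Mapping.single (act Q (longitude D C UNIV @ longitude D C {}) x) (1::int)) =
    longitude_sum Q D (initially q) UNIV {} x"
    by (rule longitude_sum_eq[OF long_knot_proper[OF assms]]) (rule initially_color_at[OF assms])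
  then show ?thesis
    by (simp add: S_Phi_def long_colorings_def longitude_def)
qed

lemma S_1_eq:
  assumes "tangle_diagram D"
  shows "S_1 Q q x D = longitude_sum Q D (on_boundary q) strand1 strand2 x"
  unfolding S_1_def tangle_colorings_def
  by (rule longitude_sum_eq[OF tangle_proper[OF assms]]) (rule on_boundary_color_at[OF assms])

lemma S_2_eq:
  assumes "tangle_diagram D"
  shows "S_2 Q q x D = longitude_sum Q D (on_boundary q) strand2 strand1 x"
  unfolding S_2_def tangle_colorings_def
  by (rule longitude_sum_eq[OF tangle_proper[OF assms]]) (rule on_boundary_color_at[OF assms])

text \<open>An arc is determined by the set of under-crossings that precede it.\<close>

lemma finite_long_colorings:
  assumes D: "long_knot_diagram D" and fin: "finite (carrier Q)"
  shows "finite (param_colorings D Q)"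
proof -
  have reg: "regular_diagram D" and P: "params D = UNIV"
    using D by (auto simp: long_knot_diagram_def)
  define below where "below t = {u \<in> unders D. u < t}" for t
  define g where "g V = arc_at D (SOME t. t \<notin> unders D \<and> below t = V)" for V
  have same: "arc_at D s = arc_at D t" if "s \<le> t" "s \<notin> unders D" "t \<notin> unders D" "below s = below t" for s t
  proof (rule arc_at_same[of "{s..t}"])
    show "{s..t} \<subseteq> params D - unders D"
    proof
      fix u assume u: "u \<in> {s..t}"
      have "u \<notin> unders D"
      proof
        assume "u \<in> unders D"
        moreover from this have "u < t" using u that(3) by (metis atLeastAtMost_iff order_le_less)
        ultimately have "u \<in> below s" using that(4) by (simp add: below_def)
        then show False using u by (simp add: below_def)
      qed
      then show "u \<in> params D - unders D" using P by simp
    qed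
  qed (use that in auto)
  have "arcs D \<subseteq> g ` Pow (unders D)"
  proof
    fix A assume A: "A \<in> arcs D"
    obtain t where t: "t \<in> A" using arc_props(3)[OF A] by blast
    have tU: "t \<notin> unders D" using arc_props(2)[OF A] t by blast
    define s where "s = (SOME s. s \<notin> unders D \<and> below s = below t)"
    have s: "s \<notin> unders D \<and> below s = below t"
      unfolding s_def by (rule someI[of _ t]) (use tU in simp)
    have "arc_at D s = arc_at D t" using same s tU by (metis linear)
    then have "g (below t) = A" using arc_at_eqI[OF A t] by (simp add: g_def s_def)
    moreover have "below t \<in> Pow (unders D)" by (auto simp: below_def)
    ultimately show "A \<in> g ` Pow (unders D)" by blast
  qed
  then have "finite (arcs D)"
    using finite_unders[OF reg] by (meson finite_Pow_iff finite_imageI finite_subset)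
  then have "finite (colorings D Q)"
    using fin by (auto simp: colorings_def intro: finite_subset[OF _ finite_PiE[of "arcs D" "\<lambda>_. carrier Q"]])
  then show ?thesis using color_at_bij[OF long_knot_proper[OF D]] bij_betw_finite by blast
qed

end

section \<open>Differential geometry of the plane\<close>

definition det2 :: "complex \<Rightarrow> complex \<Rightarrow> real" where
  "det2 u v = Im (cnj u * v)"

lemma inner_normal: "inner (\<i> * u) v = det2 u v"
  by (simp add: det2_def inner_complex_def)

lemma det2_scaleR [simp]: "det2 (a *\<^sub>R u) v = a * det2 u v" "det2 u (a *\<^sub>R v) = a * det2 u v"
  by (simp_all add: det2_def algebra_simps)

lemma det2_add_right: "det2 u (v + w) = det2 u v + det2 u w"
  by (simp add: det2_def algebra_simps)

lemma det2_self [simp]: "det2 u u = 0"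
  by (simp add: det2_def)

lemma det2_combination:
  "det2 (a *\<^sub>R p + b *\<^sub>R q) (c *\<^sub>R p + d *\<^sub>R q) = det2 p q * (a * d - b * c)"
  unfolding det2_def by (simp, algebra)

lemma along_normal_det2: "along_normal D t \<longleftrightarrow> det2 (tangent D (over D t)) (tangent D t) > 0"
  by (simp add: along_normal_def normal_def inner_normal)

lemma smooth_plane_derivative:
  assumes "smooth_plane h"
  shows "(h has_derivative frechet_derivative h (at z)) (at z)"
    and "frechet_derivative h (at z) v =
      Re v *\<^sub>R frechet_derivative h (at z) 1 + Im v *\<^sub>R frechet_derivative h (at z) \<i>"
    and "continuous_on A (\<lambda>z. frechet_derivative h (at z) v)"
proof -
  obtain F :: "nat \<Rightarrow> nat \<Rightarrow> complex \<Rightarrow> complex" where F: "F 0 0 = h"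
    "\<forall>m n z. (F m n has_derivative
      (\<lambda>v. Re v *\<^sub>R F (Suc m) n z + Im v *\<^sub>R F m (Suc n) z)) (at z)"
    using assms unfolding smooth_plane_def by blast
  have d: "(h has_derivative (\<lambda>v. Re v *\<^sub>R F 1 0 z + Im v *\<^sub>R F 0 1 z)) (at z)" for z
    using F(2)[rule_format, of 0 0 z] F(1) by simp
  have e: "frechet_derivative h (at z) = (\<lambda>v. Re v *\<^sub>R F 1 0 z + Im v *\<^sub>R F 0 1 z)" for z
    using frechet_derivative_at[OF d] by (rule sym)
  show "(h has_derivative frechet_derivative h (at z)) (at z)" unfolding e by (rule d)
  show "frechet_derivative h (at z) v =
      Re v *\<^sub>R frechet_derivative h (at z) 1 + Im v *\<^sub>R frechet_derivative h (at z) \<i>"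
    unfolding e by simp
  have "continuous_on A (F m n)" for m n
    by (rule continuous_at_imp_continuous_on) (use has_derivative_continuous[OF F(2)[rule_format]] in simp)
  then show "continuous_on A (\<lambda>z. frechet_derivative h (at z) v)"
    unfolding e by (intro continuous_intros)
qed

lemma det2_frechet:
  assumes "smooth_plane h"
  shows "det2 (frechet_derivative h (at z) u) (frechet_derivative h (at z) v) =
    jacobian h z * det2 u v"
proof -
  have "jacobian h z = det2 (frechet_derivative h (at z) 1) (frechet_derivative h (at z) \<i>)"
    unfolding jacobian_def det2_def by (rule refl)
  moreover have "det2 u v = Re u * Im v - Im u * Re v"
    unfolding det2_def by simp
  ultimately show ?thesis
    by (subst (1 2) smooth_plane_derivative(2)[OF assms]) (simp only: det2_combination)
qed

lemma frechet_nonzero: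
  assumes "oriented_diffeo h" "u \<noteq> 0"
  shows "frechet_derivative h (at z) u \<noteq> 0"
proof
  assume "frechet_derivative h (at z) u = 0"
  then have "jacobian h z * det2 u (\<i> * u) = 0"
    using det2_frechet[of h z u "\<i> * u"] assms(1) by (simp add: oriented_diffeo_def det2_def)
  moreover have "jacobian h z \<noteq> 0" using assms(1) by (metis less_irrefl oriented_diffeo_def)
  moreover have "det2 u (\<i> * u) = (norm u)\<^sup>2"
    unfolding cmod_power2 by (simp add: det2_def power2_eq_square)
  ultimately show False using assms(2) by simp
qed

lemma curve_has_tangent:
  assumes "smooth_curve (curve D)"
  shows "(curve D has_vector_derivative tangent D t) (at t)"
proof -
  obtain F :: "nat \<Rightarrow> real \<Rightarrow> complex" where
    F: "F 0 = curve D" "\<forall>n t. (F n has_vector_derivative F (Suc n) t) (at t)"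
    using assms unfolding smooth_curve_def by blast
  have "(curve D has_vector_derivative F 1 t) (at t)" using F(2)[rule_format, of 0 t] F(1) by simp
  then show ?thesis unfolding tangent_def using vector_derivative_at by metis
qed

lemma continuous_tangent:
  assumes "smooth_curve (curve D)"
  shows "continuous_on A (tangent D)"
proof -
  obtain F :: "nat \<Rightarrow> real \<Rightarrow> complex" where
    F: "F 0 = curve D" "\<forall>n t. (F n has_vector_derivative F (Suc n) t) (at t)"
    using assms unfolding smooth_curve_def by blast
  have "tangent D t = F 1 t" for t
    unfolding tangent_def using F(2)[rule_format, of 0 t] F(1) by (intro vector_derivative_at) simp
  then have "tangent D = F 1" by (rule ext)
  moreover have "continuous_on A (F 1)"
    by (rule continuous_at_imp_continuous_on)
      (use has_vector_derivative_continuous[OF F(2)[rule_format]] in simp)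
  ultimately show ?thesis by simp
qed

lemma tangent_cong:
  assumes "open W" "t \<in> W" "\<And>s. s \<in> W \<Longrightarrow> curve D' s = curve D s" "smooth_curve (curve D)"
  shows "tangent D' t = tangent D t"
proof -
  have "(curve D' has_vector_derivative tangent D t) (at t)"
    by (rule has_vector_derivative_transform_within_open[OF curve_has_tangent[OF assms(4)] assms(1,2)])
      (simp add: assms(3))
  then show ?thesis unfolding tangent_def[of D'] by (rule vector_derivative_at)
qed

lemma image_has_tangent:
  assumes "smooth_plane h" "smooth_curve (curve D)"
  shows "(h \<circ> curve D has_vector_derivative frechet_derivative h (at (curve D t)) (tangent D t)) (at t)"
  using vector_derivative_diff_chain_within[OF curve_has_tangent[OF assms(2)], of h]
    has_derivative_at_withinI[OF smooth_plane_derivative(1)[OF assms(1)]] by blast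

lemma continuous_image_tangent:
  assumes "smooth_plane h" "smooth_curve (curve D)"
  shows "continuous_on A (\<lambda>t. frechet_derivative h (at (curve D t)) (tangent D t))"
proof -
  have cD: "continuous_on A (curve D)"
    by (rule continuous_at_imp_continuous_on)
      (use has_vector_derivative_continuous[OF curve_has_tangent[OF assms(2)]] in simp)
  have "continuous_on A (\<lambda>t. frechet_derivative h (at (curve D t)) v)" for v
    by (rule continuous_on_compose2[OF smooth_plane_derivative(3)[OF assms(1), of UNIV] cD]) simp
  then show ?thesis
    by (subst smooth_plane_derivative(2)[OF assms(1)])
      (intro continuous_intros continuous_tangent[OF assms(2)])
qed

text \<open>
  A curve on a line cannot turn back, as its derivative does not vanish. So a chord is a positive
  multiple of the tangent at either end.
\<close>

lemma collinear_chord: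
  fixes f f' :: "real \<Rightarrow> complex"
  assumes der: "\<And>t. (f has_vector_derivative f' t) (at t)" and con: "continuous_on {a..b} f'"
    and nz: "\<And>t. t \<in> {a..b} \<Longrightarrow> f' t \<noteq> 0" and col: "collinear (f ` {a..b})"
    and st: "s \<in> {a..b}" "t \<in> {a..b}" "s < t"
  shows "\<exists>k>0. f t - f s = k *\<^sub>R f' s" "\<exists>k>0. f t - f s = k *\<^sub>R f' t"
proof -
  have ab: "a < b" using st by auto
  obtain u v where uv: "\<And>x. x \<in> {a..b} \<Longrightarrow> \<exists>c. f x = u + c *\<^sub>R v"
    using col unfolding collinear_alt by blast
  define w where "w = (1 / inner v v) *\<^sub>R v"
  define g where "g x = inner (f x - u) w" for x
  define g' where "g' x = inner (f' x) w" for x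
  have fg: "f x = u + g x *\<^sub>R v" if "x \<in> {a..b}" for x
    using uv[OF that] by (cases "v = 0") (auto simp: g_def w_def)
  have dg: "(g has_vector_derivative g' x) (at x)" for x
    using der[of x] unfolding has_vector_derivative_def g_def g'_def
    by (auto intro!: derivative_eq_intros)
  have f'g: "f' x = g' x *\<^sub>R v" if x: "x \<in> {a..b}" for x
  proof (rule vector_derivative_unique_within_closed_interval[OF ab])
    show "x \<in> cbox a b" using x by simp
    show "(f has_vector_derivative f' x) (at x within cbox a b)"
      using der has_vector_derivative_at_within by blast
    have "((\<lambda>x. u + g x *\<^sub>R v) has_vector_derivative g' x *\<^sub>R v) (at x within cbox a b)"
      using has_vector_derivative_at_within[OF dg[of x]]
      by (auto intro!: derivative_eq_intros simp: has_vector_derivative_def)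
    then show "(f has_vector_derivative g' x *\<^sub>R v) (at x within cbox a b)"
      by (rule has_vector_derivative_transform[rotated 2]) (use x fg in auto)
  qed
  have cg: "continuous_on {a..b} g'" unfolding g'_def by (intro continuous_intros con)
  have "connected (g' ` {a..b})" by (rule connected_continuous_image[OF cg]) simp
  then have iv: "is_interval (g' ` {a..b})" by (simp add: is_interval_connected_1)
  have nz': "g' x \<noteq> 0" if "x \<in> {a..b}" for x using f'g[OF that] nz[OF that] by auto
  have sgn: "g' x / g' y > 0" if xy: "x \<in> {a..b}" "y \<in> {a..b}" for x y
  proof (rule ccontr)
    assume "\<not> g' x / g' y > 0"
    then have "g' x \<le> 0 \<and> 0 \<le> g' y \<or> g' y \<le> 0 \<and> 0 \<le> g' x"
      by (auto simp: zero_less_divide_iff not_less)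
    then have "0 \<in> g' ` {a..b}" using iv xy unfolding is_interval_1 by blast
    then show False using nz' by auto
  qed
  obtain \<xi> where \<xi>: "s < \<xi>" "\<xi> < t" "g t - g s = (t - s) * g' \<xi>"
    using MVT2[OF st(3), of g g'] dg by (auto simp: has_real_derivative_iff_has_vector_derivative)
  have \<xi>2: "\<xi> \<in> {a..b}" using \<xi> st by auto
  have chord: "\<exists>k>0. f t - f s = k *\<^sub>R f' y" if y: "y \<in> {a..b}" for y
  proof (intro exI conjI)
    show "(t - s) * (g' \<xi> / g' y) > 0" using sgn[OF \<xi>2 y] st(3) by (intro mult_pos_pos) simp_all
    have "f t - f s = (g t - g s) *\<^sub>R v" using fg st by (simp add: scaleR_left_diff_distrib)
    also have "\<dots> = ((t - s) * (g' \<xi> / g' y)) *\<^sub>R f' y" using \<xi>(3) f'g[OF y] nz'[OF y] by simp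
    finally show "f t - f s = ((t - s) * (g' \<xi> / g' y)) *\<^sub>R f' y" .
  qed
  show "\<exists>k>0. f t - f s = k *\<^sub>R f' s" "\<exists>k>0. f t - f s = k *\<^sub>R f' t"
    using chord st by auto
qed

lemma collinear_chord_signed:
  fixes f f' :: "real \<Rightarrow> complex"
  assumes der: "\<And>t. (f has_vector_derivative f' t) (at t)" and con: "continuous_on {a..b} f'"
    and nz: "\<And>t. t \<in> {a..b} \<Longrightarrow> f' t \<noteq> 0" and col: "collinear (f ` {a..b})"
    and st: "s \<in> {a..b}" "t \<in> {a..b}" "s \<noteq> t"
  obtains k where "f t - f s = k *\<^sub>R f' s" "k > 0 \<longleftrightarrow> s < t" "k \<noteq> 0"
proof (cases "s < t")
  case True
  then show ?thesis
    using collinear_chord(1)[OF der con nz col st(1,2)] that by force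
next
  case False
  then have "t < s" using st(3) by simp
  then obtain k where k: "k > 0" "f s - f t = k *\<^sub>R f' s"
    using collinear_chord(2)[OF der con nz col st(2,1)] by blast
  then have "f t - f s = (- k) *\<^sub>R f' s" by (simp add: algebra_simps)
  then show ?thesis using that[of "- k"] k False by auto
qed

section \<open>From Reidemeister moves to local changes\<close>

lemma crossings_in_iff:
  assumes "regular_diagram D"
  shows "(s, t) \<in> crossings_in D B \<longleftrightarrow> t \<in> unders D \<and> t \<in> inside D B \<and> s = over D t"
  using over_double_point[OF assms] over_eqI[OF assms] over_props(3)[OF assms]
  by (auto simp: crossings_in_def inside_def)

lemma unders_inside:
  assumes "regular_diagram D"
  shows "unders D \<inter> inside D B = snd ` crossings_in D B"
  using crossings_in_iff[OF assms] by (force simp: image_iff)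

lemma agree_outside_local_change:
  assumes D: "proper_diagram D" "proper_diagram D'" and ag: "agree_outside B D D'"
    and ins: "inside D B = \<Union>\<J>" and fin: "finite \<J>" and ivl: "\<And>J. J \<in> \<J> \<Longrightarrow> \<exists>a b. J = {a..b}"
    and disj: "\<And>J K. J \<in> \<J> \<Longrightarrow> K \<in> \<J> \<Longrightarrow> J \<noteq> K \<Longrightarrow> J \<inter> K = {}"
    and int: "inside D B \<subseteq> interior (params D)"
  shows "local_change \<J> D D'"
proof -
  note reg = proper_regular[OF D(1)] proper_regular[OF D(2)]
  have P: "params D' = params D" and ins': "inside D' B = inside D B"
    and same: "\<And>t. t \<in> params D \<Longrightarrow> t \<notin> inside D B \<Longrightarrow>
      curve D' t = curve D t \<and> (t \<in> unders D' \<longleftrightarrow> t \<in> unders D)"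
    using ag by (auto simp: agree_outside_def)
  have "closed (\<Union>\<J>)" using fin ivl by (intro closed_Union) fastforce+
  then have op: "open (interior (params D) - inside D B)" by (simp add: ins open_Diff)
  have tan: "tangent D' t = tangent D t" if "t \<in> interior (params D)" "t \<notin> inside D B" for t
    by (rule tangent_cong[OF op])
      (use that same interior_subset[of "params D"] reg in \<open>auto simp: regular_diagram_def\<close>)
  have uP: "unders D \<subseteq> params D" "unders D' \<subseteq> params D"
    using over_props(3) reg P by auto
  have U: "unders D' - inside D B = unders D - inside D B" using uP same by blast
  have over_in: "over E t \<in> inside E B" if "regular_diagram E" "t \<in> unders E" "t \<in> inside E B" for E t
    using over_props[OF that(1,2)] that(3) by (simp add: inside_def)
  have out: "over D' t = over D t \<and> over D t \<notin> inside D B \<and> along_normal D' t = along_normal D t"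
    if t: "t \<in> unders D" "t \<notin> inside D B" for t
  proof -
    note o = over_props[OF reg(1) t(1)]
    have s: "over D t \<notin> inside D B" using o t(2) by (simp add: inside_def)
    have "(over D t, t) \<in> double_points D'"
      using o same[OF o(1) s] same[OF o(3) t(2)] P by (simp add: double_points_def)
    then have ov: "over D' t = over D t" by (rule over_eqI[OF reg(2)])
    show ?thesis
      using ov s tan[OF proper_interior(2)[OF D(1) t(1)] s]
        tan[OF proper_interior(1)[OF D(1) t(1)] t(2)]
      by (simp add: along_normal_det2)
  qed
  show ?thesis
    unfolding local_change_def ins[symmetric]
    using D P fin ivl int disj U out over_in[OF reg(1)] over_in[OF reg(2)] ins' by auto
qed

text \<open>
  The chords \<open>X\<close>, \<open>Y\<close>, \<open>Z\<close> are the sides of a triangle. Its vertex opposite to \<open>X\<close> lies on one side of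
  the line through \<open>X\<close>, and this side is described by the order of the crossings on \<open>Y\<close> and the
  sign of \<open>X\<close> over \<open>Y\<close> as well as by the order on \<open>Z\<close> and the sign of \<open>X\<close> over \<open>Z\<close>.
\<close>

lemma chord_signs:
  assumes D: "regular_diagram D" and h: "oriented_diffeo h"
    and X: "collinear (h ` curve D ` {ax..bx})" and Y: "collinear (h ` curve D ` {ay..by})"
    and Z: "collinear (h ` curve D ` {az..bz})"
    and sub: "{ax..bx} \<subseteq> params D" "{ay..by} \<subseteq> params D" "{az..bz} \<subseteq> params D"
    and x: "x1 \<in> {ax..bx}" "x2 \<in> {ax..bx}" "x1 \<noteq> x2"
    and y: "y1 \<in> {ay..by}" "y2 \<in> {ay..by}" "y1 \<noteq> y2"
    and z: "z1 \<in> {az..bz}" "z2 \<in> {az..bz}" "z1 \<noteq> z2"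
    and u: "y1 \<in> unders D" "z1 \<in> unders D" "z2 \<in> unders D"
    and o: "over D y1 = x1" "over D z1 = x2" "over D z2 = y2"
  shows "(z1 < z2) = (y1 < y2) \<longleftrightarrow> along_normal D y1 = along_normal D z1"
proof -
  define f where "f = h \<circ> curve D"
  define f' where "f' t = frechet_derivative h (at (curve D t)) (tangent D t)" for t
  have sm: "smooth_curve (curve D)" "smooth_plane h"
    using D h by (auto simp: regular_diagram_def oriented_diffeo_def)
  have der: "(f has_vector_derivative f' t) (at t)" for t
    unfolding f_def f'_def by (rule image_has_tangent[OF sm(2,1)])
  have con: "continuous_on A f'" for A
    unfolding f'_def by (rule continuous_image_tangent[OF sm(2,1)])
  have nz: "f' t \<noteq> 0" if "t \<in> params D" for t
    unfolding f'_def by (rule frechet_nonzero[OF h]) (use D that in \<open>auto simp: regular_diagram_def\<close>)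
  have col: "collinear (f ` {ax..bx})" "collinear (f ` {ay..by})" "collinear (f ` {az..bz})"
    using X Y Z by (simp_all add: f_def image_comp)
  have same: "f (over D t) = f t" if "t \<in> unders D" for t
    using over_props(5)[OF D that] by (simp add: f_def)
  have pos: "det2 (f' (over D t)) (f' t) > 0 \<longleftrightarrow> along_normal D t"
    and ne: "det2 (f' (over D t)) (f' t) \<noteq> 0" if t: "t \<in> unders D" for t
  proof -
    have j: "jacobian h (curve D t) > 0" using h by (simp add: oriented_diffeo_def)
    have e: "det2 (f' (over D t)) (f' t) =
        jacobian h (curve D t) * det2 (tangent D (over D t)) (tangent D t)"
      unfolding f'_def over_props(5)[OF D t] by (rule det2_frechet[OF sm(2)])
    show "det2 (f' (over D t)) (f' t) > 0 \<longleftrightarrow> along_normal D t"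
      unfolding e along_normal_det2 using j by (simp add: zero_less_mult_iff)
    have "\<forall>(s, t)\<in>double_points D. inner (normal D s) (tangent D t) \<noteq> 0"
      using D by (simp add: regular_diagram_def)
    then have "det2 (tangent D (over D t)) (tangent D t) \<noteq> 0"
      using over_double_point[OF D t] by (auto simp: normal_def inner_normal)
    then show "det2 (f' (over D t)) (f' t) \<noteq> 0" unfolding e using j by simp
  qed
  have v: "f x1 = f y1" "f x2 = f z1" "f y2 = f z2" using same u o by metis+
  have nzX: "f' t \<noteq> 0" if "t \<in> {ax..bx}" for t using nz sub(1) that by blast
  have nzY: "f' t \<noteq> 0" if "t \<in> {ay..by}" for t using nz sub(2) that by blast
  have nzZ: "f' t \<noteq> 0" if "t \<in> {az..bz}" for t using nz sub(3) that by blast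
  obtain \<alpha> where a: "f y2 - f y1 = \<alpha> *\<^sub>R f' y1" "\<alpha> > 0 \<longleftrightarrow> y1 < y2" "\<alpha> \<noteq> 0"
    using collinear_chord_signed[OF der con nzY col(2) y] .
  obtain \<beta> where b: "f z2 - f z1 = \<beta> *\<^sub>R f' z1" "\<beta> > 0 \<longleftrightarrow> z1 < z2" "\<beta> \<noteq> 0"
    using collinear_chord_signed[OF der con nzZ col(3) z] .
  obtain c where c: "f x2 - f x1 = c *\<^sub>R f' x1" "c > 0 \<longleftrightarrow> x1 < x2" "c \<noteq> 0"
    using collinear_chord_signed[OF der con nzX col(1) x] .
  obtain d where d: "f x1 - f x2 = d *\<^sub>R f' x2" "d > 0 \<longleftrightarrow> x2 < x1" "d \<noteq> 0"
    using collinear_chord_signed[OF der con nzX col(1) x(2,1) x(3)[symmetric]] .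
  \<comment> \<open>The tangents at the two crossings on \<open>X\<close> point in the same direction.\<close>
  define k where "k = - d / c"
  have "c *\<^sub>R f' x1 = - (d *\<^sub>R f' x2)" using c(1) d(1) by (metis minus_diff_eq)
  then have "(1 / c) *\<^sub>R (c *\<^sub>R f' x1) = (1 / c) *\<^sub>R (- (d *\<^sub>R f' x2))" by (rule arg_cong)
  then have k: "f' x1 = k *\<^sub>R f' x2" using c(3) by (simp add: k_def)
  have "k > 0"
    using c(2,3) d(2,3) x(3) by (auto simp: k_def divide_less_0_iff zero_less_divide_iff)
  have "f y2 - f y1 = (f z2 - f z1) + c *\<^sub>R f' x1" using v c(1) by (simp add: algebra_simps)
  \<comment> \<open>Moving along \<open>X\<close> does not change the height above the line through \<open>X\<close>.\<close>
  then have "det2 (f' x1) (\<alpha> *\<^sub>R f' y1) = det2 (f' x1) (\<beta> *\<^sub>R f' z1)"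
    using a(1) b(1) by (simp add: det2_add_right)
  then have key: "\<alpha> * det2 (f' x1) (f' y1) = (\<beta> * k) * det2 (f' x2) (f' z1)"
    by (simp add: k)
  have bk: "\<beta> * k > 0 \<longleftrightarrow> z1 < z2" "\<beta> * k \<noteq> 0"
    using b(2,3) \<open>k > 0\<close> by (simp_all add: zero_less_mult_iff)
  have sgn: "(p > 0) = (q > 0) \<longleftrightarrow> (i > 0) = (j > 0)"
    if "p * i = q * j" "p \<noteq> 0" "q \<noteq> 0" "i \<noteq> 0" "j \<noteq> 0" for p q i j :: real
  proof -
    have "(p > 0) = (i > 0) \<longleftrightarrow> (q > 0) = (j > 0)"
      using that by (metis less_irrefl linorder_neqE_linordered_idom mult_neg_neg mult_neg_pos
          mult_pos_neg mult_pos_pos not_less_iff_gr_or_eq)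
    then show ?thesis by blast
  qed
  show ?thesis
    using sgn[OF key a(3) bk(2)] ne[OF u(1)] ne[OF u(2)] pos[OF u(1)] pos[OF u(2)] o a(2) bk(1)
    by auto
qed

context quandle
begin

lemma reidemeister1_local:
  assumes D: "proper_diagram D" "proper_diagram D'" and r: "reidemeister1 R D D'"
    and int: "\<And>B. B \<subseteq> R \<Longrightarrow> inside D B \<subseteq> interior (params D)"
  shows "\<exists>\<J>. local_change \<J> D D' \<and> fillable Q D \<J> \<and> fillable Q D' \<J> \<and> same_effect Q D D' \<J>"
proof -
  note reg = proper_regular[OF D(1)] proper_regular[OF D(2)]
  obtain B a b s t where B: "B \<subseteq> R" "agree_outside B D D'" "inside D B = {a..b}"
    "crossings_in D B = {}" "crossings_in D' B = {(s, t)}"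
    using r unfolding reidemeister1_def by blast
  have ins': "inside D' B = {a..b}" and P: "params D' = params D"
    using B(2,3) by (auto simp: agree_outside_def)
  have lc: "local_change {{a..b}} D D'"
    by (rule agree_outside_local_change[OF D B(2)]) (use B(3) int[OF B(1)] in auto)
  have sub: "{a..b} \<subseteq> params D" "{a..b} \<subseteq> params D'"
    using local_change_strand[OF lc] P by auto
  have U: "unders D \<inter> {a..b} = {}" "unders D' \<inter> {a..b} = {t}"
    using unders_inside[OF reg(1), of B] unders_inside[OF reg(2), of B] B ins' by simp_all
  have t: "t \<in> unders D'" "t \<in> {a..b}" using U by blast+
  have o: "over D' t \<in> {a..b}" using lc t by (auto simp: local_change_def)
  have "fillable Q D {{a..b}}" by (rule loop_fillable[OF reg(1) sub(1), of t]) (use U in auto)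
  moreover have "fillable Q D' {{a..b}}"
    by (rule loop_fillable[OF reg(2) sub(2), of t]) (use U o in auto)
  moreover have "same_effect Q D D' {{a..b}}"
    by (rule reidemeister1_effect[OF reg(1) U(1) reg(2) P U(2) o sub(1)])
  ultimately show ?thesis using lc by blast
qed

lemma reidemeister2_local:
  assumes D: "proper_diagram D" "proper_diagram D'" and r: "reidemeister2 R D D'"
    and int: "\<And>B. B \<subseteq> R \<Longrightarrow> inside D B \<subseteq> interior (params D)"
  shows "\<exists>\<J>. local_change \<J> D D' \<and> fillable Q D \<J> \<and> fillable Q D' \<J> \<and> same_effect Q D D' \<J>"
proof -
  note reg = proper_regular[OF D(1)] proper_regular[OF D(2)]
  obtain B a b c d s1 t1 s2 t2 where B: "B \<subseteq> R" "agree_outside B D D'"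
    "inside D B = {a..b} \<union> {c..d}" "{a..b} \<inter> {c..d} = {}"
    "crossings_in D B = {}" "crossings_in D' B = {(s1, t1), (s2, t2)}"
    "{s1, s2} \<subseteq> {a..b}" "{t1, t2} \<subseteq> {c..d}" "along_normal D' t1 \<noteq> along_normal D' t2"
    using r unfolding reidemeister2_def by (elim exE conjE) meson
  define X Z where "X = {a..b}" and "Z = {c..d}"
  \<comment> \<open>an empty middle layer, as an interval\<close>
  have E: "{} = {1..0::real}" by simp
  have ins': "inside D' B = X \<union> Z" and P: "params D' = params D"
    using B(2,3) by (auto simp: agree_outside_def X_def Z_def)
  have XZ: "X \<inter> Z = {}" "inside D B = X \<union> Z" "t1 \<in> Z" "t2 \<in> Z" "s1 \<in> X" "s2 \<in> X"
    using B(3,4,7,8) by (auto simp: X_def Z_def)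
  have lc: "local_change {X, {}, Z} D D'"
  proof (rule agree_outside_local_change[OF D B(2)])
    show "\<exists>a b. J = {a..b}" if "J \<in> {X, {}, Z}" for J
      using that E unfolding X_def Z_def by blast
  qed (use XZ int[OF B(1)] in auto)
  have sub: "X \<subseteq> params D" "Z \<subseteq> params D" using local_change_strand[OF lc] by auto
  have U: "unders D \<inter> (X \<union> Z) = {}" "unders D' \<inter> (X \<union> Z) = {t1, t2}"
    using unders_inside[OF reg(1), of B] unders_inside[OF reg(2), of B] B(5,6) XZ(2) ins'
    by simp_all
  have o: "over D' t1 \<in> X" "over D' t2 \<in> X"
    using crossings_in_iff[OF reg(2), of s1 t1 B] crossings_in_iff[OF reg(2), of s2 t2 B] B(6) XZ
    by auto
  have UX: "unders D \<inter> X = {}" "unders D' \<inter> X = {}" "unders D \<inter> Z = {}" "unders D' \<inter> Z = {t1, t2}"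
  proof -
    have t: "t1 \<notin> X" "t2 \<notin> X" using XZ(1,3,4) by auto
    show "unders D \<inter> X = {}" "unders D \<inter> Z = {}" using U(1) by auto
    have "unders D' \<inter> X = {t1, t2} \<inter> X" "unders D' \<inter> Z = {t1, t2} \<inter> Z"
      unfolding U(2)[symmetric] by auto
    then show "unders D' \<inter> X = {}" "unders D' \<inter> Z = {t1, t2}" using t XZ(3,4) by auto
  qed
  have l: "layered D X {} Z" "layered D' X {} Z"
    unfolding layered_def using reg sub XZ(1) UX o P by auto
  have "t1 \<noteq> t2" using B(9) by blast
  then have "same_effect Q D D' {X, {}, Z}"
    using reidemeister2_effect[OF l(1) UX(3) l(2) P UX(4) _ B(9) X_def Z_def] by simp
  moreover have "fillable Q D {X, {}, Z}" "fillable Q D' {X, {}, Z}"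
    using layered_fillable[OF l(1) X_def E Z_def] layered_fillable[OF l(2) X_def E Z_def] by auto
  ultimately show ?thesis using lc by blast
qed

lemma reidemeister3_local:
  assumes D: "proper_diagram D" "proper_diagram D'" and r: "reidemeister3 R D D'"
    and int: "\<And>B. B \<subseteq> R \<Longrightarrow> inside D B \<subseteq> interior (params D)"
  shows "\<exists>\<J>. local_change \<J> D D' \<and> fillable Q D \<J> \<and> fillable Q D' \<J> \<and> same_effect Q D D' \<J>"
proof -
  note reg = proper_regular[OF D(1)] proper_regular[OF D(2)]
  obtain h B X Y Z x1 x2 y1 y2 z1 z2 x1' x2' y1' y2' z1' z2' where h: "oriented_diffeo h"
    and B: "B \<subseteq> R" "agree_outside B D D'"
    and V: "\<forall>V\<in>{X, Y, Z}. (\<exists>a b. V = {a..b}) \<and> collinear (h ` curve D ` V)"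
    and ins: "inside D B = X \<union> Y \<union> Z"
    and dj: "X \<inter> Y = {}" "X \<inter> Z = {}" "Y \<inter> Z = {}"
    and m: "{x1, x2, x1', x2'} \<subseteq> X" "{y1, y2, y1', y2'} \<subseteq> Y" "{z1, z2, z1', z2'} \<subseteq> Z"
    and cr: "crossings_in D B = {(x1, y1), (x2, z1), (y2, z2)}"
      "crossings_in D' B = {(x1', y1'), (x2', z1'), (y2', z2')}"
    and al: "along_normal D' y1' = along_normal D y1" "along_normal D' z1' = along_normal D z1"
      "along_normal D' z2' = along_normal D z2"
    and ord: "y1 < y2 \<longleftrightarrow> y2' < y1'" "z1 < z2 \<longleftrightarrow> z2' < z1'"
    using r unfolding reidemeister3_def by (elim exE conjE) (rule that; assumption)
  obtain ax bx ay "by" az bz where I: "X = {ax..bx}" "Y = {ay..by}" "Z = {az..bz}"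
    using V by (metis insertI1 insertI2)
  have ins': "inside D' B = X \<union> Y \<union> Z" and P: "params D' = params D"
    using B(2) ins by (auto simp: agree_outside_def)
  have lc: "local_change {X, Y, Z} D D'"
  proof (rule agree_outside_local_change[OF D B(2)])
    show "J \<inter> K = {}" if "J \<in> {X, Y, Z}" "K \<in> {X, Y, Z}" "J \<noteq> K" for J K
      using that dj by blast
  qed (use ins V int[OF B(1)] in auto)
  have sub: "X \<subseteq> params D" "Y \<subseteq> params D" "Z \<subseteq> params D"
    using local_change_strand[OF lc] by auto
  have tri: "triangle E X Y Z (along_normal E v1) (along_normal E w1) (along_normal E w2)
        (v1 < v2) (w1 < w2) \<and> v1 \<noteq> v2 \<and> w1 \<noteq> w2 \<and> u1 \<noteq> u2 \<and>
      {v1, w1, w2} \<subseteq> unders E \<and> over E v1 = u1 \<and> over E w1 = u2 \<and> over E w2 = v2"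
    if E: "regular_diagram E" "inside E B = X \<union> Y \<union> Z" "params E = params D"
      and crE: "crossings_in E B = {(u1, v1), (u2, w1), (v2, w2)}"
      and mE: "u1 \<in> X" "u2 \<in> X" "v1 \<in> Y" "v2 \<in> Y" "w1 \<in> Z" "w2 \<in> Z"
    for E u1 u2 v1 v2 w1 w2
  proof -
    have iff: "(s, t) \<in> {(u1, v1), (u2, w1), (v2, w2)} \<longleftrightarrow>
        t \<in> unders E \<and> t \<in> X \<union> Y \<union> Z \<and> s = over E t" for s t
      using crossings_in_iff[OF E(1), of s t B] unfolding crE E(2) .
    have o: "v1 \<in> unders E" "w1 \<in> unders E" "w2 \<in> unders E"
      "over E v1 = u1" "over E w1 = u2" "over E w2 = v2"
      using iff[of u1 v1] iff[of u2 w1] iff[of v2 w2] by simp_all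
    have U: "unders E \<inter> (X \<union> Y \<union> Z) = {v1, w1, w2}"
      using unders_inside[OF E(1), of B] unfolding crE E(2) by simp
    have UX: "unders E \<inter> X = {}" "unders E \<inter> Y = {v1}" "unders E \<inter> Z = {w1, w2}"
    proof -
      have t: "v1 \<notin> X" "v1 \<notin> Z" "w1 \<notin> X" "w2 \<notin> X" "w1 \<notin> Y" "w2 \<notin> Y" using mE dj by auto
      have "unders E \<inter> X = {v1, w1, w2} \<inter> X" "unders E \<inter> Y = {v1, w1, w2} \<inter> Y"
        "unders E \<inter> Z = {v1, w1, w2} \<inter> Z"
        unfolding U[symmetric] by auto
      then show "unders E \<inter> X = {}" "unders E \<inter> Y = {v1}" "unders E \<inter> Z = {w1, w2}"
        using t mE by auto
    qed
    have "w1 \<noteq> w2" using o(5,6) mE dj by blast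
    moreover have "v1 \<noteq> v2" using over_props(2)[OF E(1) o(3)] o(1,6) by blast
    moreover have "u1 \<noteq> u2"
    proof
      assume "u1 = u2"
      then have "(v1, u1) \<in> double_points E" "(w1, u1) \<in> double_points E"
        using over_double_point[OF E(1) o(1)] over_double_point[OF E(1) o(2)] o(4,5)
          double_points_sym by auto
      then have "v1 = w1" using over_eqI[OF E(1)] by metis
      then show False using mE dj by blast
    qed
    moreover have l: "layered E X Y Z"
      unfolding layered_def using E(1,3) sub dj UX o mE by auto
    moreover have "triangle E X Y Z (along_normal E v1) (along_normal E w1) (along_normal E w2)
        (v1 < v2) (w1 < w2)"
      unfolding triangle_def
      by (intro conjI l exI[of _ v1] exI[of _ w1] exI[of _ w2])
        (use UX o mE \<open>w1 \<noteq> w2\<close> in simp_all)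
    ultimately show ?thesis using o by simp
  qed
  have T: "triangle D X Y Z (along_normal D y1) (along_normal D z1) (along_normal D z2)
        (y1 < y2) (z1 < z2) \<and> y1 \<noteq> y2 \<and> z1 \<noteq> z2 \<and> x1 \<noteq> x2 \<and>
      {y1, z1, z2} \<subseteq> unders D \<and> over D y1 = x1 \<and> over D z1 = x2 \<and> over D z2 = y2"
    by (rule tri[OF reg(1) ins refl cr(1)]) (use m in auto)
  have T': "triangle D' X Y Z (along_normal D' y1') (along_normal D' z1') (along_normal D' z2')
        (y1' < y2') (z1' < z2') \<and> y1' \<noteq> y2' \<and> z1' \<noteq> z2' \<and> x1' \<noteq> x2' \<and>
      {y1', z1', z2'} \<subseteq> unders D' \<and> over D' y1' = x1' \<and> over D' z1' = x2' \<and> over D' z2' = y2'"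
    by (rule tri[OF reg(2) ins' P cr(2)]) (use m in auto)
  have flip: "(y1' < y2') = (\<not> y1 < y2)" "(z1' < z2') = (\<not> z1 < z2)"
    using ord T' by auto
  have col: "collinear (h ` curve D ` {ax..bx})" "collinear (h ` curve D ` {ay..by})"
    "collinear (h ` curve D ` {az..bz})"
    using V I by simp_all
  have sgn: "(z1 < z2) = (y1 < y2) \<longleftrightarrow> along_normal D y1 = along_normal D z1"
  proof (rule chord_signs[OF reg(1) h col])
    show "{ax..bx} \<subseteq> params D" "{ay..by} \<subseteq> params D" "{az..bz} \<subseteq> params D" using sub I by simp_all
    show "x1 \<in> {ax..bx}" "x2 \<in> {ax..bx}" "y1 \<in> {ay..by}" "y2 \<in> {ay..by}" "z1 \<in> {az..bz}" "z2 \<in> {az..bz}"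
      using m unfolding I by simp_all
  qed (use T in blast)+
  have "same_effect Q D D' {X, Y, Z}"
    using triangle_effect[OF conjunct1[OF T] _ P sgn I] T'[unfolded flip al] by blast
  moreover have l: "layered D X Y Z" "layered D' X Y Z" using T T' by (auto simp: triangle_def)
  then have "fillable Q D {X, Y, Z}" "fillable Q D' {X, Y, Z}"
    using layered_fillable[OF l(1) I] layered_fillable[OF l(2) I] by blast+
  ultimately show ?thesis using lc by blast
qed

text \<open>
  The disc of a move avoids the ends of the curve, so the strands inside it lie on single
  components, and a condition \<open>\<beta>\<close> on the colors at the ends is not affected.
\<close>

lemma reidemeister_longitude_sum:
  assumes D: "proper_diagram D" "proper_diagram D'" and r: "reidemeister R D D'"
    and int: "\<And>B. B \<subseteq> R \<Longrightarrow> inside D B \<subseteq> interior (params D)"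
    and S: "\<And>a b. {a..b} \<subseteq> interior (params D) \<Longrightarrow>
      ({a..b} \<subseteq> S1 \<or> {a..b} \<inter> S1 = {}) \<and> ({a..b} \<subseteq> S2 \<or> {a..b} \<inter> S2 = {})"
    and \<beta>: "\<And>c c' I. compact I \<Longrightarrow> I \<subseteq> interior (params D) \<Longrightarrow>
      (\<And>t. t \<in> params D \<Longrightarrow> t \<notin> I \<Longrightarrow> c' t = c t) \<Longrightarrow> \<beta> c \<longleftrightarrow> \<beta> c'"
    and x: "x \<in> carrier Q"
  shows "longitude_sum Q D \<beta> S1 S2 x = longitude_sum Q D' \<beta> S1 S2 x"
proof -
  obtain \<J> where J: "local_change \<J> D D'" "fillable Q D \<J>" "fillable Q D' \<J>" "same_effect Q D D' \<J>"
    using r reidemeister1_local[OF D _ int] reidemeister2_local[OF D _ int]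
      reidemeister3_local[OF D _ int] unfolding reidemeister_def by blast
  have strand: "(K \<subseteq> S1 \<or> K \<inter> S1 = {}) \<and> (K \<subseteq> S2 \<or> K \<inter> S2 = {})" if K: "K \<in> \<J>" for K
  proof -
    obtain a b where "K = {a..b}" using local_change_interval(1)[OF J(1) K] by blast
    moreover have "K \<subseteq> interior (params D)" using local_changeD(6)[OF J(1)] K by (metis Sup_le_iff)
    ultimately show ?thesis using S[of a b] by simp
  qed
  have "compact K" if K: "K \<in> \<J>" for K
    using local_change_interval(1)[OF J(1) K] by auto
  then have com: "compact (\<Union>\<J>)" using local_changeD(4)[OF J(1)] by (intro compact_Union)
  have \<beta>': "\<beta> c \<longleftrightarrow> \<beta> c'" if "agree_off \<J> D c c'" for c c'
    by (rule \<beta>[OF com local_changeD(6)[OF J(1)]]) (use that in \<open>simp add: agree_off_def\<close>)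
  show ?thesis
    unfolding longitude_sum_def
    by (rule local_change_invariance[OF J _ _ \<beta>' x]) (use strand in blast)+
qed

lemma long_knot_reidemeister:
  assumes "long_knot_diagram D" "long_knot_diagram D'" "reidemeister UNIV D D'" "x \<in> carrier Q"
  shows "longitude_sum Q D (initially q) UNIV {} x = longitude_sum Q D' (initially q) UNIV {} x"
proof (rule reidemeister_longitude_sum[OF long_knot_proper[OF assms(1)] long_knot_proper[OF assms(2)]
      assms(3) _ _ _ assms(4)])
  have P: "params D = UNIV" using assms(1) by (simp add: long_knot_diagram_def)
  then show "inside D B \<subseteq> interior (params D)" for B by simp
  fix c c' :: "real \<Rightarrow> 'a" and I :: "real set"
  assume I: "compact I" and c: "\<And>t. t \<in> params D \<Longrightarrow> t \<notin> I \<Longrightarrow> c' t = c t"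
  obtain N where N: "\<And>t. t \<in> I \<Longrightarrow> \<bar>t\<bar> \<le> N"
    using compact_imp_bounded[OF I] by (auto simp: bounded_iff)
  have eq: "c' t = c t" if "t \<le> - N - 1" for t
  proof (rule c)
    show "t \<notin> I" using N[of t] that by auto
  qed (simp add: P)
  have *: "initially q b" if ab: "initially q a" "\<And>t. t \<le> - N - 1 \<Longrightarrow> b t = a t" for a b
  proof -
    obtain M where "\<forall>t\<le>M. a t = q" using ab(1) by (auto simp: initially_def)
    then show ?thesis
      unfolding initially_def using ab(2) by (intro exI[of _ "min M (- N - 1)"]) auto
  qed
  show "initially q c \<longleftrightarrow> initially q c'"
    using *[of c c'] *[of c' c] eq by auto
qed auto

lemma tangle_reidemeister:
  assumes D: "tangle_diagram D" "tangle_diagram D'" "reidemeister (ball 0 1) D D'" and x: "x \<in> carrier Q"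
    and S: "{S1, S2} = {strand1, strand2}"
  shows "longitude_sum Q D (on_boundary q) S1 S2 x = longitude_sum Q D' (on_boundary q) S1 S2 x"
proof (rule reidemeister_longitude_sum[OF tangle_proper[OF D(1)] tangle_proper[OF D(2)] D(3) _ _ _ x])
  have P: "params D = strand1 \<union> strand2" using D(1) by (simp add: tangle_diagram_def)
  show "inside D B \<subseteq> interior (params D)" if "B \<subseteq> ball 0 1" for B
  proof -
    have "inside D B \<subseteq> strand1 \<union> strand2 - endpoints"
      using that D(1) P by (auto simp: inside_def tangle_diagram_def)
    then show ?thesis using interior_strands strands_minus_endpoints P by auto
  qed
  have int: "interior (params D) \<subseteq> {0<..<1} \<union> {2<..<3}"
  proof
    fix t assume t: "t \<in> interior (params D)"
    then obtain e where e: "e > 0" "ball t e \<subseteq> strand1 \<union> strand2"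
      using P by (auto simp: mem_interior)
    define d where "d = min e 1 / 2"
    have d: "d > 0" "d < e" "d < 1" using e(1) by (auto simp: d_def)
    then have "t - d \<in> ball t e" "t + d \<in> ball t e" by (auto simp: dist_real_def)
    then have "t - d \<in> strand1 \<union> strand2" "t + d \<in> strand1 \<union> strand2" using e(2) by blast+
    moreover have "t \<in> strand1 \<union> strand2" using t interior_subset P by blast
    ultimately show "t \<in> {0<..<1} \<union> {2<..<3}"
      using d(1,3) by (auto simp: strand1_def strand2_def)
  qed
  show "({a..b} \<subseteq> S1 \<or> {a..b} \<inter> S1 = {}) \<and> ({a..b} \<subseteq> S2 \<or> {a..b} \<inter> S2 = {})"
    if ab: "{a..b} \<subseteq> interior (params D)" for a b
  proof -
    have "{a..b} \<subseteq> {0<..<1} \<union> {2<..<3}" using ab int by blast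
    have "{a..b} \<subseteq> strand1 \<and> {a..b} \<inter> strand2 = {} \<or> {a..b} \<subseteq> strand2 \<and> {a..b} \<inter> strand1 = {}"
    proof (cases "\<exists>t\<in>{a..b}. t \<le> 1")
      case True
      then obtain t where t: "t \<in> {a..b}" "t \<le> 1" by blast
      have "s < 1" if s: "s \<in> {a..b}" for s
      proof (rule ccontr)
        assume "\<not> s < 1"
        then have "1 \<in> {a..b}" using t s by auto
        then show False using \<open>{a..b} \<subseteq> {0<..<1} \<union> {2<..<3}\<close> by auto
      qed
      moreover have "{a..b} \<subseteq> strand1 \<union> strand2"
        using ab P interior_subset by blast
      ultimately have "s \<in> strand1 \<and> s \<notin> strand2" if "s \<in> {a..b}" for s
        using that by (fastforce simp: strand1_def strand2_def)
      then show ?thesis by blast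
    next
      case False
      moreover have "{a..b} \<subseteq> strand1 \<union> strand2"
        using ab P interior_subset by blast
      ultimately have "s \<in> strand2 \<and> s \<notin> strand1" if "s \<in> {a..b}" for s
        using that by (fastforce simp: strand1_def strand2_def)
      then show ?thesis by blast
    qed
    then show ?thesis using S by (auto simp: doubleton_eq_iff)
  qed
  fix c c' :: "real \<Rightarrow> 'a" and I :: "real set"
  assume I: "I \<subseteq> interior (params D)" and c: "\<And>t. t \<in> params D \<Longrightarrow> t \<notin> I \<Longrightarrow> c' t = c t"
  have "c' t = c t" if "t \<in> endpoints" for t
  proof (rule c)
    show "t \<in> params D" using that P by (auto simp: endpoints_def strand1_def strand2_def)
    show "t \<notin> I" using that I int by (auto simp: endpoints_def)
  qed
  then show "on_boundary q c \<longleftrightarrow> on_boundary q c'" by (simp add: on_boundary_def)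
qed

end

section \<open>Diagrams carried by a diffeomorphism\<close>

lemma oriented_diffeo_inj: "oriented_diffeo h \<Longrightarrow> h z = h w \<longleftrightarrow> z = w"
  by (auto simp: oriented_diffeo_def bij_def inj_def)

lemma carried_props:
  assumes "carried_to h \<rho> D D'"
  shows "\<And>t. t \<in> params D' \<Longrightarrow> \<rho> t \<in> params D"
    "\<And>t. t \<in> params D' \<Longrightarrow> curve D' t = h (curve D (\<rho> t))"
    "\<And>t. t \<in> params D' \<Longrightarrow> t \<in> unders D' \<longleftrightarrow> \<rho> t \<in> unders D"
    "inj_on \<rho> (params D')" "\<And>t. (\<rho> has_real_derivative deriv \<rho> t) (at t)"
    "\<And>t. t \<in> params D' \<Longrightarrow> deriv \<rho> t > 0"
proof -
  obtain F :: "nat \<Rightarrow> real \<Rightarrow> real" where F: "F 0 = \<rho>"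
    "\<forall>n t. (F n has_vector_derivative F (Suc n) t) (at t)"
    using assms unfolding carried_to_def smooth_curve_def by blast
  have "(\<rho> has_real_derivative F 1 t) (at t)" for t
    using F(2)[rule_format, of 0 t] F(1) by (simp add: has_real_derivative_iff_has_vector_derivative)
  then show "(\<rho> has_real_derivative deriv \<rho> t) (at t)" for t
    using DERIV_imp_deriv by metis
qed (use assms in \<open>auto simp: carried_to_def\<close>)

lemma carried_continuous: "carried_to h \<rho> D D' \<Longrightarrow> continuous_on A \<rho>"
  by (rule continuous_at_imp_continuous_on) (use carried_props(5) DERIV_isCont in blast)

lemma carried_strict_mono:
  assumes "carried_to h \<rho> D D'" "{a..b} \<subseteq> params D'"
  shows "strict_mono_on {a..b} \<rho>"
proof (rule strict_mono_onI)
  fix s t assume st: "s \<in> {a..b}" "t \<in> {a..b}" "s < t"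
  show "\<rho> s < \<rho> t"
  proof (rule DERIV_pos_imp_increasing[OF st(3)])
    fix r assume "s \<le> r" "r \<le> t"
    then have "r \<in> params D'" using st assms(2) by (auto simp: subset_iff)
    then show "\<exists>y. (\<rho> has_real_derivative y) (at r) \<and> 0 < y"
      using carried_props(5,6)[OF assms(1)] by blast
  qed
qed

lemma carried_tangent:
  assumes ca: "carried_to h \<rho> D D'" and h: "oriented_diffeo h" and D: "regular_diagram D"
    and t: "t \<in> interior (params D')"
  shows "tangent D' t = deriv \<rho> t *\<^sub>R frechet_derivative h (at (curve D (\<rho> t))) (tangent D (\<rho> t))"
proof -
  have sm: "smooth_curve (curve D)" "smooth_plane h"
    using D h by (auto simp: regular_diagram_def oriented_diffeo_def)
  have "(\<rho> has_vector_derivative deriv \<rho> t) (at t)"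
    using carried_props(5)[OF ca] by (simp add: has_real_derivative_iff_has_vector_derivative)
  from vector_diff_chain_at[OF this image_has_tangent[OF sm(2,1), of "\<rho> t"]]
  have d: "((h \<circ> curve D) \<circ> \<rho> has_vector_derivative
      deriv \<rho> t *\<^sub>R frechet_derivative h (at (curve D (\<rho> t))) (tangent D (\<rho> t))) (at t)" .
  have "(curve D' has_vector_derivative
      deriv \<rho> t *\<^sub>R frechet_derivative h (at (curve D (\<rho> t))) (tangent D (\<rho> t))) (at t)"
  proof (rule has_vector_derivative_transform_within_open[OF d open_interior t])
    show "((h \<circ> curve D) \<circ> \<rho>) s = curve D' s" if "s \<in> interior (params D')" for s
      using carried_props(2)[OF ca, of s] interior_subset[of "params D'"] that by auto
  qed
  then show ?thesis unfolding tangent_def[of D'] by (rule vector_derivative_at)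
qed

text \<open>Orientation preserving diffeomorphisms preserve the signs of crossings.\<close>

lemma carried_crossing:
  assumes ca: "carried_to h \<rho> D D'" and h: "oriented_diffeo h"
    and D: "regular_diagram D" "proper_diagram D'" and t: "t \<in> unders D'"
  shows "\<rho> t \<in> unders D" "\<rho> (over D' t) = over D (\<rho> t)" "along_normal D' t = along_normal D (\<rho> t)"
proof -
  note reg = proper_regular[OF D(2)]
  note o = over_props[OF reg t]
  let ?s = "over D' t"
  show u: "\<rho> t \<in> unders D" using carried_props(3)[OF ca o(3)] t by simp
  have "h (curve D (\<rho> ?s)) = h (curve D (\<rho> t))"
    using o(5) carried_props(2)[OF ca o(1)] carried_props(2)[OF ca o(3)] by simp
  then have eq: "curve D (\<rho> ?s) = curve D (\<rho> t)" using oriented_diffeo_inj[OF h] by blast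
  moreover have "\<rho> ?s \<noteq> \<rho> t" using carried_props(4)[OF ca] o(1,3,4) by (meson inj_on_def)
  ultimately have "(\<rho> ?s, \<rho> t) \<in> double_points D"
    using carried_props(1)[OF ca] o(1,3) by (simp add: double_points_def)
  then show ov: "\<rho> ?s = over D (\<rho> t)" using over_eqI[OF D(1)] by simp
  have sm: "smooth_plane h" using h by (simp add: oriented_diffeo_def)
  have "det2 (tangent D' ?s) (tangent D' t) = deriv \<rho> ?s * (deriv \<rho> t *
      (jacobian h (curve D (\<rho> t)) * det2 (tangent D (\<rho> ?s)) (tangent D (\<rho> t))))"
    using carried_tangent[OF ca h D(1) proper_interior(1)[OF D(2) t]]
      carried_tangent[OF ca h D(1) proper_interior(2)[OF D(2) t]] det2_frechet[OF sm] eq by simp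
  moreover have "jacobian h (curve D (\<rho> t)) > 0" using h by (simp add: oriented_diffeo_def)
  ultimately show "along_normal D' t = along_normal D (\<rho> t)"
    using carried_props(6)[OF ca o(1)] carried_props(6)[OF ca o(3)] ov
    by (simp add: along_normal_det2 zero_less_mult_iff)
qed

lemma carried_unders:
  assumes "carried_to h \<rho> D D'" "A \<subseteq> params D'"
  shows "unders D \<inter> \<rho> ` A = \<rho> ` (unders D' \<inter> A)"
proof -
  have "t \<in> unders D' \<longleftrightarrow> \<rho> t \<in> unders D" if "t \<in> A" for t
    using carried_props(3)[OF assms(1)] assms(2) that by blast
  then show ?thesis by auto
qed

context
  fixes h \<rho> D D' and c c' :: "real \<Rightarrow> 'a"
  assumes ca: "carried_to h \<rho> D D'" and h: "oriented_diffeo h"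
    and reg: "regular_diagram D" and pd: "proper_diagram D'"
    and c: "\<And>t. t \<in> params D' \<Longrightarrow> c' t = c (\<rho> t)"
begin

lemma carried_words:
  assumes A: "A \<subseteq> params D'" "strict_mono_on A \<rho>"
  shows "passes D c (\<rho> ` A) = passes D' c' A"
    "param_longitude D c (\<rho> ` A) = param_longitude D' c' A"
proof -
  note reg' = proper_regular[OF pd]
  have fin: "finite (unders D' \<inter> A)" using finite_unders[OF reg'] by simp
  have mono: "strict_mono_on (unders D' \<inter> A) \<rho>"
    using A(2) by (rule monotone_on_subset) simp
  have "over D' t \<in> params D'" "t \<in> params D'" if "t \<in> unders D' \<inter> A" for t
    using over_props(1,3)[OF reg'] that by auto
  then show "passes D c (\<rho> ` A) = passes D' c' A"
    "param_longitude D c (\<rho> ` A) = param_longitude D' c' A"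
    unfolding passes_def param_longitude_def carried_unders[OF ca A(1)] word_image[OF fin mono]
    using carried_crossing[OF ca h reg pd] c by (auto intro!: word_cong)
qed

lemma carried_segment:
  assumes st: "s \<le> t" "{s..t} \<subseteq> params D'"
  shows "\<rho> s \<le> \<rho> t" "\<rho> ` {s..t} = {\<rho> s..\<rho> t}" "\<rho> ` {s..<t} = {\<rho> s..<\<rho> t}"
    "passes D c {\<rho> s..<\<rho> t} = passes D' c' {s..<t}"
    "param_longitude D c {\<rho> s..\<rho> t} = param_longitude D' c' {s..t}"
proof -
  have mono: "strict_mono_on {s..t} \<rho>" by (rule carried_strict_mono[OF ca st(2)])
  have less: "\<rho> a < \<rho> b" if "a \<in> {s..t}" "b \<in> {s..t}" "a < b" for a b
    using mono that by (simp add: strict_mono_onD)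
  show le: "\<rho> s \<le> \<rho> t" using less[of s t] st(1) by (cases "s = t") auto
  have "{\<rho> s..\<rho> t} \<subseteq> \<rho> ` {s..t}"
  proof
    fix y assume "y \<in> {\<rho> s..\<rho> t}"
    then show "y \<in> \<rho> ` {s..t}"
      using IVT'[of \<rho> s y t] st(1) carried_continuous[OF ca] by auto
  qed
  moreover have "\<rho> r \<in> {\<rho> s..\<rho> t}" if "r \<in> {s..t}" for r
  proof -
    have "\<rho> s \<le> \<rho> r" using less[of s r] that by (cases "s = r") auto
    moreover have "\<rho> r \<le> \<rho> t" using less[of r t] that by (cases "r = t") auto
    ultimately show ?thesis by simp
  qed
  ultimately show im: "\<rho> ` {s..t} = {\<rho> s..\<rho> t}" by blast
  have inj: "inj_on \<rho> {s..t}" using mono by (rule strict_mono_on_imp_inj_on)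
  have "\<rho> ` {s..<t} = \<rho> ` ({s..t} - {t})"
    by (rule arg_cong[where f = "image \<rho>"]) auto
  also have "\<dots> = {\<rho> s..\<rho> t} - {\<rho> t}"
    using inj_on_image_set_diff[OF inj, of "{s..t}" "{t}"] st(1) im by simp
  also have "\<dots> = {\<rho> s..<\<rho> t}" by auto
  finally show im2: "\<rho> ` {s..<t} = {\<rho> s..<\<rho> t}" .
  have sub: "{s..<t} \<subseteq> params D'" using st(2) by (auto simp: subset_iff)
  have "strict_mono_on {s..<t} \<rho>" using mono by (rule monotone_on_subset) auto
  from carried_words(1)[OF sub this]
  show "passes D c {\<rho> s..<\<rho> t} = passes D' c' {s..<t}" unfolding im2 .
  from carried_words(2)[OF st(2) mono]
  show "param_longitude D c {\<rho> s..\<rho> t} = param_longitude D' c' {s..t}" unfolding im .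
qed

lemma carried_flows:
  assumes "A \<subseteq> params D'"
  shows "flows Q D' c' A \<longleftrightarrow> (\<forall>s t. s \<le> t \<longrightarrow> {s..t} \<subseteq> A \<longrightarrow>
    c (\<rho> t) = act Q (passes D c {\<rho> s..<\<rho> t}) (c (\<rho> s)))"
proof -
  have "(c' t = act Q (passes D' c' {s..<t}) (c' s)) =
      (c (\<rho> t) = act Q (passes D c {\<rho> s..<\<rho> t}) (c (\<rho> s)))"
    if "s \<le> t" "{s..t} \<subseteq> A" for s t
  proof -
    have "{s..t} \<subseteq> params D'" "s \<in> {s..t}" "t \<in> {s..t}" using that assms by auto
    then show ?thesis using carried_segment(4)[OF that(1)] c by (metis subsetD)
  qed
  then show ?thesis unfolding flows_def by blast
qed

end

text \<open>
  A planar isotopy changes neither the crossings nor their order. Parameter intervals of the new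
  diagram have to be mapped onto all parameter intervals of the old one; this says that
  components correspond to components.
\<close>

lemma (in quandle) carried_longitude_sum:
  assumes ca: "carried_to h \<rho> D D'" and h: "oriented_diffeo h"
    and D: "regular_diagram D" "proper_diagram D'"
    and onto: "\<rho> ` params D' = params D"
    and lift: "\<And>s t. s \<le> t \<Longrightarrow> {s..t} \<subseteq> params D \<Longrightarrow>
      \<exists>s' t'. s' \<le> t' \<and> {s'..t'} \<subseteq> params D' \<and> \<rho> s' = s \<and> \<rho> t' = t"
    and \<beta>: "\<And>c c'. (\<And>t. t \<in> params D' \<Longrightarrow> c' t = c (\<rho> t)) \<Longrightarrow> \<beta> c \<longleftrightarrow> \<beta> c'"
    and S: "S1 \<subseteq> params D'" "strict_mono_on S1 \<rho>" "\<rho> ` S1 = S1"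
      "S2 \<subseteq> params D'" "strict_mono_on S2 \<rho>" "\<rho> ` S2 = S2"
  shows "longitude_sum Q D \<beta> S1 S2 x = longitude_sum Q D' \<beta> S1 S2 x"
  unfolding longitude_sum_def
proof (rule sum_eq_by_matching[where R = "\<lambda>c c'. \<forall>t\<in>params D'. c' t = c (\<rho> t)"])
  let ?g = "inv_into (params D') \<rho>"
  note inj = carried_props(4)[OF ca]
  have g: "?g t \<in> params D'" "\<rho> (?g t) = t" if "t \<in> params D" for t
    using that onto inv_into_into[of t \<rho> "params D'"] f_inv_into_f[of t \<rho> "params D'"] by auto
  show "\<exists>c'\<in>{c \<in> param_colorings D' Q. \<beta> c}. \<forall>t\<in>params D'. c' t = c (\<rho> t)"
    if c: "c \<in> {c \<in> param_colorings D Q. \<beta> c}" for c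
  proof
    define c' where "c' = restrict (c \<circ> \<rho>) (params D')"
    have eq: "c' t = c (\<rho> t)" if "t \<in> params D'" for t using that by (simp add: c'_def)
    have cf: "flows Q D c (params D)" using c param_coloringsD(2)[of c D] by simp
    have fl: "flows Q D' c' (params D') \<longleftrightarrow> (\<forall>s t. s \<le> t \<longrightarrow> {s..t} \<subseteq> params D' \<longrightarrow>
        c (\<rho> t) = act Q (passes D c {\<rho> s..<\<rho> t}) (c (\<rho> s)))"
      by (rule carried_flows[OF ca h D]) (use eq in auto)
    have "flows Q D' c' (params D')"
      unfolding fl
    proof (intro allI impI)
      fix s t assume st: "s \<le> t" "{s..t} \<subseteq> params D'"
      have "\<rho> s \<le> \<rho> t" and im: "\<rho> ` {s..t} = {\<rho> s..\<rho> t}"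
        using carried_segment(1,2)[OF ca h D, where c = c and c' = c', OF eq st] by auto
      moreover have "{\<rho> s..\<rho> t} \<subseteq> params D"
        unfolding im[symmetric] onto[symmetric] by (rule image_mono[OF st(2)])
      ultimately show "c (\<rho> t) = act Q (passes D c {\<rho> s..<\<rho> t}) (c (\<rho> s))"
        using flowsD[OF cf] by blast
    qed
    moreover have "c' \<in> params D' \<rightarrow>\<^sub>E carrier Q"
      using c param_coloringsD(1)[of c D] carried_props(1)[OF ca] by (auto simp: c'_def Pi_iff)
    ultimately show "c' \<in> {c \<in> param_colorings D' Q. \<beta> c}"
      using \<beta>[of c' c] eq c by (simp add: param_colorings_def)
    show "\<forall>t\<in>params D'. c' t = c (\<rho> t)" using eq by simp
  qed
  show "\<exists>c\<in>{c \<in> param_colorings D Q. \<beta> c}. \<forall>t\<in>params D'. c' t = c (\<rho> t)"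
    if c': "c' \<in> {c \<in> param_colorings D' Q. \<beta> c}" for c'
  proof
    define c where "c = restrict (c' \<circ> ?g) (params D)"
    have eq: "c' t = c (\<rho> t)" if "t \<in> params D'" for t
      using that carried_props(1)[OF ca that] inj by (simp add: c_def)
    have iff: "flows Q D' c' (params D') \<longleftrightarrow> (\<forall>s t. s \<le> t \<longrightarrow> {s..t} \<subseteq> params D' \<longrightarrow>
        c (\<rho> t) = act Q (passes D c {\<rho> s..<\<rho> t}) (c (\<rho> s)))"
      by (rule carried_flows[OF ca h D]) (use eq in auto)
    have fl: "flows Q D' c' (params D')" using c' param_coloringsD(2)[of c' D'] by simp
    have "flows Q D c (params D)"
      unfolding flows_def
    proof (intro allI impI)
      fix s t assume "s \<le> t" "{s..t} \<subseteq> params D"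
      then obtain s' t' where "s' \<le> t'" "{s'..t'} \<subseteq> params D'" "\<rho> s' = s" "\<rho> t' = t"
        using lift by blast
      then show "c t = act Q (passes D c {s..<t}) (c s)"
        using fl unfolding iff by blast
    qed
    moreover have "c \<in> params D \<rightarrow>\<^sub>E carrier Q"
      using c' param_coloringsD(1)[of c' D'] g by (auto simp: c_def Pi_iff)
    ultimately show "c \<in> {c \<in> param_colorings D Q. \<beta> c}"
      using \<beta>[of c' c] eq c' by (simp add: param_colorings_def)
    show "\<forall>t\<in>params D'. c' t = c (\<rho> t)" using eq by simp
  qed
  show "a = a'" if "a \<in> {c \<in> param_colorings D Q. \<beta> c}" "a' \<in> {c \<in> param_colorings D Q. \<beta> c}"
    "\<forall>t\<in>params D'. b t = a (\<rho> t)" "\<forall>t\<in>params D'. b t = a' (\<rho> t)" for a a' b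
  proof (rule extensionalityI[of _ "params D"])
    show "a t = a' t" if "t \<in> params D" for t
      using g[OF that] \<open>\<forall>t\<in>params D'. b t = a (\<rho> t)\<close> \<open>\<forall>t\<in>params D'. b t = a' (\<rho> t)\<close> by metis
  qed (use that param_coloringsD(3)[of _ D] in auto)
  show "b = b'" if "b \<in> {c \<in> param_colorings D' Q. \<beta> c}" "b' \<in> {c \<in> param_colorings D' Q. \<beta> c}"
    "\<forall>t\<in>params D'. b t = a (\<rho> t)" "\<forall>t\<in>params D'. b' t = a (\<rho> t)" for a b b'
    by (rule extensionalityI[of _ "params D'"]) (use that param_coloringsD(3)[of _ D'] in auto)
  show "Poly_Mapping.single (act Q (param_longitude D a S1 @ param_longitude D a S2) x) 1 =
      Poly_Mapping.single (act Q (param_longitude D' b S1 @ param_longitude D' b S2) x) (1::int)"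
    if "\<forall>t\<in>params D'. b t = a (\<rho> t)" for a b
  proof -
    have eq: "b t = a (\<rho> t)" if "t \<in> params D'" for t using that \<open>\<forall>t\<in>params D'. b t = a (\<rho> t)\<close> by blast
    show ?thesis
      using carried_words(2)[OF ca h D, where c = a and c' = b, OF eq S(1,2)] carried_words(2)[OF ca h D, where c = a and c' = b, OF eq S(4,5)] S(3,6) by simp
  qed
qed

lemma (in quandle) long_knot_isotopy:
  assumes D: "long_knot_diagram D" "long_knot_diagram D'" and iso: "planar_isotopic A D D'"
  shows "longitude_sum Q D (initially q) UNIV {} x = longitude_sum Q D' (initially q) UNIV {} x"
proof -
  have P: "params D = UNIV" "params D' = UNIV" using D by (auto simp: long_knot_diagram_def)
  obtain H \<rho> where H: "\<forall>t\<in>{0..1::real}. oriented_diffeo (H t) \<and> (\<forall>z\<in>A. H t z = z)"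
    and \<rho>: "strict_mono_on (params D') \<rho>" "\<rho> ` params D' = params D" "carried_to (H 1) \<rho> D D'"
    using iso unfolding planar_isotopic_def by blast
  have h: "oriented_diffeo (H 1)" using H by auto
  have mono: "strict_mono \<rho>" using \<rho>(1) P by simp
  have surj: "surj \<rho>" using \<rho>(2) P by simp
  show ?thesis
  proof (rule carried_longitude_sum[OF \<rho>(3) h proper_regular[OF long_knot_proper[OF D(1)]]
        long_knot_proper[OF D(2)] \<rho>(2)])
    show "\<exists>s' t'. s' \<le> t' \<and> {s'..t'} \<subseteq> params D' \<and> \<rho> s' = s \<and> \<rho> t' = t" if st: "s \<le> t" for s t
    proof -
      obtain s' t' where "\<rho> s' = s" "\<rho> t' = t" using surj by (metis surjD)
      then show ?thesis using st mono P by (metis subset_UNIV strict_mono_less_eq)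
    qed
    fix c c' :: "real \<Rightarrow> 'a" assume "\<And>t. t \<in> params D' \<Longrightarrow> c' t = c (\<rho> t)"
    then have eq: "c' t = c (\<rho> t)" for t using P by simp
    show "initially q c \<longleftrightarrow> initially q c'"
    proof
      assume "initially q c"
      then obtain M where M: "\<forall>t\<le>M. c t = q" by (auto simp: initially_def)
      obtain N where "\<rho> N = M" using surj by (metis surjD)
      then have "\<forall>t\<le>N. c' t = q" using M eq mono by (metis strict_mono_less_eq)
      then show "initially q c'" by (auto simp: initially_def)
    next
      assume "initially q c'"
      then obtain M where M: "\<forall>t\<le>M. c' t = q" by (auto simp: initially_def)
      have "c t = q" if "t \<le> \<rho> M" for t
      proof -
        obtain s where "\<rho> s = t" using surj by (metis surjD)
        then show ?thesis using M eq mono that by (metis strict_mono_less_eq)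
      qed
      then show "initially q c" by (auto simp: initially_def)
    qed
  qed (use P \<rho> in auto)
qed

text \<open>
  An increasing continuous map cannot carry a connected strand across the gap between the strands.
\<close>

lemma strand_correspondence:
  assumes mono: "strict_mono_on (strand1 \<union> strand2) \<rho>"
    and onto: "\<rho> ` (strand1 \<union> strand2) = strand1 \<union> strand2" and con: "continuous_on UNIV \<rho>"
  shows "\<rho> 0 = 0" "\<rho> 1 = 1" "\<rho> 2 = 2" "\<rho> 3 = 3"
proof -
  let ?P = "{0..1} \<union> {2..3::real}"
  have P: "strand1 \<union> strand2 = ?P" by (simp add: strand1_def strand2_def)
  have into: "\<rho> t \<in> ?P" if "t \<in> ?P" for t using onto that unfolding P by blast
  have le: "\<rho> s \<le> \<rho> t" if "s \<in> ?P" "t \<in> ?P" "s \<le> t" for s t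
    using strict_mono_onD[OF mono[unfolded P] that(1,2)] that(3) by (cases "s = t") auto
  have pre: "\<exists>s\<in>?P. \<rho> s = t" if "t \<in> ?P" for t
    using onto that unfolding P by (metis imageE)
  have seg: "{\<rho> a..\<rho> b} \<subseteq> ?P" if ab: "a \<le> b" "{a..b} \<subseteq> ?P" for a b
  proof
    fix y assume "y \<in> {\<rho> a..\<rho> b}"
    then obtain r where "r \<in> {a..b}" "\<rho> r = y"
      using IVT'[of \<rho> a y b] ab(1) continuous_on_subset[OF con] by auto
    then show "y \<in> ?P" using into ab(2) by blast
  qed
  show z: "\<rho> 0 = 0"
  proof -
    have "0 \<in> ?P" by simp
    then obtain s where s: "s \<in> ?P" "\<rho> s = 0" using pre by blast
    then show ?thesis using le[of 0 s] into[of 0] by auto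
  qed
  show h: "\<rho> 3 = 3"
  proof -
    have "3 \<in> ?P" by simp
    then obtain s where s: "s \<in> ?P" "\<rho> s = 3" using pre by blast
    then show ?thesis using le[of s 3] into[of 3] by auto
  qed
  have one: "\<rho> 1 \<le> 1"
  proof (rule ccontr)
    assume "\<not> \<rho> 1 \<le> 1"
    then have "\<rho> 1 \<ge> 2" using into[of 1] by auto
    then have "3/2 \<in> {\<rho> 0..\<rho> 1}" using z by simp
    moreover have "{\<rho> 0..\<rho> 1} \<subseteq> ?P" by (rule seg) auto
    ultimately have "3/2 \<in> ?P" by (metis subsetD)
    then show False by auto
  qed
  have two: "\<rho> 2 \<ge> 2"
  proof (rule ccontr)
    assume "\<not> \<rho> 2 \<ge> 2"
    then have "\<rho> 2 \<le> 1" using into[of 2] by auto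
    then have "3/2 \<in> {\<rho> 2..\<rho> 3}" using h by simp
    moreover have "{\<rho> 2..\<rho> 3} \<subseteq> ?P" by (rule seg) auto
    ultimately have "3/2 \<in> ?P" by (metis subsetD)
    then show False by auto
  qed
  show "\<rho> 1 = 1"
  proof -
    have "1 \<in> ?P" by simp
    then obtain s where s: "s \<in> ?P" "\<rho> s = 1" using pre by blast
    then have "s \<le> 1" using le[of 2 s] two by fastforce
    then show ?thesis using le[of s 1] s one by auto
  qed
  show "\<rho> 2 = 2"
  proof -
    have "2 \<in> ?P" by simp
    then obtain s where s: "s \<in> ?P" "\<rho> s = 2" using pre by blast
    then have "s \<ge> 2" using le[of s 1] one by fastforce
    then show ?thesis using le[of 2 s] s two by auto
  qed
qed

lemma (in quandle) tangle_isotopy: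
  assumes D: "tangle_diagram D" "tangle_diagram D'" and iso: "planar_isotopic A D D'"
    and S: "{S1, S2} = {strand1, strand2}"
  shows "longitude_sum Q D (on_boundary q) S1 S2 x = longitude_sum Q D' (on_boundary q) S1 S2 x"
proof -
  have P: "params D = strand1 \<union> strand2" "params D' = strand1 \<union> strand2"
    using D by (auto simp: tangle_diagram_def)
  obtain H \<rho> where H: "\<forall>t\<in>{0..1::real}. oriented_diffeo (H t) \<and> (\<forall>z\<in>A. H t z = z)"
    and \<rho>: "strict_mono_on (params D') \<rho>" "\<rho> ` params D' = params D" "carried_to (H 1) \<rho> D D'"
    using iso unfolding planar_isotopic_def by blast
  have h: "oriented_diffeo (H 1)" using H by auto
  note reg = proper_regular[OF tangle_proper[OF D(1)]] and pd = tangle_proper[OF D(2)]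
  note e = strand_correspondence[OF \<rho>(1)[unfolded P] \<rho>(2)[unfolded P] carried_continuous[OF \<rho>(3)]]
  have sub: "{0..1} \<subseteq> params D'" "{2..3} \<subseteq> params D'" using P by (auto simp: strand1_def strand2_def)
  note seg = carried_segment(2)[OF \<rho>(3) h reg pd, where c = id and c' = \<rho>]
  have im: "\<rho> ` {0..1} = {0..1}" "\<rho> ` {2..3} = {2..3}"
    using seg[OF _ _ sub(1)] seg[OF _ _ sub(2)] e by simp_all
  have st: "\<rho> ` strand1 = strand1" "\<rho> ` strand2 = strand2"
    using im by (simp_all add: strand1_def strand2_def)
  have mono: "strict_mono_on strand1 \<rho>" "strict_mono_on strand2 \<rho>"
    using carried_strict_mono[OF \<rho>(3)] sub by (auto simp: strand1_def strand2_def)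
  show ?thesis
  proof (rule carried_longitude_sum[OF \<rho>(3) h reg pd \<rho>(2)])
    show "\<exists>s' t'. s' \<le> t' \<and> {s'..t'} \<subseteq> params D' \<and> \<rho> s' = s \<and> \<rho> t' = t"
      if ivl: "s \<le> t" "{s..t} \<subseteq> params D" for s t
    proof -
      have "s \<in> params D" "t \<in> params D" using ivl by (auto simp: subset_iff)
      then obtain s' t' where s't': "s' \<in> params D'" "t' \<in> params D'" "\<rho> s' = s" "\<rho> t' = t"
        using \<rho>(2) by (metis imageE)
      have le: "a \<le> b" if "\<rho> a \<le> \<rho> b" "a \<in> params D'" "b \<in> params D'" for a b
        using strict_mono_onD[OF \<rho>(1) that(3,2)] that(1) by fastforce
      have "{s'..t'} \<subseteq> params D'"
      proof (rule ccontr)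
        assume "\<not> ?thesis"
        then have st: "s' \<le> 1" "2 \<le> t'" using s't'(1,2) P by (auto simp: strand1_def strand2_def)
        have "1 \<in> params D'" "2 \<in> params D'" using sub by auto
        then have "s \<le> 1" "2 \<le> t"
          using st s't' e strict_mono_onD[OF \<rho>(1), of s' 1] strict_mono_onD[OF \<rho>(1), of 2 t']
          by (cases "s' = 1"; cases "t' = 2"; simp)+
        then have "3/2 \<in> {s..t}" by simp
        then have "3/2 \<in> strand1 \<union> strand2" using ivl(2) unfolding P(1) by (metis subsetD)
        then show False by (auto simp: strand1_def strand2_def)
      qed
      then show ?thesis using le[of s' t'] s't' ivl(1) by blast
    qed
    show "on_boundary q c \<longleftrightarrow> on_boundary q c'"
      if c: "\<And>t. t \<in> params D' \<Longrightarrow> c' t = c (\<rho> t)" for c c' :: "real \<Rightarrow> 'a"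
    proof -
      have "c' 0 = c 0" "c' 1 = c 1" "c' 2 = c 2" "c' 3 = c 3"
        using c[of 0] c[of 1] c[of 2] c[of 3] e P by (simp_all add: strand1_def strand2_def)
      then show ?thesis by (simp add: on_boundary_def endpoints_def)
    qed
  qed (use S st mono P in \<open>auto simp: doubleton_eq_iff\<close>)
qed

section \<open>Invariance\<close>

lemma long_knot_class:
  assumes "K \<in> long_knots" "D \<in> K" "D' \<in> K"
  shows "equivclp long_knot_move D D'" "long_knot_diagram D"
proof -
  obtain E where E: "long_knot_diagram E" "K = {(D, D'). equivclp long_knot_move D D'} `` {E}"
    using assms(1) unfolding long_knots_def quotient_def by blast
  then have DE: "equivclp long_knot_move E D" "equivclp long_knot_move E D'" using assms(2,3) by auto
  show "equivclp long_knot_move D D'" using DE by (meson equivclp_sym equivclp_trans)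
  show "long_knot_diagram D"
    using DE(1) E(1) by (induction rule: equivclp_induct) (auto simp: long_knot_move_def)
qed

lemma tangle_class:
  assumes "T \<in> tangles" "D \<in> T" "D' \<in> T"
  shows "equivclp tangle_move D D'" "tangle_diagram D"
proof -
  obtain E where E: "tangle_diagram E" "T = {(D, D'). equivclp tangle_move D D'} `` {E}"
    using assms(1) unfolding tangles_def quotient_def by blast
  then have DE: "equivclp tangle_move E D" "equivclp tangle_move E D'" using assms(2,3) by auto
  show "equivclp tangle_move D D'" using DE by (meson equivclp_sym equivclp_trans)
  show "tangle_diagram D"
    using DE(1) E(1) by (induction rule: equivclp_induct) (auto simp: tangle_move_def)
qed

context quandle
begin

lemma S_Phi_invariant:
  assumes "equivclp long_knot_move D D'" and x: "x \<in> carrier Q"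
  shows "S_Phi Q q x D = S_Phi Q q x D'"
proof -
  have move: "S_Phi Q q x D = S_Phi Q q x D'" if "long_knot_move D D'" for D D'
    using that long_knot_isotopy[of D D' _ q x] long_knot_reidemeister[of D D' x q] x
    by (auto simp: long_knot_move_def S_Phi_eq)
  show ?thesis
    using assms(1) by (induction rule: equivclp_induct) (use move in metis)+
qed

lemma S_1_S_2_invariant:
  assumes "equivclp tangle_move D D'" and x: "x \<in> carrier Q"
  shows "S_1 Q q x D = S_1 Q q x D'" "S_2 Q q x D = S_2 Q q x D'"
proof -
  have S: "{strand1, strand2} = {strand1, strand2}" "{strand2, strand1} = {strand1, strand2}" by auto
  have move: "S_1 Q q x D = S_1 Q q x D' \<and> S_2 Q q x D = S_2 Q q x D'" if "tangle_move D D'" for D D'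
    using that tangle_isotopy[of D D' _ _ _ q x, OF _ _ _ S(1)] tangle_isotopy[of D D' _ _ _ q x, OF _ _ _ S(2)]
      tangle_reidemeister[of D D' x _ _ q, OF _ _ _ x S(1)] tangle_reidemeister[of D D' x _ _ q, OF _ _ _ x S(2)]
    by (auto simp: tangle_move_def S_1_eq S_2_eq)
  have "S_1 Q q x D = S_1 Q q x D' \<and> S_2 Q q x D = S_2 Q q x D'"
    using assms(1) by (induction rule: equivclp_induct) (use move in metis)+
  then show "S_1 Q q x D = S_1 Q q x D'" "S_2 Q q x D = S_2 Q q x D'" by auto
qed

end

section \<open>Tangles in a long knot\<close>

definition extend_by ::
  "'a \<Rightarrow> (real \<Rightarrow> real) \<Rightarrow> real set \<Rightarrow> (real \<Rightarrow> 'a) \<Rightarrow> real \<Rightarrow> 'a" where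
  "extend_by q \<rho> P c t = (if t \<in> \<rho> ` P then c (inv_into P \<rho> t) else q)"

lemma included_by_injection:
  assumes "finite B" "inj_on h A" "h ` A \<subseteq> B" "\<And>a. a \<in> A \<Longrightarrow> g (h a) = f a"
  shows "included (\<Sum>a\<in>A. Poly_Mapping.single (f a) 1) (\<Sum>b\<in>B. Poly_Mapping.single (g b) 1)"
  unfolding included_def
proof
  fix y
  have "Poly_Mapping.lookup (\<Sum>a\<in>A. Poly_Mapping.single (f a) 1) y =
      (\<Sum>a\<in>A. Poly_Mapping.lookup (Poly_Mapping.single (g (h a)) (1::int)) y)"
    using assms(4) by (simp add: lookup_sum)
  also have "\<dots> = (\<Sum>b\<in>h ` A. Poly_Mapping.lookup (Poly_Mapping.single (g b) 1) y)"
    unfolding sum.reindex[OF assms(2)] by (simp add: comp_def)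
  also have "\<dots> \<le> (\<Sum>b\<in>B. Poly_Mapping.lookup (Poly_Mapping.single (g b) 1) y)"
    by (rule sum_mono2[OF assms(1,3)]) (simp add: lookup_single when_def)
  finally show "Poly_Mapping.lookup (\<Sum>a\<in>A. Poly_Mapping.single (f a) (1::int)) y \<le>
      Poly_Mapping.lookup (\<Sum>b\<in>B. Poly_Mapping.single (g b) 1) y"
    by (simp add: lookup_sum)
qed

locale tangle_in_long_knot = quandle Q for Q :: "'a magma2" +
  fixes D D' :: diagram and g :: "complex \<Rightarrow> complex" and \<rho> :: "real \<Rightarrow> real"
    and l1 r1 l2 r2 :: real and q :: 'a
  assumes D: "long_knot_diagram D" and D': "tangle_diagram D'"
    and g: "oriented_diffeo g" and ca: "carried_to g \<rho> D D'"
    and region: "\<rho> ` params D' = {t \<in> params D. g (curve D t) \<in> cball 0 1}"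
    and le: "l1 \<le> r1" "l2 \<le> r2" and strands: "{l1..r1} \<union> {l2..r2} = params D'"
    and ends: "{l1, r1, l2, r2} = endpoints"
    and before: "\<rho> r1 < \<rho> l2" and q: "q \<in> carrier Q"
begin

lemma reg: "regular_diagram D" and proper: "proper_diagram D'" and P: "params D = UNIV"
  using D proper_regular long_knot_proper tangle_proper[OF D'] by (auto simp: long_knot_diagram_def)

lemma ends_param: "t \<in> endpoints \<Longrightarrow> t \<in> params D'"
  unfolding strands[symmetric] ends[symmetric] using le by auto

lemma ends_not_under:
  assumes "t \<in> endpoints"
  shows "\<rho> t \<notin> unders D"
  using carried_props(3)[OF ca ends_param[OF assms]] tangle_endpoint_not_under[OF D'] assms by blast

lemma over_outside: "t \<in> unders D \<Longrightarrow> t \<notin> \<rho> ` params D' \<Longrightarrow> over D t \<notin> \<rho> ` params D'"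
  using over_props(5)[OF reg] P by (simp add: region)

lemma images: "\<rho> ` {l1..r1} = {\<rho> l1..\<rho> r1}" "\<rho> ` {l2..r2} = {\<rho> l2..\<rho> r2}"
    "\<rho> l1 \<le> \<rho> r1" "\<rho> l2 \<le> \<rho> r2"
    "\<rho> ` params D' = {\<rho> l1..\<rho> r1} \<union> {\<rho> l2..\<rho> r2}"
proof -
  have sub: "{l1..r1} \<subseteq> params D'" "{l2..r2} \<subseteq> params D'" using strands by auto
  note s = carried_segment[OF ca g reg proper, where c = id and c' = \<rho>]
  show im: "\<rho> ` {l1..r1} = {\<rho> l1..\<rho> r1}" "\<rho> ` {l2..r2} = {\<rho> l2..\<rho> r2}"
    "\<rho> l1 \<le> \<rho> r1" "\<rho> l2 \<le> \<rho> r2"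
    using s(1,2)[OF _ le(1) sub(1)] s(1,2)[OF _ le(2) sub(2)] by simp_all
  show "\<rho> ` params D' = {\<rho> l1..\<rho> r1} \<union> {\<rho> l2..\<rho> r2}"
    unfolding strands[symmetric] image_Un im ..
qed

context
  fixes c
  assumes c: "c \<in> param_colorings D' Q" and bd: "on_boundary q c"
begin

abbreviation (input) "e \<equiv> extend_by q \<rho> (params D') c"

lemma extend_by_eq: "t \<in> params D' \<Longrightarrow> c t = e (\<rho> t)"
  using carried_props(4)[OF ca] by (simp add: extend_by_def)

lemma extend_by_outside: "t \<notin> \<rho> ` params D' \<Longrightarrow> e t = q"
  by (simp add: extend_by_def)

lemma extend_by_mem: "e t \<in> carrier Q"
  using param_coloringsD(1)[OF c] q inv_into_into[of t \<rho> "params D'"]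
  by (auto simp: extend_by_def Pi_iff)

lemma extend_by_ends: "t \<in> endpoints \<Longrightarrow> e (\<rho> t) = q"
proof -
  assume t: "t \<in> endpoints"
  then have "t \<in> params D'" by (rule ends_param)
  then show "e (\<rho> t) = q" using extend_by_eq[of t] bd t by (metis on_boundary_def)
qed

lemma extend_by_flows_strand:
  assumes lr: "l \<le> r" "{l..r} \<subseteq> params D'" "l \<in> endpoints" "r \<in> endpoints"
    and d: "d > 0" "{\<rho> l - d..\<rho> r + d} \<inter> (\<rho> ` params D' - {\<rho> l..\<rho> r}) = {}"
      "{\<rho> l - d..\<rho> r + d} \<inter> (unders D - {\<rho> l..\<rho> r}) = {}"
  shows "flows Q D e {\<rho> l - d..\<rho> r + d}"
proof (rule flows_from_base[OF reg])
  have im: "\<rho> ` {l..r} = {\<rho> l..\<rho> r}" and le': "\<rho> l \<le> \<rho> r"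
    using carried_segment(1,2)[OF ca g reg proper, where c = id and c' = \<rho>, OF _ lr(1,2)] by simp_all
  have U: "unders D \<inter> {\<rho> l - d..\<rho> r + d} \<subseteq> {\<rho> l..\<rho> r}" using d(3) by blast
  have out: "e t = q" if "t \<in> {\<rho> l - d..\<rho> r + d}" "t \<notin> {\<rho> l..\<rho> r}" for t
    using that d(2) by (intro extend_by_outside) blast
  show "unders D \<inter> {\<rho> l - d..<\<rho> l} = {}"
  proof -
    have "{\<rho> l - d..<\<rho> l} \<subseteq> {\<rho> l - d..\<rho> r + d} - {\<rho> l..\<rho> r}" using le' d(1) by auto
    then show ?thesis using U by blast
  qed
  have inside: "e t = act Q (passes D e {\<rho> l..<t}) q" if t: "t \<in> {\<rho> l..\<rho> r}" for t
  proof -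
    obtain s where s: "s \<in> {l..r}" "\<rho> s = t" using t im by (metis imageE)
    then have sub: "l \<le> s" "{l..s} \<subseteq> params D'" using lr(2) by (auto simp: subset_iff)
    have "c s = act Q (passes D' c {l..<s}) (c l)"
      by (rule flowsD[OF param_coloringsD(2)[OF c] sub])
    moreover have "passes D e {\<rho> l..<\<rho> s} = passes D' c {l..<s}"
      by (rule carried_segment(4)[OF ca g reg proper _ sub]) (rule extend_by_eq)
    moreover have "c s = e t" "c l = q"
      using extend_by_eq[of s] s sub lr(3) bd by (auto simp: on_boundary_def subset_iff)
    ultimately show ?thesis using s(2) by simp
  qed
  fix t assume t: "t \<in> {\<rho> l - d..\<rho> r + d}"
  consider "t < \<rho> l" | "t \<in> {\<rho> l..\<rho> r}" | "t > \<rho> r" by fastforce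
  then show "e t = act Q (passes D e {\<rho> l..<t}) q"
  proof cases
    case 1
    then show ?thesis using out[OF t] by simp
  next
    case 2
    then show ?thesis by (rule inside)
  next
    case 3
    have "unders D \<inter> {\<rho> r..<t} = {}"
    proof -
      have "{\<rho> r<..<t} \<subseteq> {\<rho> l - d..\<rho> r + d} - {\<rho> l..\<rho> r}" using t le' d(1) by auto
      then have "unders D \<inter> {\<rho> r<..<t} = {}" using U by blast
      moreover have "{\<rho> r..<t} = insert (\<rho> r) {\<rho> r<..<t}" using 3 by auto
      ultimately show ?thesis using ends_not_under[OF lr(4)] by simp
    qed
    then have "passes D e {\<rho> l..<t} = passes D e {\<rho> l..<\<rho> r}"
      using passes_split[OF reg le', of t e] passes_empty[of D "{\<rho> r..<t}" e] 3 by simp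
    then show ?thesis
      using inside[of "\<rho> r"] extend_by_ends[OF lr(4)] out[OF t] 3 le' by simp
  qed
qed

text \<open>
  The strands of a crossing are both inside or both outside the region of the tangle. So outside it
  only arcs of color \<open>q\<close> are passed, which fix \<open>q\<close>, inside it the rule is that of the tangle, and
  both parts fit because the boundary color is \<open>q\<close>.
\<close>

lemma extend_by_coloring: "e \<in> param_colorings D Q"
proof -
  have cl: "closed (\<rho> ` params D')" unfolding images(5) by auto
  have "flows Q D e (params D)"
  proof (rule flows_local[OF reg])
    fix x :: real
    have strand: "\<exists>d>0. flows Q D e {\<rho> l - d..\<rho> r + d}"
      if lr: "l \<le> r" "{l..r} \<subseteq> params D'" "l \<in> endpoints" "r \<in> endpoints"
        and F: "closed F" "\<rho> ` params D' = {\<rho> l..\<rho> r} \<union> F" "{\<rho> l..\<rho> r} \<inter> F = {}" for l r F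
    proof -
      have le': "\<rho> l \<le> \<rho> r"
        using carried_segment(1)[OF ca g reg proper, where c = id and c' = \<rho>, OF _ lr(1,2)] by simp
      have "closed (F \<union> (unders D - {\<rho> l..\<rho> r}))"
        by (rule closed_Un[OF F(1)], rule finite_imp_closed) (use finite_unders[OF reg] in simp)
      then obtain d where d: "d > 0" "{\<rho> l - d..\<rho> r + d} \<inter> (F \<union> (unders D - {\<rho> l..\<rho> r})) = {}"
        using collar[OF _ le'] F(3) by blast
      have "flows Q D e {\<rho> l - d..\<rho> r + d}"
        by (rule extend_by_flows_strand[OF lr d(1)]) (use d(2) F(2) in blast)+
      then show ?thesis using d(1) by blast
    qed
    have near: "\<exists>d>0. \<forall>s t. s \<le> x \<and> x \<le> t \<and> t - s < d \<and> {s..t} \<subseteq> params D \<longrightarrow>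
        e t = act Q (passes D e {s..<t}) (e s)"
      if x: "x \<in> {a..b}" and fl: "\<exists>d>0. flows Q D e {a-d..b+d}" for a b
    proof -
      obtain d where d: "d > 0" "flows Q D e {a-d..b+d}" using fl by blast
      have "e t = act Q (passes D e {s..<t}) (e s)" if "s \<le> x" "x \<le> t" "t - s < d" for s t
        by (rule flowsD[OF d(2)]) (use that x in auto)
      then show ?thesis using d(1) by blast
    qed
    have dj: "{\<rho> l1..\<rho> r1} \<inter> {\<rho> l2..\<rho> r2} = {}" using before by auto
    have E: "l1 \<in> endpoints" "r1 \<in> endpoints" "l2 \<in> endpoints" "r2 \<in> endpoints" using ends by auto
    consider "x \<notin> \<rho> ` params D'" | "x \<in> {\<rho> l1..\<rho> r1}" | "x \<in> {\<rho> l2..\<rho> r2}"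
      using images(5) by blast
    then show "\<exists>d>0. \<forall>s t. s \<le> x \<and> x \<le> t \<and> t - s < d \<and> {s..t} \<subseteq> params D \<longrightarrow>
        e t = act Q (passes D e {s..<t}) (e s)"
    proof cases
      case 1
      then obtain d where d: "d > 0" "ball x d \<subseteq> - \<rho> ` params D'"
        using cl open_contains_ball_eq[of "- \<rho> ` params D'"] by blast
      have "e t = act Q (passes D e {s..<t}) (e s)" if st: "s \<le> x" "x \<le> t" "t - s < d" for s t
      proof -
        have ball: "u \<notin> \<rho> ` params D'" if "u \<in> {s..t}" for u
          using d(2) st that by (auto simp: ball_eq_greaterThanLessThan subset_iff)
        have "act Q (passes D e {s..<t}) q = q"
          unfolding passes_def
        proof (rule act_word_id[OF q])
          fix u assume u: "u \<in> unders D \<inter> {s..<t}"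
          then have "over D u \<notin> \<rho> ` params D'" using over_outside ball by auto
          then show "act Q (passing D e u) q = q" using extend_by_outside q by simp
        qed
        then show ?thesis using extend_by_outside ball st by simp
      qed
      then show ?thesis using d(1) by blast
    next
      case 2
      show ?thesis
        by (rule near[OF 2], rule strand[OF le(1) _ E(1,2) _ images(5) dj]) (use strands in auto)
    next
      case 3
      show ?thesis
        by (rule near[OF 3], rule strand[OF le(2) _ E(3,4), of "{\<rho> l1..\<rho> r1}"])
          (use strands images(5) dj in auto)
    qed
  qed
  then show ?thesis using extend_by_mem P by (simp add: param_colorings_def PiE_iff)
qed

text \<open>Where everything has color \<open>q\<close>, each crossing contributes \<open>q\<close> and its inverse.\<close>

lemma extend_by_longitude:
  assumes x: "x \<in> carrier Q"
  shows "act Q (param_longitude D e UNIV) x =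
    act Q (param_longitude D' c {l1..r1} @ param_longitude D' c {l2..r2}) x"
proof -
  let ?f = "corrected_passing D e" and ?U = "unders D"
  have fin: "finite ?U" by (rule finite_unders[OF reg])
  have mem: "act Q (word ?f A) u \<in> carrier Q" if "u \<in> carrier Q" for A u
    using that extend_by_mem by (intro act_closed word_colors) auto
  have out: "act Q (word ?f A) u = u" if "u \<in> carrier Q" "A \<subseteq> ?U - \<rho> ` params D'" for A u
  proof (rule act_word_id[OF that(1)])
    fix t assume "t \<in> A"
    then have "e t = q" "e (over D t) = q"
      using that(2) extend_by_outside over_outside by blast+
    then show "act Q (?f t) u = u" using that(1) q by simp
  qed
  define A0 A2 A4 where "A0 = ?U \<inter> {..<\<rho> l1}" and "A2 = ?U \<inter> {\<rho> r1<..<\<rho> l2}" and "A4 = ?U \<inter> {\<rho> r2<..}"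
  define A1 A3 where "A1 = ?U \<inter> {\<rho> l1..\<rho> r1}" and "A3 = ?U \<inter> {\<rho> l2..\<rho> r2}"
  note A_def = A0_def A1_def A2_def A3_def A4_def
  have finA: "finite A0" "finite A1" "finite A2" "finite A3" "finite A4" using fin by (auto simp: A_def)
  have U: "?U = A0 \<union> (A1 \<union> (A2 \<union> (A3 \<union> A4)))"
    using images(3,4) before by (auto simp: A_def)
  have "word ?f ?U = word ?f A0 @ word ?f (A1 \<union> (A2 \<union> (A3 \<union> A4)))"
    by (subst U, rule word_Un) (use finA images(3,4) before in \<open>auto simp: A_def\<close>)
  also have "word ?f (A1 \<union> (A2 \<union> (A3 \<union> A4))) = word ?f A1 @ word ?f (A2 \<union> (A3 \<union> A4))"
    by (rule word_Un) (use finA images(3,4) before in \<open>auto simp: A_def\<close>)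
  also have "word ?f (A2 \<union> (A3 \<union> A4)) = word ?f A2 @ word ?f (A3 \<union> A4)"
    by (rule word_Un) (use finA images(3,4) before in \<open>auto simp: A_def\<close>)
  also have "word ?f (A3 \<union> A4) = word ?f A3 @ word ?f A4"
    by (rule word_Un) (use finA images(3,4) before in \<open>auto simp: A_def\<close>)
  finally have "act Q (word ?f ?U) x = act Q (word ?f A4) (act Q (word ?f A3)
      (act Q (word ?f A2) (act Q (word ?f A1) (act Q (word ?f A0) x))))"
    by simp
  moreover have "A0 \<subseteq> ?U - \<rho> ` params D'" "A2 \<subseteq> ?U - \<rho> ` params D'" "A4 \<subseteq> ?U - \<rho> ` params D'"
    using images(3,4) before unfolding images(5) A_def by auto
  ultimately have "act Q (word ?f ?U) x = act Q (word ?f A3) (act Q (word ?f A1) x)"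
    using out mem x by simp
  moreover have "word ?f A1 = param_longitude D' c {l1..r1}"
    unfolding A1_def param_longitude_def[symmetric]
    by (rule carried_segment(5)[OF ca g reg proper _ le(1)]) (use extend_by_eq strands in auto)
  moreover have "word ?f A3 = param_longitude D' c {l2..r2}"
    unfolding A3_def param_longitude_def[symmetric]
    by (rule carried_segment(5)[OF ca g reg proper _ le(2)]) (use extend_by_eq strands in auto)
  ultimately show ?thesis by (simp add: param_longitude_def)
qed

lemma extend_by_initially: "initially q e"
  unfolding initially_def
proof (intro exI allI impI)
  fix t assume "t \<le> \<rho> l1 - 1"
  then show "e t = q"
    using images(3) before by (intro extend_by_outside) (auto simp: images(5))
qed

end

lemma included_in_long_knot:
  assumes fin: "finite (carrier Q)" and x: "x \<in> carrier Q"
  shows "included (longitude_sum Q D' (on_boundary q) {l1..r1} {l2..r2} x)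
    (longitude_sum Q D (initially q) UNIV {} x)"
  unfolding longitude_sum_def
proof (rule included_by_injection[where h = "extend_by q \<rho> (params D')"])
  show "finite {c \<in> param_colorings D Q. initially q c}"
    using finite_long_colorings[OF D fin] by simp
  show "inj_on (extend_by q \<rho> (params D')) {c \<in> param_colorings D' Q. on_boundary q c}"
  proof (rule inj_onI)
    fix c c' assume c: "c \<in> {c \<in> param_colorings D' Q. on_boundary q c}"
      "c' \<in> {c \<in> param_colorings D' Q. on_boundary q c}"
      "extend_by q \<rho> (params D') c = extend_by q \<rho> (params D') c'"
    show "c = c'"
    proof (rule extensionalityI[of _ "params D'"])
      show "c t = c' t" if t: "t \<in> params D'" for t
        using extend_by_eq[of c t] extend_by_eq[of c' t] c t by (metis (no_types, lifting) mem_Collect_eq)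
    qed (use c param_coloringsD(3)[of _ D'] in auto)
  qed
  show "extend_by q \<rho> (params D') ` {c \<in> param_colorings D' Q. on_boundary q c} \<subseteq>
      {c \<in> param_colorings D Q. initially q c}"
    using extend_by_coloring extend_by_initially by auto
  show "act Q (param_longitude D (extend_by q \<rho> (params D') c) UNIV @
        param_longitude D (extend_by q \<rho> (params D') c) {}) x =
      act Q (param_longitude D' c {l1..r1} @ param_longitude D' c {l2..r2}) x"
    if "c \<in> {c \<in> param_colorings D' Q. on_boundary q c}" for c
    using extend_by_longitude[of c x] that x by simp
qed

end

text \<open>
  The long knot passes through the two components of the tangle in one of the two possible orders.
\<close>

lemma (in quandle) part_of_included:
  assumes D: "long_knot_diagram D" "tangle_diagram D'" and part: "part_of D' D"
    and fin: "finite (carrier Q)" and q: "q \<in> carrier Q" and x: "x \<in> carrier Q"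
  shows "included (S_1 Q q x D') (S_Phi Q q x D) \<or> included (S_2 Q q x D') (S_Phi Q q x D)"
proof -
  obtain g \<rho> where g: "oriented_diffeo g" "carried_to g \<rho> D D'"
    "\<rho> ` params D' = {t \<in> params D. g (curve D t) \<in> cball 0 1}"
    using part unfolding part_of_def by blast
  have P: "params D' = {0..1} \<union> {2..3}"
    using D(2) by (simp add: tangle_diagram_def strand1_def strand2_def)
  note reg = proper_regular[OF long_knot_proper[OF D(1)]] and pd = tangle_proper[OF D(2)]
  note s = carried_segment[OF g(2,1) reg pd, where c = id and c' = \<rho>]
  have im: "\<rho> ` {0..1} = {\<rho> 0..\<rho> 1}" "\<rho> ` {2..3} = {\<rho> 2..\<rho> 3}" "\<rho> 0 \<le> \<rho> 1" "\<rho> 2 \<le> \<rho> 3"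
    using s(1,2)[of 0 1] s(1,2)[of 2 3] P by auto
  have dj: "{\<rho> 0..\<rho> 1} \<inter> {\<rho> 2..\<rho> 3} = {}"
  proof -
    have "\<rho> s \<noteq> \<rho> t" if "s \<in> {0..1}" "t \<in> {2..3}" for s t
      using inj_onD[OF carried_props(4)[OF g(2)], of s t] that P by auto
    then show ?thesis unfolding im(1,2)[symmetric] by blast
  qed
  have "\<rho> 1 < \<rho> 2 \<or> \<rho> 3 < \<rho> 0"
  proof (rule ccontr)
    assume "\<not> ?thesis"
    then have "max (\<rho> 0) (\<rho> 2) \<in> {\<rho> 0..\<rho> 1} \<inter> {\<rho> 2..\<rho> 3}" using im(3,4) by auto
    then show False using dj by blast
  qed
  then show ?thesis
  proof
    assume b: "\<rho> 1 < \<rho> 2"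
    interpret I: tangle_in_long_knot Q D D' g \<rho> 0 1 2 3 q
      by unfold_locales (use D g q P b in \<open>auto simp: endpoints_def\<close>)
    show ?thesis
      using I.included_in_long_knot[OF fin x] S_Phi_eq[OF D(1)] S_1_eq[OF D(2)]
      by (simp add: strand1_def strand2_def)
  next
    assume b: "\<rho> 3 < \<rho> 0"
    interpret I: tangle_in_long_knot Q D D' g \<rho> 2 3 0 1 q
      by unfold_locales (use D g q P b in \<open>auto simp: endpoints_def\<close>)
    show ?thesis
      using I.included_in_long_knot[OF fin x] S_Phi_eq[OF D(1)] S_2_eq[OF D(2)]
      by (simp add: strand1_def strand2_def)
  qed
qed

lemma (in quandle) embeds_included:
  assumes T: "T \<in> tangles" "D_T \<in> T" and K: "K \<in> long_knots" "D \<in> K" and emb: "embeds T K"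
    and fin: "finite (carrier Q)" and q: "q \<in> carrier Q" and x: "x \<in> carrier Q"
  shows "included (S_1 Q q x D_T) (S_Phi Q q x D) \<or> included (S_2 Q q x D_T) (S_Phi Q q x D)"
proof -
  obtain D' E where DE: "D' \<in> T" "E \<in> K" "part_of D' E"
    using emb unfolding embeds_def by blast
  have "S_1 Q q x D_T = S_1 Q q x D'" "S_2 Q q x D_T = S_2 Q q x D'"
    using S_1_S_2_invariant[OF tangle_class(1)[OF T DE(1)] x] by auto
  moreover have "S_Phi Q q x D = S_Phi Q q x E"
    by (rule S_Phi_invariant[OF long_knot_class(1)[OF K DE(2)] x])
  ultimately show ?thesis
    using part_of_included[OF long_knot_class(2)[OF K(1) DE(2) DE(2)]
        tangle_class(2)[OF T(1) DE(1) DE(1)] DE(3) fin q x] by simp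
qed

theorem corollary3:
  fixes T K :: "diagram set" and D_T D :: diagram
  assumes "T \<in> tangles" and "D_T \<in> T"
    and "K \<in> long_knots" and "D \<in> K"
  shows "(\<forall>Q :: 'a magma2. quandle Q \<and> finite (carrier Q) \<longrightarrow>
            (\<forall>q\<in>carrier Q. \<forall>x\<in>carrier Q. embeds T K \<longrightarrow>
               included (S_1 Q q x D_T) (S_Phi Q q x D) \<or>
               included (S_2 Q q x D_T) (S_Phi Q q x D)))
       \<and> ((\<exists>Q :: 'a magma2. quandle Q \<and> finite (carrier Q) \<and>
            (\<exists>q\<in>carrier Q. \<exists>x\<in>carrier Q.
               \<not> (included (S_1 Q q x D_T) (S_Phi Q q x D) \<or>
                  included (S_2 Q q x D_T) (S_Phi Q q x D))))
          \<longrightarrow> \<not> embeds T K)"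
proof -
  have main: "included (S_1 Q q x D_T) (S_Phi Q q x D) \<or> included (S_2 Q q x D_T) (S_Phi Q q x D)"
    if "quandle Q" "finite (carrier Q)" "q \<in> carrier Q" "x \<in> carrier Q" "embeds T K"
    for Q :: "'a magma2" and q x
    by (rule quandle.embeds_included[OF that(1) assms that(5,2,3,4)])
  show ?thesis
  proof (intro conjI allI impI ballI)
    show "included (S_1 Q q x D_T) (S_Phi Q q x D) \<or> included (S_2 Q q x D_T) (S_Phi Q q x D)"
      if "quandle Q \<and> finite (carrier Q)" "q \<in> carrier Q" "x \<in> carrier Q" "embeds T K"
      for Q :: "'a magma2" and q x
      using main[of Q q x] that by simp
  next
    assume "\<exists>Q :: 'a magma2. quandle Q \<and> finite (carrier Q) \<and>
      (\<exists>q\<in>carrier Q. \<exists>x\<in>carrier Q. \<not> (included (S_1 Q q x D_T) (S_Phi Q q x D) \<or>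
        included (S_2 Q q x D_T) (S_Phi Q q x D)))"
    then obtain Q :: "'a magma2" and q x where Q: "quandle Q" "finite (carrier Q)"
      "q \<in> carrier Q" "x \<in> carrier Q" "\<not> (included (S_1 Q q x D_T) (S_Phi Q q x D) \<or>
        included (S_2 Q q x D_T) (S_Phi Q q x D))"
      by (elim exE conjE bexE) (rule that)
    then show "\<not> embeds T K" using main[OF Q(1-4)] by blast
  qed
qed

end
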